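(* (Nichtsingulärstellensatz.) Let $L$ be a hermitian monic pencil of size $d$, and let $\widetilde{L}$ be a not necessarily square affine linear matrix polynomial in $x,x^*$, of size $\delta\times\varepsilon$ with $\delta\ge\varepsilon$. Consider the set of all matrices $D\in M_{\varepsilon\times\delta}(\mathbb{C})$, finitely many $C_k\in M_{d\times\varepsilon}(\mathbb{C})$, and $P_0\in M_\varepsilon(\mathbb{C})$ such that $P_0\succeq0$ and $$D\widetilde{L}+\widetilde{L}^*D^*=P_0+\sum_kC_k^*LC_k.\qquad(\ast)$$ (1) If the only solutions of $(\ast)$ have $P_0=0$ and $C_k=0$ for all $k$, then for some $(X,X^* )$ in the interior of $\mathcal{D}_L$, the matrix $\widetilde{L}(X,X^* )$ is rank deficient. (2) Otherwise, take a solution for which $P_0$ and the $C_k$ are not all zero and let $V=\ker P_0\cap\bigcap_k\ker C_k$. (a) If $V=\{0\}$, then $\widetilde{L}$ is full rank on $\operatorname{int}\mathcal{D}_L$. (b) If $V\neq\{0\}$, then $\widetilde{L}$ is full rank on $\operatorname{int}\mathcal{D}_L$ if and only if $\widetilde{L}|_V$ is full rank on $\operatorname{int}\mathcal{D}_L$ (and the theorem now applies with $\widetilde{L}$ replaced by the smaller pencil $\widetilde{L}|_V$).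
   Context: Let $x=(x_1,\dots,x_g)$ be freely noncommuting variables with formal adjoints $x^*=(x_1^*,\dots,x_g^* )$. A hermitian monic pencil of size $d$ is $L=I_d-\sum_{j=1}^gA_jx_j-\sum_{j=1}^gA_j^*x_j^*$ with $A_j\in M_d(\mathbb{C})$. An affine linear matrix polynomial (pencil) of size $\delta\times\varepsilon$ is $\widetilde{L}=\widetilde C+\sum_j\widetilde A_jx_j+\sum_j\widetilde B_jx_j^*$ with $\widetilde C,\widetilde A_j,\widetilde B_j\in M_{\delta\times\varepsilon}(\mathbb{C})$; its adjoint is $\widetilde{L}^*=\widetilde C^*+\sum_j\widetilde A_j^*x_j^*+\sum_j\widetilde B_j^*x_j$. For $X\in M_n(\mathbb{C})^g$, $\widetilde{L}(X,X^* )=\widetilde C\otimes I_n+\sum_j\widetilde A_j\otimes X_j+\sum_j\widetilde B_j\otimes X_j^*$, and similarly for $L$. $\mathcal{D}_L=\bigcup_n\mathcal{D}_L(n)$, with $\mathcal{D}_L(n)=\{(X,X^* ):X\in M_n(\mathbb{C})^g,\ L(X,X^* )\succeq0\}$; the interior of $\mathcal D_L$ is taken levelwise and equals $\{(X,X^* ):L(X,X^* )\succ0\}$. "$\widetilde{L}$ is full rank on $\operatorname{int}\mathcal{D}_L$" means $\widetilde{L}(X,X^* )$ has full (column) rank for every $n$ and every $(X,X^* )$ in the interior of $\mathcal{D}_L(n)$. For a subspace $V\subseteq\mathbb{C}^\varepsilon$, $\widetilde{L}|_V$ is the $\delta\times\dim V$ pencil whose coefficients are the restrictions to $V$ of the coefficients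 of $\widetilde{L}$. *)

theory Defs
  imports
    "Jordan_Normal_Form.Schur_Decomposition"
    "Jordan_Normal_Form.Matrix_Kernel"
    "Jordan_Normal_Form.DL_Rank"
begin

subsection \<open>Matrices\<close>

definition kron :: "complex mat \<Rightarrow> complex mat \<Rightarrow> complex mat" where
  "kron A B = mat (dim_row A * dim_row B) (dim_col A * dim_col B)
     (\<lambda>(i, j). A $$ (i div dim_row B, j div dim_col B) * B $$ (i mod dim_row B, j mod dim_col B))"

text \<open>The type of matrices of all sizes is not a monoid under addition, so finite sums of
  matrices of a common size are formed entrywise.\<close>

definition mat_sum :: "nat \<Rightarrow> nat \<Rightarrow> ('i \<Rightarrow> complex mat) \<Rightarrow> 'i set \<Rightarrow> complex mat" where
  "mat_sum nr nc F S = mat nr nc (\<lambda>ij. \<Sum>s\<in>S. F s $$ ij)"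

definition psd :: "nat \<Rightarrow> complex mat \<Rightarrow> bool" where
  "psd n A \<longleftrightarrow> A \<in> carrier_mat n n \<and> mat_adjoint A = A \<and>
     (\<forall>v\<in>carrier_vec n. 0 \<le> Re ((A *\<^sub>v v) \<bullet>c v))"

definition full_column_rank :: "complex mat \<Rightarrow> bool" where
  "full_column_rank M \<longleftrightarrow> vec_space.rank (dim_row M) M = dim_col M"

definition (in vec_space) basis_mat :: "'a vec set \<Rightarrow> 'a mat \<Rightarrow> bool" where
  "basis_mat W B \<longleftrightarrow> B \<in> carrier_mat n (dim_col B) \<and> distinct (cols B) \<and>
     lin_indpt (set (cols B)) \<and> span (set (cols B)) = W"

subsection \<open>Affine linear matrix polynomials in freely noncommuting variables and their adjoints\<close>

text \<open>The variables are indexed by a finite type \<open>'g\<close>.  \<open>Pencil C A B\<close> stands for the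
  polynomial with constant term \<open>C\<close>, coefficient \<open>A j\<close> at \<open>x\<^sub>j\<close> and coefficient \<open>B j\<close> at the
  adjoint variable of \<open>x\<^sub>j\<close>.  As the variables are free, equality of polynomials is
  equality of all coefficients, which is equality in this datatype.\<close>

datatype 'g pencil =
  Pencil (const_coeff: "complex mat") (x_coeff: "'g \<Rightarrow> complex mat")
    (xstar_coeff: "'g \<Rightarrow> complex mat")

definition carrier_pencil :: "nat \<Rightarrow> nat \<Rightarrow> 'g pencil set" where
  "carrier_pencil nr nc = {p. const_coeff p \<in> carrier_mat nr nc \<and>
     (\<forall>j. x_coeff p j \<in> carrier_mat nr nc) \<and> (\<forall>j. xstar_coeff p j \<in> carrier_mat nr nc)}"

definition hermitian_monic_pencil :: "nat \<Rightarrow> ('g \<Rightarrow> complex mat) \<Rightarrow> 'g pencil" where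
  "hermitian_monic_pencil d A = Pencil (1\<^sub>m d) (\<lambda>j. - A j) (\<lambda>j. - mat_adjoint (A j))"

definition const_pencil :: "nat \<Rightarrow> nat \<Rightarrow> complex mat \<Rightarrow> 'g pencil" where
  "const_pencil nr nc P = Pencil P (\<lambda>_. 0\<^sub>m nr nc) (\<lambda>_. 0\<^sub>m nr nc)"

definition pencil_add :: "'g pencil \<Rightarrow> 'g pencil \<Rightarrow> 'g pencil" where
  "pencil_add p q = Pencil (const_coeff p + const_coeff q)
     (\<lambda>j. x_coeff p j + x_coeff q j) (\<lambda>j. xstar_coeff p j + xstar_coeff q j)"

definition pencil_lmult :: "complex mat \<Rightarrow> 'g pencil \<Rightarrow> 'g pencil" where
  "pencil_lmult M p = Pencil (M * const_coeff p) (\<lambda>j. M * x_coeff p j) (\<lambda>j. M * xstar_coeff p j)"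

definition pencil_rmult :: "'g pencil \<Rightarrow> complex mat \<Rightarrow> 'g pencil" where
  "pencil_rmult p M = Pencil (const_coeff p * M) (\<lambda>j. x_coeff p j * M) (\<lambda>j. xstar_coeff p j * M)"

text \<open>Taking adjoints swaps each variable with its adjoint.\<close>

definition pencil_adjoint :: "'g pencil \<Rightarrow> 'g pencil" where
  "pencil_adjoint p = Pencil (mat_adjoint (const_coeff p))
     (\<lambda>j. mat_adjoint (xstar_coeff p j)) (\<lambda>j. mat_adjoint (x_coeff p j))"

definition mat_tuples :: "nat \<Rightarrow> ('g \<Rightarrow> complex mat) set" where
  "mat_tuples n = {X. \<forall>j. X j \<in> carrier_mat n n}"

definition pencil_eval :: "nat \<Rightarrow> 'g::finite pencil \<Rightarrow> ('g \<Rightarrow> complex mat) \<Rightarrow> complex mat" where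
  "pencil_eval n p X =
     (let nr = dim_row (const_coeff p) * n; nc = dim_col (const_coeff p) * n in
      kron (const_coeff p) (1\<^sub>m n)
      + mat_sum nr nc (\<lambda>j. kron (x_coeff p j) (X j)) UNIV
      + mat_sum nr nc (\<lambda>j. kron (xstar_coeff p j) (mat_adjoint (X j))) UNIV)"

subsection \<open>Free spectrahedra\<close>

text \<open>A pair of a tuple and its adjoint tuple is represented by the tuple alone.\<close>

definition free_spectrahedron :: "'g::finite pencil \<Rightarrow> nat \<Rightarrow> ('g \<Rightarrow> complex mat) set" where
  "free_spectrahedron L n =
     {X \<in> mat_tuples n. psd (dim_row (const_coeff L) * n) (pencil_eval n L X)}"

text \<open>Topological interior at level \<open>n\<close>, relative to the space of all tuples of complex \<open>n \<times> n\<close>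
  matrices; the norm is the maximum of the moduli of all entries (all norms are equivalent
  here).\<close>

definition interior_spectrahedron :: "'g::finite pencil \<Rightarrow> nat \<Rightarrow> ('g \<Rightarrow> complex mat) set" where
  "interior_spectrahedron L n = {X \<in> mat_tuples n. \<exists>r>0. \<forall>Y\<in>mat_tuples n.
     (\<forall>j. \<forall>a<n. \<forall>b<n. cmod (Y j $$ (a, b) - X j $$ (a, b)) < r) \<longrightarrow> Y \<in> free_spectrahedron L n}"

definition full_rank_on_interior :: "'g::finite pencil \<Rightarrow> 'g pencil \<Rightarrow> bool" where
  "full_rank_on_interior L Lt \<longleftrightarrow>
     (\<forall>n>0. \<forall>X\<in>interior_spectrahedron L n. full_column_rank (pencil_eval n Lt X))"

subsection \<open>The certificate\<close>

text \<open>\<open>D Lt + Lt\<^sup>* D\<^sup>* = P0 + \<Sum>C. C\<^sup>* L C\<close>, with \<open>C\<close> running through the list \<open>Cs\<close>.\<close>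

definition is_certificate ::
  "nat \<Rightarrow> nat \<Rightarrow> nat \<Rightarrow> 'g pencil \<Rightarrow> 'g pencil \<Rightarrow>
   complex mat \<Rightarrow> complex mat \<Rightarrow> complex mat list \<Rightarrow> bool" where
  "is_certificate d \<delta> \<epsilon> L Lt D P0 Cs \<longleftrightarrow>
     D \<in> carrier_mat \<epsilon> \<delta> \<and> psd \<epsilon> P0 \<and> set Cs \<subseteq> carrier_mat d \<epsilon> \<and>
     pencil_add (pencil_lmult D Lt) (pencil_rmult (pencil_adjoint Lt) (mat_adjoint D)) =
     foldr (\<lambda>C. pencil_add (pencil_lmult (mat_adjoint C) (pencil_rmult L C))) Cs
       (const_pencil \<epsilon> \<epsilon> P0)"

definition is_zero_solution :: "nat \<Rightarrow> nat \<Rightarrow> complex mat \<Rightarrow> complex mat list \<Rightarrow> bool" where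
  "is_zero_solution d \<epsilon> P0 Cs \<longleftrightarrow> P0 = 0\<^sub>m \<epsilon> \<epsilon> \<and> (\<forall>C\<in>set Cs. C = 0\<^sub>m d \<epsilon>)"

text \<open>The restriction of a pencil to a subspace with basis the columns of \<open>B\<close>, written as a
  matrix pencil with respect to that basis, is \<open>pencil_rmult p B\<close>.\<close>

definition common_kernel :: "complex mat \<Rightarrow> complex mat list \<Rightarrow> complex vec set" where
  "common_kernel P0 Cs = mat_kernel P0 \<inter> (\<Inter>C\<in>set Cs. mat_kernel C)"

end

theory Submission
  imports "HOL-Analysis.Function_Topology" "HOL-Analysis.Topology_Euclidean_Space" Defs
begin

text \<open>
  Part (2): if \<open>Lt(X) v = 0\<close> for some \<open>X\<close> in the interior, where \<open>L(X)\<close> is positive definite, then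
  evaluating the certificate at \<open>X\<close> and pairing with \<open>v\<close> makes every summand vanish, so all
  slices of \<open>v\<close> lie in the common kernel.

  Part (1): the pencils \<open>P0 + \<Sum> C\<^sup>* L C\<close> form a closed pointed convex cone, which by assumption meets
  the real space of all \<open>D Lt + Lt\<^sup>* D\<^sup>*\<close> only in \<open>0\<close>. A functional that vanishes on this space and
  is strictly positive on the rest of the cone is given by a hermitian matrix \<open>\<Gamma>0\<close> and matrices \<open>\<Gamma>\<^sub>j\<close> of
  size \<open>\<epsilon>\<close>. Positivity on the \<open>P0\<close> gives \<open>\<Gamma>0 = G G\<^sup>*\<close> with \<open>G\<close> invertible, positivity on the \<open>C\<^sup>* L C\<close>
  says that the transposes \<open>X\<^sub>j\<close> of \<open>G\<^sup>-\<^sup>1 \<Gamma>\<^sub>j G\<^sup>-\<^sup>*\<close> satisfy \<open>L(X) > 0\<close>, and the vanishing says that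
  \<open>Lt(X)\<close> annihilates the vectorised \<open>G\<close>. In particular level \<open>n = \<epsilon>\<close> suffices.
\<close>

unbundle no vec_syntax

subsection \<open>Strict separation of a compact convex set from a subspace\<close>

text \<open>Closedness of the cone is the real obstacle: the number of matrices C is unbounded, and
  a limit of such sums has to be such a sum again. What helps is that the sum depends only, and
  linearly, on the Gram matrix of the stacked matrices, whose size is fixed by \<open>d\<close> and
  \<open>\<epsilon>\<close>. Normalising its trace to 1 cuts the cone down to a compact convex set,
  and a square Gram factor always exists. So a compact set is separated from a subspace, and no
  closure argument remains. Pointedness needs no separate proof either: if 0 lay in the compact set,
  it would come from a nonzero solution with multiplier D = 0, and such solutions are excluded
  together with all others.

  Separation and compactness take place in spaces of functions with the product topology, where
  finite index sets select the coordinates that count; matrices enter through their entries.\<close>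

lemma continuous_on_coordinate: "continuous_on K (\<lambda>x. x i)"
  by (rule continuous_on_subset[OF continuous_on_product_coordinates subset_UNIV])

text \<open>The point of \<open>K\<close> nearest to 0 serves as \<open>l\<close>: moving from it
  towards any \<open>k\<close> stays in \<open>K\<close> and cannot shorten it, so its inner product
  with \<open>k\<close> is at least its own squared length. Only coordinates in \<open>I\<close> are
  measured, so positivity of that length is what \<open>ne\<close> supplies.\<close>

lemma compact_convex_positive_functional:
  fixes K :: "('i \<Rightarrow> 'b::real_inner) set"
  assumes "finite I" "compact K" "K \<noteq> {}"
    and conv: "\<And>x y t. x \<in> K \<Longrightarrow> y \<in> K \<Longrightarrow> 0 \<le> t \<Longrightarrow> t \<le> 1 \<Longrightarrow> (\<lambda>i. (1-t) *\<^sub>R x i + t *\<^sub>R y i) \<in> K"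
    and ne: "\<And>k. k \<in> K \<Longrightarrow> \<exists>i\<in>I. k i \<noteq> 0"
  shows "\<exists>l. \<forall>k\<in>K. 0 < (\<Sum>i\<in>I. inner (l i) (k i))"
proof -
  have "continuous_on K (\<lambda>k. \<Sum>i\<in>I. inner (k i) (k i))"
    by (intro continuous_on_sum continuous_on_inner continuous_on_coordinate)
  from continuous_attains_inf[OF assms(2,3) this]
  obtain l where l: "l \<in> K" and min: "\<And>k. k \<in> K \<Longrightarrow> (\<Sum>i\<in>I. inner (l i) (l i)) \<le> (\<Sum>i\<in>I. inner (k i) (k i))"
    by auto
  have "0 < (\<Sum>i\<in>I. inner (l i) (k i))" if k: "k \<in> K" for k
  proof -
    define a b c where "a = (\<Sum>i\<in>I. inner (l i) (l i))" and "b = (\<Sum>i\<in>I. inner (l i) (k i))"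
      and "c = (\<Sum>i\<in>I. inner (k i - l i) (k i - l i))"
    have "a > 0"
      unfolding a_def using ne[OF l] assms(1) by (auto intro!: sum_pos2)
    have c0: "c \<ge> 0" unfolding c_def by (auto intro!: sum_nonneg)
    \<comment> \<open>The squared length along the segment from \<open>l\<close> to
      \<open>k\<close>, minus its minimum \<open>a\<close>, divided by \<open>t\<close>.\<close>
    have *: "0 \<le> 2 * (b - a) + t * c" if t: "0 < t" "t \<le> 1" for t
    proof -
      have "(\<Sum>i\<in>I. inner ((1-t) *\<^sub>R l i + t *\<^sub>R k i) ((1-t) *\<^sub>R l i + t *\<^sub>R k i))
         = a + t * (2 * (b - a) + t * c)"
        unfolding a_def b_def c_def
        by (simp add: sum.distrib sum_distrib_left sum_subtractf inner_add inner_diff algebra_simps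
              inner_commute power2_eq_square)
      with min[OF conv[OF l k, of t]] t have "0 \<le> t * (2 * (b - a) + t * c)"
        unfolding a_def by auto
      with t show ?thesis by (simp add: zero_le_mult_iff)
    qed
    have "b \<ge> a"
    proof (rule ccontr)
      assume "\<not> b \<ge> a"
      \<comment> \<open>Small enough that \<open>t * c\<close> is at most \<open>a - b\<close>, half
        of the linear deficit \<open>2 * (a - b)\<close>; the \<open>+ 1\<close> covers
        \<open>c = 0\<close>.\<close>
      define t where "t = min 1 ((a - b) / (c + 1))"
      have t: "0 < t" "t \<le> 1" using \<open>\<not> b \<ge> a\<close> c0 by (auto simp: t_def)
      have "t * c \<le> (a - b) / (c + 1) * c"
        using c0 by (intro mult_right_mono) (auto simp: t_def)
      also have "\<dots> \<le> a - b" using \<open>\<not> b \<ge> a\<close> c0 by (simp add: field_simps)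
      finally show False using *[OF t] \<open>\<not> b \<ge> a\<close> by auto
    qed
    with \<open>a > 0\<close> show ?thesis by (simp add: b_def)
  qed
  thus ?thesis by blast
qed

text \<open>Induction on the generators of the subspace: the orthogonal projection along one of them
  removes it, and the projection is self-adjoint.\<close>

lemma compact_convex_separation:
  fixes K :: "('i \<Rightarrow> 'b::real_inner) set" and u :: "'j \<Rightarrow> 'i \<Rightarrow> 'b"
  assumes "finite J" "finite I" "compact K"
    and "\<And>x y t. x \<in> K \<Longrightarrow> y \<in> K \<Longrightarrow> 0 \<le> t \<Longrightarrow> t \<le> 1 \<Longrightarrow> (\<lambda>i. (1-t) *\<^sub>R x i + t *\<^sub>R y i) \<in> K"
    and "\<And>k c. k \<in> K \<Longrightarrow> \<exists>i\<in>I. k i \<noteq> (\<Sum>j\<in>J. c j *\<^sub>R u j i)"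
  shows "\<exists>l. (\<forall>j\<in>J. (\<Sum>i\<in>I. inner (l i) (u j i)) = 0) \<and> (\<forall>k\<in>K. 0 < (\<Sum>i\<in>I. inner (l i) (k i)))"
  using assms(1,3-)
proof (induction J arbitrary: K u rule: finite_induct)
  case empty
  show ?case
  proof (cases "K = {}")
    case False
    have "\<exists>l. \<forall>k\<in>K. 0 < (\<Sum>i\<in>I. inner (l i) (k i))"
    proof (rule compact_convex_positive_functional[OF assms(2) empty(1) False])
      show "\<exists>i\<in>I. k i \<noteq> 0" if "k \<in> K" for k using empty(3)[OF that] by auto
    qed (rule empty(2))
    then show ?thesis by simp
  qed auto
next
  case (insert m J)
  \<comment> \<open>If \<open>u m\<close> vanishes on \<open>I\<close>, then \<open>q = 0\<close>,
    and the convention \<open>inverse 0 = 0\<close> makes \<open>pr\<close> the identity; the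
    argument still applies.\<close>
  define q where "q = (\<Sum>i\<in>I. inner (u m i) (u m i))"
  define pr where "pr x i = x i - ((\<Sum>i\<in>I. inner (u m i) (x i)) * inverse q) *\<^sub>R u m i" for x i
  have pr1: "(\<Sum>i\<in>I. inner (pr x i) (y i)) =
      (\<Sum>i\<in>I. inner (x i) (y i)) - (\<Sum>i\<in>I. inner (u m i) (x i)) * inverse q * (\<Sum>i\<in>I. inner (u m i) (y i))" for x y
    by (simp only: pr_def inner_diff_left inner_scaleR_left sum_subtractf sum_distrib_left)
  have pr2: "(\<Sum>i\<in>I. inner (x i) (pr y i)) =
      (\<Sum>i\<in>I. inner (x i) (y i)) - (\<Sum>i\<in>I. inner (u m i) (y i)) * inverse q * (\<Sum>i\<in>I. inner (x i) (u m i))" for x y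
    by (simp only: pr_def inner_diff_right inner_scaleR_right sum_subtractf sum_distrib_left)
  have selfadj: "(\<Sum>i\<in>I. inner (pr x i) (y i)) = (\<Sum>i\<in>I. inner (x i) (pr y i))" for x y
    unfolding pr1 pr2 by (simp add: inner_commute)
  have pru: "pr (u m) i = 0" if "i \<in> I" for i
  proof (cases "q = 0")
    case True
    then have "u m i = 0" using that assms(2) unfolding q_def by (subst (asm) sum_nonneg_eq_0_iff) auto
    then show ?thesis by (simp add: pr_def)
  qed (simp add: pr_def q_def[symmetric])
  have lin: "pr (\<lambda>i. a *\<^sub>R x i + b *\<^sub>R y i) = (\<lambda>i. a *\<^sub>R pr x i + b *\<^sub>R pr y i)" for a b x y
  proof -
    have "(\<Sum>i\<in>I. inner (u m i) (a *\<^sub>R x i + b *\<^sub>R y i)) =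
        a * (\<Sum>i\<in>I. inner (u m i) (x i)) + b * (\<Sum>i\<in>I. inner (u m i) (y i))"
      by (simp only: inner_add_right inner_scaleR_right sum.distrib sum_distrib_left)
    then show ?thesis
      by (simp add: pr_def fun_eq_iff algebra_simps add_divide_distrib)
  qed
  have "continuous_on K pr"
    unfolding pr_def by (intro continuous_on_coordinatewise_then_product continuous_on_diff continuous_on_scaleR 
       continuous_on_mult continuous_on_const continuous_on_sum continuous_on_inner continuous_on_coordinate)
  then have c: "compact (pr ` K)" using insert.prems(1) by (rule compact_continuous_image)
  have cv: "(\<lambda>i. (1-t) *\<^sub>R x i + t *\<^sub>R y i) \<in> pr ` K" if "x \<in> pr ` K" "y \<in> pr ` K" "0 \<le> t" "t \<le> 1" for x y t
  proof -
    from that obtain x' y' where xy: "x' \<in> K" "y' \<in> K" "x = pr x'" "y = pr y'" by auto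
    show ?thesis unfolding xy lin[symmetric] by (intro imageI insert.prems(2) xy that)
  qed
  have "\<exists>i\<in>I. pr k i \<noteq> (\<Sum>j\<in>J. c j *\<^sub>R pr (u j) i)" if "k \<in> K" for k c
  proof (rule ccontr)
    assume "\<not> ?thesis"
    then have eq: "pr k i = (\<Sum>j\<in>J. c j *\<^sub>R pr (u j) i)" if "i \<in> I" for i using that by auto
    \<comment> \<open>\<open>s x\<close> is the multiple of \<open>u m\<close> that
      \<open>pr\<close> removes from \<open>x\<close>; restoring it in \<open>k\<close> and in every
      \<open>u j\<close> determines the coefficient of \<open>u m\<close> in
      \<open>c'\<close>.\<close>
    define s where "s x = (\<Sum>i\<in>I. inner (u m i) (x i)) * inverse q" for x
    define c' where "c' = c(m := s k - (\<Sum>j\<in>J. c j * s (u j)))"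
    have "k i = (\<Sum>j\<in>insert m J. c' j *\<^sub>R u j i)" if "i \<in> I" for i
    proof -
      have "(\<Sum>j\<in>insert m J. c' j *\<^sub>R u j i) = c' m *\<^sub>R u m i + (\<Sum>j\<in>J. c' j *\<^sub>R u j i)"
        using insert by simp
      also have "(\<Sum>j\<in>J. c' j *\<^sub>R u j i) = (\<Sum>j\<in>J. c j *\<^sub>R u j i)"
        using insert by (intro sum.cong) (auto simp: c'_def)
      also have "\<dots> = (\<Sum>j\<in>J. c j *\<^sub>R pr (u j) i + (c j * s (u j)) *\<^sub>R u m i)"
        by (simp add: pr_def s_def algebra_simps)
      also have "\<dots> = pr k i + (\<Sum>j\<in>J. c j * s (u j)) *\<^sub>R u m i"
        by (simp add: sum.distrib scaleR_sum_left eq[OF that])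
      finally show ?thesis by (simp add: c'_def pr_def s_def algebra_simps)
    qed
    with insert.prems(3)[OF that, of c'] show False by auto
  qed
  then obtain l where l: "\<And>j. j \<in> J \<Longrightarrow> (\<Sum>i\<in>I. inner (l i) (pr (u j) i)) = 0"
    "\<And>k. k \<in> K \<Longrightarrow> 0 < (\<Sum>i\<in>I. inner (l i) (pr k i))"
    using insert.IH[OF c cv, of "\<lambda>j. pr (u j)"] by fastforce
  \<comment> \<open>The functional for the original data is \<open>pr l\<close>: self-adjointness
    shifts \<open>pr\<close> to the argument, where it kills \<open>u m\<close> and turns the other
    generators and \<open>K\<close> into the data of the induction hypothesis.\<close>
  have "\<And>j. j \<in> insert m J \<Longrightarrow> (\<Sum>i\<in>I. inner (pr l i) (u j i)) = 0"
    using l(1) pru by (auto simp: selfadj)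
  then show ?case using l(2) by (intro exI[of _ "pr l"]) (auto simp: selfadj)
qed

subsection \<open>Positive semidefinite forms\<close>

text \<open>Functions on an index set replace matrices here: the pivoting induction deletes one
  index at a time, later index sets consist of pairs, and test vectors vary in a space with the
  product topology.\<close>

definition qform :: "'k set \<Rightarrow> ('k \<Rightarrow> 'k \<Rightarrow> complex) \<Rightarrow> ('k \<Rightarrow> complex) \<Rightarrow> complex" where
  "qform S Z v = (\<Sum>i\<in>S. \<Sum>j\<in>S. cnj (v i) * Z i j * v j)"

lemma qform_cong:
  "(\<And>i j. i \<in> S \<Longrightarrow> j \<in> S \<Longrightarrow> Z i j = Z' i j) \<Longrightarrow> (\<And>i. i \<in> S \<Longrightarrow> v i = v' i) \<Longrightarrow>
    qform S Z v = qform S Z' v'"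
  unfolding qform_def by (intro sum.cong refl) simp

lemma qform_insert:
  assumes "finite S" "p \<notin> S"
  shows "qform (insert p S) Z v = cnj (v p) * Z p p * v p + (\<Sum>j\<in>S. cnj (v p) * Z p j * v j)
    + (\<Sum>i\<in>S. cnj (v i) * Z i p * v p) + qform S Z v"
  using assms by (simp add: qform_def sum.distrib)

lemma qform_rank_one: "qform S (\<lambda>i j. g i * cnj (g j)) v = of_real ((cmod (\<Sum>i\<in>S. cnj (v i) * g i))\<^sup>2)"
proof -
  have "qform S (\<lambda>i j. g i * cnj (g j)) v = (\<Sum>i\<in>S. cnj (v i) * g i) * cnj (\<Sum>i\<in>S. cnj (v i) * g i)"
    by (simp add: qform_def sum_product mult_ac)
  then show ?thesis by (simp only: complex_norm_square)
qed

lemma qform_diff: "qform S (\<lambda>i j. Z i j - Z' i j) v = qform S Z v - qform S Z' v"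
  by (simp add: qform_def algebra_simps sum_subtractf)

text \<open>A nonzero \<open>Z i p\<close> next to a null pivot would make the form unbounded below:
  on vectors supported on \<open>i\<close> and \<open>p\<close>, the absence of the term with
  \<open>Z p p\<close> leaves only linear dependence on the entry at \<open>p\<close>.\<close>

lemma psd_function_null_pivot:
  assumes "finite S" "i \<in> S" "p \<in> S"
    and herm: "\<And>i j. i \<in> S \<Longrightarrow> j \<in> S \<Longrightarrow> Z i j = cnj (Z j i)"
    and pos: "\<And>v. 0 \<le> Re (qform S Z v)"
    and "Z p p = 0"
  shows "Z i p = 0"
proof (cases "i = p")
  case False
  have *: "2 * s * (cmod (Z i p))\<^sup>2 \<le> Re (Z i i)" for s :: real
  proof -
    \<comment> \<open>The phase of the entry at \<open>p\<close> makes both cross terms equal to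
      \<open>- s\<close> times the squared modulus of \<open>Z i p\<close>.\<close>
    define v where "v = (\<lambda>k. if k = i then 1 else if k = p then - of_real s * cnj (Z i p) else 0)"
    have "qform S Z v = qform {i, p} Z v"
    proof -
      have "(\<Sum>j\<in>S. cnj (v k) * Z k j * v j) = (\<Sum>j\<in>{i,p}. cnj (v k) * Z k j * v j)" for k
        using assms(1-3) by (intro sum.mono_neutral_right) (auto simp: v_def)
      moreover have "(\<Sum>k\<in>S. \<Sum>j\<in>{i,p}. cnj (v k) * Z k j * v j) =
          (\<Sum>k\<in>{i,p}. \<Sum>j\<in>{i,p}. cnj (v k) * Z k j * v j)"
        using assms(1-3) by (intro sum.mono_neutral_right) (auto simp: v_def)
      ultimately show ?thesis by (simp add: qform_def)
    qed
    also have "\<dots> = Z i i - of_real s * (Z i p * cnj (Z i p)) - of_real s * (Z i p * cnj (Z i p))"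
      using False assms(6) herm[OF assms(3,2)] by (simp add: qform_def v_def algebra_simps)
    also have "Re \<dots> = Re (Z i i) - 2 * s * (cmod (Z i p))\<^sup>2"
      by (simp only: complex_norm_square[symmetric] of_real_mult[symmetric] minus_complex.sel Re_complex_of_real)
    finally show ?thesis using pos[of v] by simp
  qed
  show ?thesis
  proof (rule ccontr)
    assume "Z i p \<noteq> 0"
    then have "(cmod (Z i p))\<^sup>2 > 0" by simp
    \<comment> \<open>For this \<open>s\<close> the inequality would read
      \<open>Re (Z i i) + 1 \<le> Re (Z i i)\<close>.\<close>
    with *[of "(Re (Z i i) + 1) / (2 * (cmod (Z i p))\<^sup>2)"] show False by simp
  qed
qed (simp add: assms(6))

text \<open>Cholesky factorization with pivot \<open>p\<close>; for a null pivot, division by \<open>0\<close> makes \<open>g\<close> vanish, which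
  is what the argument needs.\<close>

lemma psd_function_factorization:
  assumes "finite S"
    and "\<And>i j. i \<in> S \<Longrightarrow> j \<in> S \<Longrightarrow> Z i j = cnj (Z j i)"
    and "\<And>v. 0 \<le> Re (qform S Z v)"
  shows "\<exists>G. \<forall>i\<in>S. \<forall>j\<in>S. Z i j = (\<Sum>k\<in>S. G i k * cnj (G j k))"
  using assms
proof (induction S arbitrary: Z rule: finite_induct)
  case (insert p S)
  define a where "a = Re (Z p p)"
  define g where "g i = Z i p / of_real (sqrt a)" for i
  have Zpp: "Z p p = of_real a"
    using insert.prems(1)[of p p] unfolding a_def
    by (metis Reals_cnj_iff insertI1 complex_is_Real_iff of_real_Re)
  define e where "e = (\<lambda>i. if i = p then 1 else 0 :: complex)"
  have "e p = 1" and "\<And>i. i \<in> S \<Longrightarrow> e i = 0"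
    using insert.hyps by (auto simp: e_def)
  then have "qform (insert p S) Z e = Z p p"
    using insert.hyps by (simp add: qform_insert) (simp add: qform_def)
  with insert.prems(2)[of e] have a0: "a \<ge> 0" by (simp add: Zpp)
  have null: "Z i p = 0" if "a = 0" "i \<in> insert p S" for i
    using psd_function_null_pivot[OF _ that(2) _ insert.prems(1,2)] that(1) insert.hyps by (simp add: Zpp)
  \<comment> \<open>The rank-one matrix built from \<open>g\<close> reproduces column
    \<open>p\<close> of \<open>Z\<close>, and by conjugation row \<open>p\<close>, so that
    \<open>Z'\<close> below vanishes there.\<close>
  have ggp: "g i * cnj (g p) = Z i p" if "i \<in> insert p S" for i
  proof (cases "a = 0")
    case False
    then have "of_real (sqrt a) * of_real (sqrt a) = (of_real a :: complex)"
      using a0 by (simp flip: of_real_mult)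
    with False show ?thesis by (simp add: g_def Zpp)
  qed (use null[OF _ that] in \<open>simp add: g_def\<close>)
  have gpg: "g p * cnj (g j) = Z p j" if "j \<in> insert p S" for j
    using arg_cong[OF ggp[OF that], of cnj] insert.prems(1)[of p j] that by (simp add: mult.commute)
  define Z' where "Z' i j = Z i j - g i * cnj (g j)" for i j
  have pos': "0 \<le> Re (qform S Z' v)" for v
  proof -
    \<comment> \<open>The entry at \<open>p\<close> makes \<open>v'\<close> orthogonal to
      \<open>g\<close>, so subtracting the rank-one matrix does not change the form; for a null
      pivot \<open>g\<close> is zero anyway.\<close>
    define v' where "v' = v(p := - (\<Sum>i\<in>S. v i * cnj (g i)) / of_real (sqrt a))"
    have "cnj (v' p) * g p = - (\<Sum>i\<in>S. cnj (v i) * g i)"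
    proof (cases "a = 0")
      case True
      then show ?thesis using null by (auto simp: v'_def g_def intro!: sum.neutral)
    next
      case False
      have "g p = of_real (sqrt a)"
        unfolding g_def Zpp using False a0 by (simp add: real_div_sqrt flip: of_real_divide)
      with False a0 show ?thesis by (simp add: v'_def)
    qed
    moreover have "(\<Sum>i\<in>S. cnj (v' i) * g i) = (\<Sum>i\<in>S. cnj (v i) * g i)"
      using insert.hyps by (intro sum.cong) (auto simp: v'_def)
    ultimately have "(\<Sum>i\<in>insert p S. cnj (v' i) * g i) = 0"
      using insert.hyps by simp
    then have "qform (insert p S) Z v' = qform (insert p S) Z' v'"
      unfolding Z'_def qform_diff qform_rank_one by simp
    also have "\<dots> = qform S Z' v'"
      using insert.hyps ggp gpg by (simp add: qform_insert Z'_def)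
    also have "\<dots> = qform S Z' v"
      using insert.hyps by (intro qform_cong) (auto simp: v'_def)
    finally show ?thesis using insert.prems(2)[of v'] by simp
  qed
  have "Z' i j = cnj (Z' j i)" if "i \<in> S" "j \<in> S" for i j
    using insert.prems(1)[of i j] that by (simp add: Z'_def)
  from insert.IH[OF this pos'] obtain G where
    G: "\<And>i j. i \<in> S \<Longrightarrow> j \<in> S \<Longrightarrow> Z' i j = (\<Sum>k\<in>S. G i k * cnj (G j k))" by blast
  \<comment> \<open>The triangular Cholesky factor: column \<open>p\<close> is \<open>g\<close>, and
    the rest of row \<open>p\<close> can be zero because \<open>Z'\<close> vanishes in row and
    column \<open>p\<close>.\<close>
  define H where "H i k = (if k = p then g i else if i = p then 0 else G i k)" for i k
  have "Z i j = (\<Sum>k\<in>insert p S. H i k * cnj (H j k))" if ij: "i \<in> insert p S" "j \<in> insert p S" for i j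
  proof -
    have "(\<Sum>k\<in>S. H i k * cnj (H j k)) = (\<Sum>k\<in>S. if i = p \<or> j = p then 0 else G i k * cnj (G j k))"
      using insert.hyps by (intro sum.cong) (auto simp: H_def)
    then have "(\<Sum>k\<in>insert p S. H i k * cnj (H j k)) =
        g i * cnj (g j) + (if i = p \<or> j = p then 0 else Z' i j)"
      using insert.hyps ij by (auto simp: G H_def)
    then show ?thesis using ij ggp gpg by (auto simp: Z'_def)
  qed
  then show ?case by blast
qed simp

text \<open>Entries outside \<open>S\<close> are pinned to 0, since free coordinates would destroy
  compactness. The sphere is then a closed subset of a product of unit discs and singletons, compact
  by Tychonoff.\<close>

lemma compact_sphere_function:
  assumes "finite S"
  shows "compact {v :: 'k \<Rightarrow> complex. (\<forall>i. i \<notin> S \<longrightarrow> v i = 0) \<and> (\<Sum>i\<in>S. (cmod (v i))\<^sup>2) = 1}"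
    (is "compact ?K")
proof -
  define T :: "'k \<Rightarrow> complex set" where "T i = (if i \<in> S then {z. cmod z \<le> 1} else {0})" for i
  have "compactin (product_topology (\<lambda>_. euclidean) UNIV) (PiE UNIV T)"
  proof (subst compactin_PiE, intro disjI2 ballI)
    have "cball (0 :: complex) 1 = {z. cmod z \<le> 1}" by auto
    then have "compact {z. cmod z \<le> 1}" by (metis compact_cball)
    then show "compactin euclidean (T i)" for i by (simp add: T_def)
  qed
  then have c: "compact (PiE UNIV T)" by (simp add: euclidean_product_topology)
  have "closed ({v :: 'k \<Rightarrow> complex. (\<Sum>i\<in>S. (cmod (v i))\<^sup>2) = 1})"
    by (intro closed_Collect_eq continuous_on_sum continuous_on_power continuous_on_norm
        continuous_on_coordinate continuous_on_const)
  with c have "compact (PiE UNIV T \<inter> {v. (\<Sum>i\<in>S. (cmod (v i))\<^sup>2) = 1})" by (rule compact_Int_closed)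
  moreover have "PiE UNIV T \<inter> {v. (\<Sum>i\<in>S. (cmod (v i))\<^sup>2) = 1} = ?K"
  proof -
    have "cmod (v i) \<le> 1" if "(\<Sum>i\<in>S. (cmod (v i))\<^sup>2) = 1" "i \<in> S" for v :: "'k \<Rightarrow> complex" and i
      using member_le_sum[of i S "\<lambda>i. (cmod (v i))\<^sup>2"] that assms
      by (simp add: power_le_one_iff abs_square_le_1)
    then show ?thesis by (auto simp: T_def PiE_def Pi_def split: if_splits)
  qed
  ultimately show ?thesis by simp
qed

text \<open>The minimum of the form on the compact unit sphere is positive, and homogeneity carries
  it to all vectors. The constant is the slack that later absorbs perturbations of a positive
  definite matrix.\<close>

lemma posdef_function_coercive:
  assumes "finite S"
    and pos: "\<And>v. \<exists>i\<in>S. v i \<noteq> 0 \<Longrightarrow> 0 < Re (qform S Z v)"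
  shows "\<exists>c>0. \<forall>v. c * (\<Sum>i\<in>S. (cmod (v i))\<^sup>2) \<le> Re (qform S Z v)"
proof -
  define K where "K = {v :: 'a \<Rightarrow> complex. (\<forall>i. i \<notin> S \<longrightarrow> v i = 0) \<and> (\<Sum>i\<in>S. (cmod (v i))\<^sup>2) = 1}"
  have normalize: "(\<lambda>i. if i \<in> S then v i / of_real (sqrt (\<Sum>i\<in>S. (cmod (v i))\<^sup>2)) else 0) \<in> K"
    (is "?w \<in> K") if "i \<in> S" "v i \<noteq> 0" for v i
  proof -
    have "(\<Sum>i\<in>S. (cmod (v i))\<^sup>2) > 0" using that assms(1) by (intro sum_pos2[of _ i]) auto
    then have "(\<Sum>i\<in>S. (cmod (?w i))\<^sup>2) = 1"
      by (simp add: norm_divide power_divide flip: sum_divide_distrib)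
    then show ?thesis by (simp add: K_def)
  qed
  show ?thesis
  proof (cases "K = {}")
    \<comment> \<open>Only an empty \<open>S\<close> has an empty sphere, and then both sides are
      0.\<close>
    case True
    then have "v i = 0" if "i \<in> S" for v :: "'a \<Rightarrow> complex" and i using normalize that by auto
    from this[of _ "\<lambda>_. 1"] have "S = {}" by auto
    then show ?thesis by (intro exI[of _ 1]) (simp add: qform_def)
  next
    case False
    have "continuous_on K (\<lambda>v. Re (qform S Z v))"
      unfolding qform_def
      by (intro continuous_on_sum continuous_on_Re continuous_on_mult continuous_on_cnj
          continuous_on_coordinate continuous_on_const)
    from continuous_attains_inf[OF _ False this] compact_sphere_function[OF assms(1)]
    obtain m where m: "m \<in> K" and min: "\<And>v. v \<in> K \<Longrightarrow> Re (qform S Z m) \<le> Re (qform S Z v)"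
      unfolding K_def by blast
    define c where "c = Re (qform S Z m)"
    have "\<exists>i\<in>S. m i \<noteq> 0"
    proof (rule ccontr)
      assume "\<not> ?thesis"
      then have "(\<Sum>i\<in>S. (cmod (m i))\<^sup>2) = 0" by simp
      with m show False by (simp add: K_def)
    qed
    then have "c > 0" using pos by (simp add: c_def)
    moreover have "c * (\<Sum>i\<in>S. (cmod (v i))\<^sup>2) \<le> Re (qform S Z v)" for v
    proof (cases "\<exists>i\<in>S. v i \<noteq> 0")
      case True
      then obtain i where i: "i \<in> S" "v i \<noteq> 0" by blast
      define s where "s = (\<Sum>i\<in>S. (cmod (v i))\<^sup>2)"
      have s: "s > 0" unfolding s_def using i assms(1) by (intro sum_pos2[of _ i]) auto
      have "qform S Z v = qform S Z (\<lambda>k. of_real (sqrt s) * (if k \<in> S then v k / of_real (sqrt s) else 0))"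
        using s by (intro qform_cong) auto
      also have "\<dots> = of_real (sqrt s * sqrt s) * qform S Z (\<lambda>k. if k \<in> S then v k / of_real (sqrt s) else 0)"
        by (simp only: qform_def sum_distrib_left complex_cnj_mult complex_cnj_complex_of_real of_real_mult mult_ac)
      finally have "Re (qform S Z v) = s * Re (qform S Z (\<lambda>k. if k \<in> S then v k / of_real (sqrt s) else 0))"
        using s by simp
      moreover have "c \<le> Re (qform S Z (\<lambda>k. if k \<in> S then v k / of_real (sqrt s) else 0))"
        unfolding c_def s_def using i by (intro min normalize[where v = v and i = i])
      ultimately show ?thesis unfolding s_def[symmetric] using s by (simp add: mult.commute mult_left_mono)
    next
      case False
      then show ?thesis by (simp add: qform_def)
    qed
    ultimately show ?thesis by blast
  qed
qed

subsection \<open>Matrices, adjoints and rank\<close>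

lemma sum_lessThan_mult:
  fixes f :: "nat \<Rightarrow> 'a::comm_monoid_add"
  shows "(\<Sum>s<m * n. f s) = (\<Sum>a<m. \<Sum>i<n. f (a * n + i))"
proof (induction m)
  case (Suc m)
  have "(\<Sum>s<Suc m * n. f s) = (\<Sum>s<m * n. f s) + (\<Sum>s\<in>{m * n..<m * n + n}. f s)"
    by (subst sum.union_disjoint[symmetric]) (auto intro!: sum.cong)
  also have "(\<Sum>s\<in>{m * n..<m * n + n}. f s) = (\<Sum>i<n. f (m * n + i))"
    using sum.shift_bounds_nat_ivl[of f 0 "m * n" n] by (simp add: add.commute atLeast0LessThan)
  finally show ?case by (simp add: Suc)
qed simp

lemma block_index_less: "a * n + i < m * n" if "a < m" "i < n" for a i m n :: nat
proof -
  have "a * n + i < Suc a * n" using that by simp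
  also have "\<dots> \<le> m * n" using that by (intro mult_right_mono) auto
  finally show ?thesis .
qed

lemma less_mult_cases:
  assumes "s < m * (n :: nat)"
  obtains a i where "a < m" "i < n" "s = a * n + i"
proof
  have "n > 0" using assms by (cases n) auto
  then show "s mod n < n" by simp
  show "s div n < m" using assms by (simp add: less_mult_imp_div_less)
  show "s = (s div n) * n + s mod n" by simp
qed

lemma mult_vec_index_sum:
  assumes "A \<in> carrier_mat r c" "v \<in> carrier_vec c" "i < r"
  shows "(A *\<^sub>v v) $ i = (\<Sum>j<c. A $$ (i, j) * v $ j)"
  using assms by (auto simp: scalar_prod_def atLeast0LessThan intro!: sum.cong)

lemma mult_mat_index_sum:
  assumes "A \<in> carrier_mat r c" "B \<in> carrier_mat c m" "i < r" "j < m"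
  shows "(A * B) $$ (i, j) = (\<Sum>k<c. A $$ (i, k) * B $$ (k, j))"
  using assms by (auto simp: scalar_prod_def atLeast0LessThan intro!: sum.cong)

lemma cscalar_prod_sum:
  fixes v w :: "complex vec"
  assumes "v \<in> carrier_vec n" "w \<in> carrier_vec n"
  shows "v \<bullet>c w = (\<Sum>i<n. v $ i * cnj (w $ i))"
  using assms by (auto simp: scalar_prod_def atLeast0LessThan intro!: sum.cong)

lemma cscalar_prod_self:
  fixes v :: "complex vec"
  assumes "v \<in> carrier_vec n"
  shows "v \<bullet>c v = of_real (\<Sum>i<n. (cmod (v $ i))\<^sup>2)"
  by (simp only: cscalar_prod_sum[OF assms assms] of_real_sum complex_norm_square)

lemma mat_adjoint_dim [simp]:
  "dim_row (mat_adjoint A) = dim_col A" "dim_col (mat_adjoint A) = dim_row A"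
  by (auto simp: mat_adjoint_def)

lemma mat_adjoint_carrier [simp]: "A \<in> carrier_mat r c \<Longrightarrow> mat_adjoint A \<in> carrier_mat c r"
  by (intro carrier_matI) auto

lemma mat_adjoint_index [simp]:
  fixes A :: "complex mat"
  assumes "i < dim_col A" "j < dim_row A"
  shows "mat_adjoint A $$ (i, j) = cnj (A $$ (j, i))"
  using assms by (simp add: mat_adjoint_def mat_of_rows_index)

lemma mat_adjoint_adjoint [simp]: "mat_adjoint (mat_adjoint A) = (A :: complex mat)"
  by (intro eq_matI) auto

lemma mat_adjoint_mult:
  fixes A B :: "complex mat"
  assumes "A \<in> carrier_mat r c" "B \<in> carrier_mat c m"
  shows "mat_adjoint (A * B) = mat_adjoint B * mat_adjoint A"
proof (intro eq_matI)
  fix i j assume "i < dim_row (mat_adjoint B * mat_adjoint A)" "j < dim_col (mat_adjoint B * mat_adjoint A)"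
  with assms have ij: "i < m" "j < r" by auto
  have "mat_adjoint (A * B) $$ (i, j) = cnj (\<Sum>k<c. A $$ (j, k) * B $$ (k, i))"
    using assms ij by (simp add: mult_mat_index_sum[OF assms, symmetric] del: index_mult_mat(1))
  also have "\<dots> = (\<Sum>k<c. mat_adjoint B $$ (i, k) * mat_adjoint A $$ (k, j))"
    unfolding cnj_sum using assms ij by (intro sum.cong) (auto simp: mult.commute)
  also have "\<dots> = (mat_adjoint B * mat_adjoint A) $$ (i, j)"
    using assms ij by (intro mult_mat_index_sum[symmetric]) auto
  finally show "mat_adjoint (A * B) $$ (i, j) = (mat_adjoint B * mat_adjoint A) $$ (i, j)" .
qed (use assms in auto)

lemma mat_adjoint_add:
  fixes A B :: "complex mat"
  assumes "A \<in> carrier_mat r c" "B \<in> carrier_mat r c"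
  shows "mat_adjoint (A + B) = mat_adjoint A + mat_adjoint B"
  using assms by (intro eq_matI) auto

lemma mult_vec_cscalar_prod:
  fixes A :: "complex mat"
  assumes "A \<in> carrier_mat r c" "v \<in> carrier_vec c" "w \<in> carrier_vec r"
  shows "(A *\<^sub>v v) \<bullet>c w = v \<bullet>c (mat_adjoint A *\<^sub>v w)"
proof -
  have "(A *\<^sub>v v) \<bullet>c w = (\<Sum>i<r. \<Sum>j<c. A $$ (i, j) * v $ j * cnj (w $ i))"
    using assms by (simp add: cscalar_prod_sum[of _ r] mult_vec_index_sum[of _ r c] sum_distrib_right
        del: index_mult_mat_vec)
  also have "\<dots> = (\<Sum>j<c. \<Sum>i<r. A $$ (i, j) * v $ j * cnj (w $ i))" by (rule sum.swap)
  also have "\<dots> = (\<Sum>j<c. v $ j * cnj ((mat_adjoint A *\<^sub>v w) $ j))"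
    using assms by (intro sum.cong)
      (auto simp: mult_vec_index_sum[of _ c r] sum_distrib_left mult_ac simp del: index_mult_mat_vec)
  finally show ?thesis using assms by (simp add: cscalar_prod_sum[of _ c] mult_mat_vec_carrier[of _ c r] del: index_mult_mat_vec)
qed

lemma cscalar_prod_qform:
  fixes A :: "complex mat"
  assumes "A \<in> carrier_mat n n" "v \<in> carrier_vec n"
  shows "(A *\<^sub>v v) \<bullet>c v = qform {..<n} (\<lambda>i j. A $$ (i, j)) (\<lambda>i. v $ i)"
  using assms by (simp add: qform_def cscalar_prod_sum[of _ n] mult_vec_index_sum[of _ n n]
      sum_distrib_right sum_distrib_left mult_ac del: index_mult_mat_vec)

lemma psd_factorization:
  assumes "psd n A"
  obtains G where "G \<in> carrier_mat n n" "A = G * mat_adjoint G"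
proof -
  have A: "A \<in> carrier_mat n n" "mat_adjoint A = A" using assms by (auto simp: psd_def)
  have "\<exists>G. \<forall>i\<in>{..<n}. \<forall>j\<in>{..<n}. A $$ (i, j) = (\<Sum>k<n. G i k * cnj (G j k))"
  proof (rule psd_function_factorization)
    show "A $$ (i, j) = cnj (A $$ (j, i))" if "i \<in> {..<n}" "j \<in> {..<n}" for i j
      using that A by (metis carrier_matD lessThan_iff mat_adjoint_index)
    show "0 \<le> Re (qform {..<n} (\<lambda>i j. A $$ (i, j)) v)" for v
    proof -
      have "0 \<le> Re ((A *\<^sub>v vec n v) \<bullet>c vec n v)" using assms by (simp add: psd_def)
      also have "(A *\<^sub>v vec n v) \<bullet>c vec n v = qform {..<n} (\<lambda>i j. A $$ (i, j)) v"
        by (subst cscalar_prod_qform[OF A(1)]) (auto intro: qform_cong)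
      finally show ?thesis .
    qed
  qed simp
  then obtain G where G: "\<And>i j. i < n \<Longrightarrow> j < n \<Longrightarrow> A $$ (i, j) = (\<Sum>k<n. G i k * cnj (G j k))"
    by auto
  define M where "M = mat n n (\<lambda>(i, j). G i j)"
  have M: "M \<in> carrier_mat n n" by (simp add: M_def)
  moreover have "A = M * mat_adjoint M"
  proof (rule eq_matI)
    fix i j assume "i < dim_row (M * mat_adjoint M)" "j < dim_col (M * mat_adjoint M)"
    then have ij: "i < n" "j < n" by (auto simp: M_def)
    show "A $$ (i, j) = (M * mat_adjoint M) $$ (i, j)"
      unfolding mult_mat_index_sum[OF M mat_adjoint_carrier[OF M] ij]
      using ij M by (simp add: G) (simp add: M_def)
  qed (use A M in auto)
  ultimately show thesis using that by blast
qed

text \<open>Independence of the set of columns detects full rank only if the columns are distinct. A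
  repeated column is treated separately: it lowers the rank and puts a difference of two unit
  vectors into the kernel.\<close>

lemma full_column_rank_iff:
  assumes A: "A \<in> carrier_mat r c"
  shows "full_column_rank A \<longleftrightarrow> (\<forall>v\<in>carrier_vec c. A *\<^sub>v v = 0\<^sub>v r \<longrightarrow> v = 0\<^sub>v c)"
proof -
  interpret vec_space "TYPE(complex)" r .
  show ?thesis
  proof (cases "distinct (cols A)")
    case True
    have "rank A = c \<longleftrightarrow> lin_indpt (set (cols A))"
      using full_rank_lin_indpt[OF A _ True] lin_indpt_full_rank[OF A True] by blast
    also have "\<dots> \<longleftrightarrow> (\<forall>v\<in>carrier_vec c. A *\<^sub>v v = 0\<^sub>v r \<longrightarrow> v = 0\<^sub>v c)"
      using lin_depI[OF A _ _ _ True] lin_depE[OF A _ True] by metis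
    finally show ?thesis using A by (simp add: full_column_rank_def)
  next
    case False
    \<comment> \<open>The rank is the size of a maximal independent set of columns, hence at most
      the number of different columns.\<close>
    obtain S where S: "maximal S (\<lambda>T. T \<subseteq> set (cols A) \<and> lin_indpt T)"
      using maximal_exists[of "(\<lambda>T. T \<subseteq> set (cols A) \<and> lin_indpt T)" "card (set (cols A))" "{}"]
      by (meson List.finite_set card_mono empty_iff empty_subsetI finite_lin_indpt2 rev_finite_subset)
    then have "card S \<le> card (set (cols A))" by (simp add: card_mono maximal_def)
    also have "\<dots> < c"
      using False A by (metis card_distinct card_length carrier_matD(2) cols_length le_neq_implies_less)
    finally have "\<not> full_column_rank A"
      using rank_card_indpt[OF A S] A by (simp add: full_column_rank_def)
    moreover obtain i j where ij: "i < c" "j < c" "i \<noteq> j" "col A i = col A j"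
      using False A by (auto simp: distinct_conv_nth)
    have "A *\<^sub>v (unit_vec c i - unit_vec c j) = 0\<^sub>v r"
    proof (rule eq_vecI)
      fix k assume "k < dim_vec (0\<^sub>v r :: complex vec)"
      moreover from this have "A $$ (k, i) = A $$ (k, j)"
        using A ij by (metis carrier_matD index_col index_zero_vec(2))
      ultimately show "(A *\<^sub>v (unit_vec c i - unit_vec c j)) $ k = 0\<^sub>v r $ k"
        using A ij
        by (simp add: scalar_prod_minus_distrib[of _ c])
    qed (use A in auto)
    moreover have "unit_vec c i - unit_vec c j \<noteq> (0\<^sub>v c :: complex vec)"
    proof
      assume "unit_vec c i - unit_vec c j = (0\<^sub>v c :: complex vec)"
      then have "(unit_vec c i - unit_vec c j) $ i = (0\<^sub>v c :: complex vec) $ i" by simp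
      with ij show False by simp
    qed
    ultimately show ?thesis by (metis minus_carrier_vec unit_vec_carrier)
  qed
qed

lemma basis_matD:
  fixes B :: "complex mat"
  assumes "vec_space.basis_mat n W B"
  shows "B \<in> carrier_mat n (dim_col B)"
    and "w \<in> carrier_vec (dim_col B) \<Longrightarrow> B *\<^sub>v w = 0\<^sub>v n \<Longrightarrow> w = 0\<^sub>v (dim_col B)"
    and "v \<in> W \<Longrightarrow> \<exists>w\<in>carrier_vec (dim_col B). v = B *\<^sub>v w"
    and "dim_col B = 0 \<Longrightarrow> W = {0\<^sub>v n}"
    and "dim_col B \<le> n"
    and "dim_col B = n \<Longrightarrow> W = carrier_vec n"
proof -
  interpret vec_space "TYPE(complex)" n .
  have B: "B \<in> carrier_mat n (dim_col B)" and dist: "distinct (cols B)"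
    and li: "lin_indpt (set (cols B))" and W: "W = span (set (cols B))"
    using assms unfolding basis_mat_def by auto
  show "B \<in> carrier_mat n (dim_col B)" by (rule B)
  have sub: "set (cols B) \<subseteq> carrier_vec n" using B cols_dim by fastforce
  show "w = 0\<^sub>v (dim_col B)" if "w \<in> carrier_vec (dim_col B)" "B *\<^sub>v w = 0\<^sub>v n"
    using lin_depI[OF B that(1) _ that(2) dist] li by blast
  show "\<exists>w\<in>carrier_vec (dim_col B). v = B *\<^sub>v w" if "v \<in> W"
  proof -
    from that obtain a where "v = lincomb a (set (cols B))"
      unfolding W using finite_span[OF _ sub] by auto
    then show ?thesis using mat_mult_eq_lincomb[OF B dist, of a] by (metis vec_carrier)
  qed
  show "W = {0\<^sub>v n}" if "dim_col B = 0"
  proof -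
    have "set (cols B) = {}" using that by (simp add: cols_def)
    then show ?thesis unfolding W by (simp add: span_empty)
  qed
  have card: "card (set (cols B)) = dim_col B" using dist distinct_card by fastforce
  show "dim_col B \<le> n" using li_le_dim(2)[OF fin_dim _ li] sub card dim_is_n by simp
  show "W = carrier_vec n" if "dim_col B = n"
    using dim_li_is_basis[OF fin_dim _ _ li] sub card dim_is_n that W by (simp add: basis_def)
qed

subsection \<open>Evaluation of pencils\<close>

lemma kron_carrier [simp]:
  "A \<in> carrier_mat r c \<Longrightarrow> B \<in> carrier_mat n m \<Longrightarrow> kron A B \<in> carrier_mat (r * n) (c * m)"
  by (auto simp: kron_def)

lemma kron_index:
  assumes "A \<in> carrier_mat r c" "B \<in> carrier_mat n m" "a < r" "b < c" "i < n" "k < m"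
  shows "kron A B $$ (a * n + i, b * m + k) = A $$ (a, b) * B $$ (i, k)"
  using assms by (simp add: kron_def block_index_less)

lemma eq_mat_blockI:
  assumes "A \<in> carrier_mat (r * n) (c * m)" "B \<in> carrier_mat (r * n) (c * m)"
    and "\<And>a b i k. a < r \<Longrightarrow> b < c \<Longrightarrow> i < n \<Longrightarrow> k < m \<Longrightarrow>
      A $$ (a * n + i, b * m + k) = B $$ (a * n + i, b * m + k)"
  shows "A = B"
proof (rule eq_matI)
  fix s t assume "s < dim_row B" "t < dim_col B"
  then have "s < r * n" "t < c * m" using assms by auto
  then show "A $$ (s, t) = B $$ (s, t)" by (elim less_mult_cases) (use assms(3) in auto)
qed (use assms in auto)

lemma eq_vec_blockI:
  assumes "v \<in> carrier_vec (r * n)" "w \<in> carrier_vec (r * n)"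
    and "\<And>a i. a < r \<Longrightarrow> i < n \<Longrightarrow> v $ (a * n + i) = w $ (a * n + i)"
  shows "v = w"
proof (rule eq_vecI)
  fix s assume "s < dim_vec w"
  then have "s < r * n" using assms by auto
  then show "v $ s = w $ s" by (elim less_mult_cases) (use assms(3) in auto)
qed (use assms in auto)

lemma kron_mult:
  assumes "A \<in> carrier_mat r c" "B \<in> carrier_mat c m" "X \<in> carrier_mat n k" "Y \<in> carrier_mat k l"
  shows "kron (A * B) (X * Y) = kron A X * kron B Y"
proof (rule eq_mat_blockI)
  fix a b i j assume ab: "a < r" "b < m" "i < n" "j < l"
  have "(kron A X * kron B Y) $$ (a * n + i, b * l + j) =
      (\<Sum>s<c. \<Sum>t<k. kron A X $$ (a * n + i, s * k + t) * kron B Y $$ (s * k + t, b * l + j))"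
    using assms ab
    by (simp add: mult_mat_index_sum[OF kron_carrier kron_carrier] sum_lessThan_mult block_index_less
        del: index_mult_mat(1))
  also have "\<dots> = (\<Sum>s<c. \<Sum>t<k. (A $$ (a, s) * B $$ (s, b)) * (X $$ (i, t) * Y $$ (t, j)))"
    using assms ab by (simp add: kron_index[of _ r c _ n k] kron_index[of _ c m _ k l] mult_ac)
  also have "\<dots> = (A * B) $$ (a, b) * (X * Y) $$ (i, j)"
    using assms ab by (simp add: mult_mat_index_sum[of _ r c] mult_mat_index_sum[of _ n k] sum_product
        del: index_mult_mat(1))
  also have "\<dots> = kron (A * B) (X * Y) $$ (a * n + i, b * l + j)"
    using assms ab by (simp add: kron_index[of _ r m _ n l] del: index_mult_mat(1))
  finally show "kron (A * B) (X * Y) $$ (a * n + i, b * l + j) = (kron A X * kron B Y) $$ (a * n + i, b * l + j)" ..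
qed (use assms in \<open>auto intro!: kron_carrier mult_carrier_mat\<close>)

lemma kron_add_left:
  assumes "A \<in> carrier_mat r c" "B \<in> carrier_mat r c" "X \<in> carrier_mat n m"
  shows "kron (A + B) X = kron A X + kron B X"
  using assms by (intro eq_mat_blockI[of _ r n c m])
    (auto simp: kron_index[of _ r c _ n m] block_index_less distrib_right
      carrier_matD[OF kron_carrier[OF assms(2,3)]])

lemma kron_adjoint:
  assumes "A \<in> carrier_mat r c" "X \<in> carrier_mat n m"
  shows "mat_adjoint (kron A X) = kron (mat_adjoint A) (mat_adjoint X)"
proof (rule eq_mat_blockI)
  fix a b i k assume ab: "a < c" "b < r" "i < m" "k < n"
  have "mat_adjoint (kron A X) $$ (a * m + i, b * n + k) = cnj (kron A X $$ (b * n + k, a * m + i))"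
    using ab kron_carrier[OF assms] by (intro mat_adjoint_index) (auto simp: block_index_less)
  also have "\<dots> = kron (mat_adjoint A) (mat_adjoint X) $$ (a * m + i, b * n + k)"
    using assms ab by (simp add: kron_index[of _ r c _ n m] kron_index[of _ c r _ m n])
  finally show "mat_adjoint (kron A X) $$ (a * m + i, b * n + k) =
    kron (mat_adjoint A) (mat_adjoint X) $$ (a * m + i, b * n + k)" .
qed (use assms in auto)

lemma mat_adjoint_one [simp]: "mat_adjoint (1\<^sub>m n) = (1\<^sub>m n :: complex mat)"
  by (intro eq_matI) auto

lemma kron_zero [simp]: "kron (0\<^sub>m r c) X = 0\<^sub>m (r * dim_row X) (c * dim_col X)"
  by (intro eq_matI) (auto simp: kron_def less_mult_imp_div_less)

section \<open>Finite sums of matrices\<close>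

lemma mat_sum_carrier [simp]: "mat_sum r c F S \<in> carrier_mat r c"
  by (simp add: mat_sum_def)

lemma mat_sum_index [simp]: "i < r \<Longrightarrow> j < c \<Longrightarrow> mat_sum r c F S $$ (i, j) = (\<Sum>s\<in>S. F s $$ (i, j))"
  by (simp add: mat_sum_def)

lemma mat_sum_dim [simp]: "dim_row (mat_sum r c F S) = r" "dim_col (mat_sum r c F S) = c"
  by (simp_all add: mat_sum_def)

lemma mat_sum_add:
  assumes "\<And>s. s \<in> S \<Longrightarrow> F s \<in> carrier_mat r c" "\<And>s. s \<in> S \<Longrightarrow> G s \<in> carrier_mat r c"
  shows "mat_sum r c (\<lambda>s. F s + G s) S = mat_sum r c F S + mat_sum r c G S"
proof (rule eq_matI)
  fix i j assume "i < dim_row (mat_sum r c F S + mat_sum r c G S)" "j < dim_col (mat_sum r c F S + mat_sum r c G S)"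
  then have ij: "i < r" "j < c" by auto
  have "(\<Sum>s\<in>S. (F s + G s) $$ (i, j)) = (\<Sum>s\<in>S. F s $$ (i, j) + G s $$ (i, j))"
    using assms ij by (intro sum.cong) (auto simp: carrier_matD[OF assms(2)])
  with ij show "mat_sum r c (\<lambda>s. F s + G s) S $$ (i, j) = (mat_sum r c F S + mat_sum r c G S) $$ (i, j)"
    by (simp add: sum.distrib)
qed auto

lemma mult_mat_sum:
  assumes "M \<in> carrier_mat m r" "\<And>s. s \<in> S \<Longrightarrow> F s \<in> carrier_mat r c"
  shows "M * mat_sum r c F S = mat_sum m c (\<lambda>s. M * F s) S"
proof (rule eq_matI)
  fix i j assume "i < dim_row (mat_sum m c (\<lambda>s. M * F s) S)" "j < dim_col (mat_sum m c (\<lambda>s. M * F s) S)"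
  then have ij: "i < m" "j < c" by auto
  have "(\<Sum>s\<in>S. (M * F s) $$ (i, j)) = (\<Sum>s\<in>S. \<Sum>k<r. M $$ (i, k) * F s $$ (k, j))"
    using assms ij by (intro sum.cong refl mult_mat_index_sum) auto
  also have "\<dots> = (\<Sum>k<r. M $$ (i, k) * (\<Sum>s\<in>S. F s $$ (k, j)))"
    by (subst sum.swap) (simp add: sum_distrib_left)
  finally show "(M * mat_sum r c F S) $$ (i, j) = mat_sum m c (\<lambda>s. M * F s) S $$ (i, j)"
    using ij assms(1) by (simp add: mult_mat_index_sum[of _ m r _ c] del: index_mult_mat(1))
qed (use assms in auto)

lemma mat_sum_mult:
  assumes "M \<in> carrier_mat c m" "\<And>s. s \<in> S \<Longrightarrow> F s \<in> carrier_mat r c"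
  shows "mat_sum r c F S * M = mat_sum r m (\<lambda>s. F s * M) S"
proof (rule eq_matI)
  fix i j assume "i < dim_row (mat_sum r m (\<lambda>s. F s * M) S)" "j < dim_col (mat_sum r m (\<lambda>s. F s * M) S)"
  then have ij: "i < r" "j < m" by auto
  have "(\<Sum>s\<in>S. (F s * M) $$ (i, j)) = (\<Sum>s\<in>S. \<Sum>k<c. F s $$ (i, k) * M $$ (k, j))"
    using assms ij by (intro sum.cong refl mult_mat_index_sum) auto
  also have "\<dots> = (\<Sum>k<c. (\<Sum>s\<in>S. F s $$ (i, k)) * M $$ (k, j))"
    by (subst sum.swap) (simp add: sum_distrib_right)
  finally show "(mat_sum r c F S * M) $$ (i, j) = mat_sum r m (\<lambda>s. F s * M) S $$ (i, j)"
    using ij assms(1) by (simp add: mult_mat_index_sum[of _ r c _ m] del: index_mult_mat(1))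
qed (use assms in auto)

lemma mat_adjoint_mat_sum:
  assumes "\<And>s. s \<in> S \<Longrightarrow> F s \<in> carrier_mat r c"
  shows "mat_adjoint (mat_sum r c F S) = mat_sum c r (\<lambda>s. mat_adjoint (F s)) S"
proof (rule eq_matI)
  fix i j assume "i < dim_row (mat_sum c r (\<lambda>s. mat_adjoint (F s)) S)" "j < dim_col (mat_sum c r (\<lambda>s. mat_adjoint (F s)) S)"
  then have ij: "i < c" "j < r" by auto
  have "(\<Sum>s\<in>S. mat_adjoint (F s) $$ (i, j)) = (\<Sum>s\<in>S. cnj (F s $$ (j, i)))"
    using ij carrier_matD[OF assms] by (intro sum.cong) auto
  with ij show "mat_adjoint (mat_sum r c F S) $$ (i, j) = mat_sum c r (\<lambda>s. mat_adjoint (F s)) S $$ (i, j)"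
    by simp
qed auto

section \<open>Compatibility of evaluation with the operations on pencils\<close>

lemma carrier_pencilD:
  assumes "p \<in> carrier_pencil r c"
  shows "const_coeff p \<in> carrier_mat r c" "x_coeff p j \<in> carrier_mat r c" "xstar_coeff p j \<in> carrier_mat r c"
  using assms by (auto simp: carrier_pencil_def)

lemma mat_tuplesD [simp]: "X \<in> mat_tuples n \<Longrightarrow> X j \<in> carrier_mat n n"
  by (simp add: mat_tuples_def)

lemma pencil_eval_eq:
  assumes "p \<in> carrier_pencil r c"
  shows "pencil_eval n p X = kron (const_coeff p) (1\<^sub>m n)
    + mat_sum (r * n) (c * n) (\<lambda>j. kron (x_coeff p j) (X j)) UNIV
    + mat_sum (r * n) (c * n) (\<lambda>j. kron (xstar_coeff p j) (mat_adjoint (X j))) UNIV"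
  using carrier_pencilD(1)[OF assms] by (simp add: pencil_eval_def Let_def)

lemma pencil_eval_carrier:
  assumes "p \<in> carrier_pencil r c"
  shows "pencil_eval n p X \<in> carrier_mat (r * n) (c * n)"
  unfolding pencil_eval_eq[OF assms] by (intro add_carrier_mat mat_sum_carrier)

lemma pencil_carrier_intros:
  "p \<in> carrier_pencil r c \<Longrightarrow> q \<in> carrier_pencil r c \<Longrightarrow> pencil_add p q \<in> carrier_pencil r c"
  "M \<in> carrier_mat m r \<Longrightarrow> p \<in> carrier_pencil r c \<Longrightarrow> pencil_lmult M p \<in> carrier_pencil m c"
  "p \<in> carrier_pencil r c \<Longrightarrow> N \<in> carrier_mat c m \<Longrightarrow> pencil_rmult p N \<in> carrier_pencil r m"
  "p \<in> carrier_pencil r c \<Longrightarrow> pencil_adjoint p \<in> carrier_pencil c r"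
  "P \<in> carrier_mat r c \<Longrightarrow> const_pencil r c P \<in> carrier_pencil r c"
  by (auto intro: mult_carrier_mat simp: carrier_pencil_def pencil_add_def pencil_lmult_def pencil_rmult_def
      pencil_adjoint_def const_pencil_def)

lemma pencil_eval_add:
  assumes p: "p \<in> carrier_pencil r c" and q: "q \<in> carrier_pencil r c" and X: "X \<in> mat_tuples n"
  shows "pencil_eval n (pencil_add p q) X = pencil_eval n p X + pencil_eval n q X"
proof -
  note cs = carrier_pencilD[OF p] carrier_pencilD[OF q] mat_tuplesD[OF X] mat_adjoint_carrier[OF mat_tuplesD[OF X]]
  have "mat_sum (r * n) (c * n) (\<lambda>j. kron (x_coeff p j + x_coeff q j) (X j)) UNIV =
      mat_sum (r * n) (c * n) (\<lambda>j. kron (x_coeff p j) (X j)) UNIV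
      + mat_sum (r * n) (c * n) (\<lambda>j. kron (x_coeff q j) (X j)) UNIV"
    using cs by (subst mat_sum_add[symmetric]) (auto simp: kron_add_left[of _ r c _ _ n n])
  moreover have "mat_sum (r * n) (c * n) (\<lambda>j. kron (xstar_coeff p j + xstar_coeff q j) (mat_adjoint (X j))) UNIV =
      mat_sum (r * n) (c * n) (\<lambda>j. kron (xstar_coeff p j) (mat_adjoint (X j))) UNIV
      + mat_sum (r * n) (c * n) (\<lambda>j. kron (xstar_coeff q j) (mat_adjoint (X j))) UNIV"
    using cs by (subst mat_sum_add[symmetric]) (auto simp: kron_add_left[of _ r c _ _ n n])
  moreover have "kron (const_coeff p + const_coeff q) (1\<^sub>m n) =
      kron (const_coeff p) (1\<^sub>m n) + kron (const_coeff q) (1\<^sub>m n)"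
    using cs by (intro kron_add_left) auto
  ultimately show ?thesis
    unfolding pencil_eval_eq[OF p] pencil_eval_eq[OF q] pencil_eval_eq[OF pencil_carrier_intros(1)[OF p q]]
    using kron_carrier[OF cs(1) one_carrier_mat[of n]] kron_carrier[OF cs(4) one_carrier_mat[of n]]
    by (intro eq_matI) (auto simp: pencil_add_def)
qed

lemma pencil_eval_lmult:
  assumes M: "M \<in> carrier_mat m r" and p: "p \<in> carrier_pencil r c" and X: "X \<in> mat_tuples n"
  shows "pencil_eval n (pencil_lmult M p) X = kron M (1\<^sub>m n) * pencil_eval n p X"
proof -
  note cs = M carrier_pencilD[OF p] mat_tuplesD[OF X] mat_adjoint_carrier[OF mat_tuplesD[OF X]]
  have k: "kron (M * N) Y = kron M (1\<^sub>m n) * kron N Y"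
    if "N \<in> carrier_mat r c" "Y \<in> carrier_mat n n" for N Y
    using kron_mult[OF M that(1) one_carrier_mat that(2)] that(2) by simp
  have MM: "kron M (1\<^sub>m n) \<in> carrier_mat (m * n) (r * n)" using M by simp
  have "kron M (1\<^sub>m n) * pencil_eval n p X =
      kron M (1\<^sub>m n) * kron (const_coeff p) (1\<^sub>m n)
      + kron M (1\<^sub>m n) * mat_sum (r * n) (c * n) (\<lambda>j. kron (x_coeff p j) (X j)) UNIV
      + kron M (1\<^sub>m n) * mat_sum (r * n) (c * n) (\<lambda>j. kron (xstar_coeff p j) (mat_adjoint (X j))) UNIV"
    unfolding pencil_eval_eq[OF p]
    using cs by (simp add: mult_add_distrib_mat[OF MM, of _ "c * n"])
  also have "\<dots> = pencil_eval n (pencil_lmult M p) X"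
    unfolding pencil_eval_eq[OF pencil_carrier_intros(2)[OF M p]]
    using cs by (simp add: pencil_lmult_def mult_mat_sum[OF MM] k)
  finally show ?thesis ..
qed

lemma pencil_eval_rmult:
  assumes M: "M \<in> carrier_mat c m" and p: "p \<in> carrier_pencil r c" and X: "X \<in> mat_tuples n"
  shows "pencil_eval n (pencil_rmult p M) X = pencil_eval n p X * kron M (1\<^sub>m n)"
proof -
  note cs = M carrier_pencilD[OF p] mat_tuplesD[OF X] mat_adjoint_carrier[OF mat_tuplesD[OF X]]
  have k: "kron (N * M) Y = kron N Y * kron M (1\<^sub>m n)"
    if "N \<in> carrier_mat r c" "Y \<in> carrier_mat n n" for N Y
    using kron_mult[OF that(1) M that(2) one_carrier_mat] that(2) by simp
  have MM: "kron M (1\<^sub>m n) \<in> carrier_mat (c * n) (m * n)" using M by simp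
  have "pencil_eval n p X * kron M (1\<^sub>m n) =
      kron (const_coeff p) (1\<^sub>m n) * kron M (1\<^sub>m n)
      + mat_sum (r * n) (c * n) (\<lambda>j. kron (x_coeff p j) (X j)) UNIV * kron M (1\<^sub>m n)
      + mat_sum (r * n) (c * n) (\<lambda>j. kron (xstar_coeff p j) (mat_adjoint (X j))) UNIV * kron M (1\<^sub>m n)"
    unfolding pencil_eval_eq[OF p]
    using cs by (simp add: add_mult_distrib_mat[OF _ _ MM, of _ "r * n"])
  also have "\<dots> = pencil_eval n (pencil_rmult p M) X"
    unfolding pencil_eval_eq[OF pencil_carrier_intros(3)[OF p M]]
    using cs by (simp add: pencil_rmult_def mat_sum_mult[OF MM] k)
  finally show ?thesis ..
qed

lemma pencil_eval_adjoint:
  assumes p: "p \<in> carrier_pencil r c" and X: "X \<in> mat_tuples n"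
  shows "pencil_eval n (pencil_adjoint p) X = mat_adjoint (pencil_eval n p X)"
proof -
  note cs = carrier_pencilD[OF p] mat_tuplesD[OF X] mat_adjoint_carrier[OF mat_tuplesD[OF X]]
  let ?K = "kron (const_coeff p) (1\<^sub>m n)"
    and ?A = "mat_sum (r * n) (c * n) (\<lambda>j. kron (x_coeff p j) (X j)) UNIV"
    and ?B = "mat_sum (r * n) (c * n) (\<lambda>j. kron (xstar_coeff p j) (mat_adjoint (X j))) UNIV"
  have K: "?K \<in> carrier_mat (r * n) (c * n)" using cs by simp
  have "mat_adjoint (pencil_eval n p X) = mat_adjoint ?K + mat_adjoint ?A + mat_adjoint ?B"
    unfolding pencil_eval_eq[OF p]
    by (simp only: mat_adjoint_add[OF add_carrier_mat[OF mat_sum_carrier] mat_sum_carrier]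
        mat_adjoint_add[OF K mat_sum_carrier])
  \<comment> \<open>The adjoint exchanges the roles of the two sums, so they are reordered to match
    the coefficients of the adjoint pencil.\<close>
  also have "\<dots> = mat_adjoint ?K + mat_adjoint ?B + mat_adjoint ?A"
    using K by (intro eq_matI) auto
  also have "\<dots> = pencil_eval n (pencil_adjoint p) X"
    unfolding pencil_eval_eq[OF pencil_carrier_intros(4)[OF p]]
    using cs by (simp add: pencil_adjoint_def mat_adjoint_mat_sum kron_adjoint[of _ r c _ n n])
  finally show ?thesis ..
qed

lemma pencil_eval_const:
  assumes "P \<in> carrier_mat r c" "X \<in> mat_tuples n"
  shows "pencil_eval n (const_pencil r c P) X = kron P (1\<^sub>m n)"
proof -
  have d: "dim_row (X j) = n" "dim_col (X j) = n" for j using mat_tuplesD[OF assms(2)] by auto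
  show ?thesis unfolding pencil_eval_eq[OF pencil_carrier_intros(5)[OF assms(1)]]
    using kron_carrier[OF assms(1) one_carrier_mat[of n]]
    by (intro eq_matI) (auto simp: const_pencil_def d)
qed

text \<open>In the block indexing of \<open>kron\<close> the vector \<open>v\<close> is a tensor in
  C^m tensor C^n, and this is its component along the basis vector \<open>i\<close> of the second
  factor. A matrix \<open>kron A (1\<^sub>m n)\<close> acts on each slice as \<open>A\<close>, which
  reduces kernel conditions at level \<open>n\<close> to conditions on the coefficient
  space.\<close>

definition slice :: "nat \<Rightarrow> nat \<Rightarrow> complex vec \<Rightarrow> nat \<Rightarrow> complex vec" where
  "slice m n v i = vec m (\<lambda>a. v $ (a * n + i))"

lemma slice_carrier [simp]: "slice m n v i \<in> carrier_vec m"
  by (simp add: slice_def)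

lemma eq_vec_sliceI:
  assumes "v \<in> carrier_vec (m * n)" "w \<in> carrier_vec (m * n)"
    and "\<And>i. i < n \<Longrightarrow> slice m n v i = slice m n w i"
  shows "v = w"
proof (rule eq_vec_blockI[OF assms(1,2)])
  fix a i assume "a < m" "i < n"
  then show "v $ (a * n + i) = w $ (a * n + i)"
    using arg_cong[OF assms(3), of i "\<lambda>u. u $ a"] by (simp add: slice_def)
qed

lemma slice_zero: "slice m n (0\<^sub>v (m * n)) i = 0\<^sub>v m" if "i < n"
  using that by (intro eq_vecI) (auto simp: slice_def block_index_less)

lemma kron_mult_vec_index:
  assumes "A \<in> carrier_mat r c" "X \<in> carrier_mat n m" "v \<in> carrier_vec (c * m)" "a < r" "i < n"
  shows "(kron A X *\<^sub>v v) $ (a * n + i) = (\<Sum>b<c. \<Sum>k<m. A $$ (a, b) * X $$ (i, k) * v $ (b * m + k))"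
  using assms by (simp add: mult_vec_index_sum[OF kron_carrier] block_index_less sum_lessThan_mult
      kron_index[of _ r c _ n m] del: index_mult_mat_vec)

lemma slice_kron_one:
  assumes A: "A \<in> carrier_mat r c" and v: "v \<in> carrier_vec (c * n)" and i: "i < n"
  shows "slice r n (kron A (1\<^sub>m n) *\<^sub>v v) i = A *\<^sub>v slice c n v i"
proof (rule eq_vecI)
  fix a assume "a < dim_vec (A *\<^sub>v slice c n v i)"
  with A have a: "a < r" by simp
  have "slice r n (kron A (1\<^sub>m n) *\<^sub>v v) i $ a =
      (\<Sum>b<c. \<Sum>k<n. A $$ (a, b) * 1\<^sub>m n $$ (i, k) * v $ (b * n + k))"
    unfolding slice_def using a by (simp only: index_vec kron_mult_vec_index[OF A one_carrier_mat v a i])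
  also have "\<dots> = (\<Sum>b<c. \<Sum>k<n. if k = i then A $$ (a, b) * v $ (b * n + k) else 0)"
    using i by (intro sum.cong) auto
  also have "\<dots> = (\<Sum>b<c. A $$ (a, b) * v $ (b * n + i))" using i by simp
  also have "\<dots> = (A *\<^sub>v slice c n v i) $ a"
    unfolding mult_vec_index_sum[OF A slice_carrier a] by (simp add: slice_def)
  finally show "slice r n (kron A (1\<^sub>m n) *\<^sub>v v) i $ a = (A *\<^sub>v slice c n v i) $ a" .
qed (use A in \<open>simp add: slice_def\<close>)

lemma mult_mat_zero_vec: "M \<in> carrier_mat r c \<Longrightarrow> M *\<^sub>v 0\<^sub>v c = (0\<^sub>v r :: complex vec)"
  by (intro eq_vecI) (auto intro!: scalar_prod_right_zero)

lemma eq_zero_vec_sliceI: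
  assumes "v \<in> carrier_vec (m * n)" "\<And>i. i < n \<Longrightarrow> slice m n v i = 0\<^sub>v m"
  shows "v = 0\<^sub>v (m * n)"
  by (rule eq_vec_sliceI[OF assms(1) zero_carrier_vec]) (simp only: assms(2) slice_zero)

lemma block_index_eq_iff: "i < n \<Longrightarrow> k < n \<Longrightarrow> a * n + i = b * n + k \<longleftrightarrow> a = b \<and> i = (k :: nat)"
  by (metis add_cancel_right_right div_less div_mult_self3 mod_less mod_mult_self3 less_nat_zero_code)

lemma pencil_eval_index:
  assumes p: "p \<in> carrier_pencil r c" and X: "X \<in> mat_tuples n"
    and "a < r" "b < c" "i < n" "k < n"
  shows "pencil_eval n p X $$ (a * n + i, b * n + k) =
    (if i = k then const_coeff p $$ (a, b) else 0)
    + (\<Sum>j\<in>UNIV. x_coeff p j $$ (a, b) * X j $$ (i, k))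
    + (\<Sum>j\<in>UNIV. xstar_coeff p j $$ (a, b) * cnj (X j $$ (k, i)))"
proof -
  note cs = carrier_pencilD[OF p] mat_tuplesD[OF X] mat_adjoint_carrier[OF mat_tuplesD[OF X]]
  have d: "dim_row (X j) = n" "dim_col (X j) = n" for j using cs by auto
  show ?thesis
    unfolding pencil_eval_eq[OF p]
    using assms(3-6)
    by (simp add: block_index_less d kron_index[OF cs(1) one_carrier_mat] kron_index[OF cs(2,4)]
        kron_index[OF cs(3,5)])
qed

section \<open>Values of hermitian monic pencils\<close>

lemma hermitian_monic_pencil_carrier:
  assumes "\<forall>j. A j \<in> carrier_mat d d"
  shows "hermitian_monic_pencil d A \<in> carrier_pencil d d"
  using assms by (auto simp: hermitian_monic_pencil_def carrier_pencil_def)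

lemma hermitian_monic_pencil_eval_index:
  assumes A: "\<forall>j. A j \<in> carrier_mat d d" and X: "X \<in> mat_tuples n"
    and "a < d" "b < d" "i < n" "k < n"
  shows "pencil_eval n (hermitian_monic_pencil d A) X $$ (a * n + i, b * n + k) =
    (if a = b \<and> i = k then 1 else 0)
    - (\<Sum>j\<in>UNIV. A j $$ (a, b) * X j $$ (i, k)) - (\<Sum>j\<in>UNIV. cnj (A j $$ (b, a)) * cnj (X j $$ (k, i)))"
proof -
  have d: "dim_row (A j) = d" "dim_col (A j) = d" for j using A by auto
  show ?thesis
    unfolding pencil_eval_index[OF hermitian_monic_pencil_carrier[OF A] assms(2-6)]
    using assms(3-6) by (simp add: hermitian_monic_pencil_def d sum_negf)
qed

lemma hermitian_monic_pencil_adjoint: "pencil_adjoint (hermitian_monic_pencil d A) = hermitian_monic_pencil d A"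
proof -
  have "mat_adjoint (- M) = - mat_adjoint M" for M :: "complex mat" by (intro eq_matI) auto
  then show ?thesis by (simp add: pencil_adjoint_def hermitian_monic_pencil_def)
qed

lemma hermitian_monic_pencil_eval_hermitian:
  assumes A: "\<forall>j. A j \<in> carrier_mat d d" and X: "X \<in> mat_tuples n"
  shows "mat_adjoint (pencil_eval n (hermitian_monic_pencil d A) X) = pencil_eval n (hermitian_monic_pencil d A) X"
  using pencil_eval_adjoint[OF hermitian_monic_pencil_carrier[OF A] X]
  unfolding hermitian_monic_pencil_adjoint by (rule sym)

text \<open>Convexity with the point \<open>0\<close>, where \<open>L\<close> is the identity: an interior point \<open>X\<close> can be
  pushed outwards to \<open>(1 + t) X\<close>, and then \<open>(1 + t) L(X) = L((1 + t) X) + t I\<close>.\<close>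

lemma interior_spectrahedron_posdef:
  assumes A: "\<forall>j. A j \<in> carrier_mat d d"
    and X: "X \<in> interior_spectrahedron (hermitian_monic_pencil d A) n"
    and v: "v \<in> carrier_vec (d * n)" "v \<noteq> 0\<^sub>v (d * n)"
  shows "0 < Re ((pencil_eval n (hermitian_monic_pencil d A) X *\<^sub>v v) \<bullet>c v)"
proof -
  let ?L = "hermitian_monic_pencil d A"
  note cL = hermitian_monic_pencil_carrier[OF A]
  from X obtain r where XT: "X \<in> mat_tuples n" and r: "r > 0"
    and nb: "\<And>Y. Y \<in> mat_tuples n \<Longrightarrow>
      \<forall>j. \<forall>a<n. \<forall>b<n. cmod (Y j $$ (a, b) - X j $$ (a, b)) < r \<Longrightarrow> Y \<in> free_spectrahedron ?L n"
    by (auto simp: interior_spectrahedron_def)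
  have dX: "dim_row (X j) = n" "dim_col (X j) = n" for j using mat_tuplesD[OF XT] by auto
  define m where "m = (\<Sum>j\<in>UNIV. \<Sum>a<n. \<Sum>b<n. cmod (X j $$ (a, b)))"
  have m: "cmod (X j $$ (a, b)) \<le> m" if "a < n" "b < n" for j a b
  proof -
    have "cmod (X j $$ (a, b)) \<le> (\<Sum>b<n. cmod (X j $$ (a, b)))"
      using that by (intro member_le_sum) auto
    also have "\<dots> \<le> (\<Sum>a<n. \<Sum>b<n. cmod (X j $$ (a, b)))"
      using that by (intro member_le_sum[of a _ "\<lambda>a. \<Sum>b<n. cmod (X j $$ (a, b))"]) (auto intro: sum_nonneg)
    also have "\<dots> \<le> m" unfolding m_def
      by (intro member_le_sum[of j _ "\<lambda>j. \<Sum>a<n. \<Sum>b<n. cmod (X j $$ (a, b))"]) (auto intro!: sum_nonneg)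
    finally show ?thesis .
  qed
  have m0: "m \<ge> 0" unfolding m_def by (intro sum_nonneg) auto
  \<comment> \<open>\<open>m\<close> bounds every entry of \<open>X\<close>, so scaling by
    \<open>1 + t\<close> moves entries by at most \<open>t * m < r\<close>; the \<open>+ 1\<close>
    covers \<open>m = 0\<close>.\<close>
  define t where "t = r / (m + 1)"
  have t: "t > 0" using r m0 by (simp add: t_def)
  have tm: "t * m < r" using r m0 by (simp add: t_def field_simps)
  define Y where "Y j = of_real (1 + t) \<cdot>\<^sub>m X j" for j
  have YT: "Y \<in> mat_tuples n" unfolding mat_tuples_def Y_def by (simp add: mat_tuplesD[OF XT])
  have "Y \<in> free_spectrahedron ?L n"
  proof (rule nb[OF YT], intro allI impI)
    fix j a b assume ab: "a < n" "b < n"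
    then have "cmod (Y j $$ (a, b) - X j $$ (a, b)) = t * cmod (X j $$ (a, b))"
      using t by (simp add: Y_def dX algebra_simps norm_mult)
    also have "\<dots> \<le> t * m" using m[OF ab] t by simp
    finally show "cmod (Y j $$ (a, b) - X j $$ (a, b)) < r" using tm by simp
  qed
  then have "0 \<le> Re ((pencil_eval n ?L Y *\<^sub>v v) \<bullet>c v)"
    using v by (auto simp: free_spectrahedron_def psd_def hermitian_monic_pencil_def)
  moreover have E: "pencil_eval n ?L Y = of_real (1 + t) \<cdot>\<^sub>m pencil_eval n ?L X + (- of_real t) \<cdot>\<^sub>m 1\<^sub>m (d * n)"
  proof (rule eq_mat_blockI)
    fix a b i k assume ab: "a < d" "b < d" "i < n" "k < n"
    note idx = hermitian_monic_pencil_eval_index[OF A XT ab] hermitian_monic_pencil_eval_index[OF A YT ab]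
    have "(of_real (1 + t) \<cdot>\<^sub>m pencil_eval n ?L X + (- of_real t) \<cdot>\<^sub>m 1\<^sub>m (d * n)) $$ (a * n + i, b * n + k) =
      of_real (1 + t) * pencil_eval n ?L X $$ (a * n + i, b * n + k) - (if a = b \<and> i = k then of_real t else 0)"
      using pencil_eval_carrier[OF cL, of n X] ab by (auto simp: block_index_less block_index_eq_iff)
    also have "\<dots> = pencil_eval n ?L Y $$ (a * n + i, b * n + k)"
      unfolding idx using ab by (auto simp: Y_def dX sum_distrib_left sum.distrib algebra_simps)
    finally show "pencil_eval n ?L Y $$ (a * n + i, b * n + k) =
      (of_real (1 + t) \<cdot>\<^sub>m pencil_eval n ?L X + (- of_real t) \<cdot>\<^sub>m 1\<^sub>m (d * n)) $$ (a * n + i, b * n + k)" ..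
  qed (use pencil_eval_carrier[OF cL, of n] in auto)
  moreover have "(pencil_eval n ?L Y *\<^sub>v v) \<bullet>c v =
    of_real (1 + t) * ((pencil_eval n ?L X *\<^sub>v v) \<bullet>c v) - of_real t * (v \<bullet>c v)"
  proof -
    have "pencil_eval n ?L Y *\<^sub>v v = of_real (1 + t) \<cdot>\<^sub>v (pencil_eval n ?L X *\<^sub>v v) + (- of_real t) \<cdot>\<^sub>v v"
      unfolding E using pencil_eval_carrier[OF cL, of n X] v
      by (intro eq_vecI) (auto simp: add_mult_distrib_mat_vec[of _ "d * n" "d * n"])
    then show ?thesis
      using pencil_eval_carrier[OF cL, of n X] v
      by (simp add: add_scalar_prod_distrib[of _ "d * n"] del: of_real_add)
  qed
  moreover have "(\<Sum>s<d * n. (cmod (v $ s))\<^sup>2) > 0"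
  proof -
    obtain s where "s < d * n" "v $ s \<noteq> 0" using v by (metis eq_vecI carrier_vecD index_zero_vec)
    then show ?thesis by (intro sum_pos2[of _ s]) auto
  qed
  ultimately have "0 < (1 + t) * Re ((pencil_eval n ?L X *\<^sub>v v) \<bullet>c v)"
    using t unfolding cscalar_prod_self[OF v(1)]
    by (simp flip: of_real_mult) (smt (verit) mult_pos_pos)
  then show ?thesis using t by (simp add: zero_less_mult_iff)
qed

subsection \<open>Certificates bound the kernel\<close>

lemma certificate_sum_carrier:
  assumes L: "L \<in> carrier_pencil d d" and P0: "P0 \<in> carrier_mat \<epsilon> \<epsilon>" and "set Cs \<subseteq> carrier_mat d \<epsilon>"
  shows "foldr (\<lambda>C. pencil_add (pencil_lmult (mat_adjoint C) (pencil_rmult L C))) Cs (const_pencil \<epsilon> \<epsilon> P0)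
    \<in> carrier_pencil \<epsilon> \<epsilon>"
  using assms(3)
proof (induction Cs)
  case (Cons C Cs)
  then show ?case by (auto intro!: pencil_carrier_intros(1-3)[of _ \<epsilon> d] pencil_carrier_intros(1) L
      intro: pencil_carrier_intros)
qed (use P0 in \<open>simp add: pencil_carrier_intros\<close>)

text \<open>Evaluation turns \<open>C\<close> into \<open>kron C (1\<^sub>m n)\<close>, and the
  adjoint factor on the left moves to the other argument of the inner product. What remains are
  values of the forms of \<open>P0\<close> and of \<open>L(X)\<close>, whose signs are
  known.\<close>

lemma certificate_sum_form:
  assumes L: "L \<in> carrier_pencil d d" and P0: "P0 \<in> carrier_mat \<epsilon> \<epsilon>" and "set Cs \<subseteq> carrier_mat d \<epsilon>"
    and X: "X \<in> mat_tuples n" and v: "v \<in> carrier_vec (\<epsilon> * n)"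
  shows "(pencil_eval n (foldr (\<lambda>C. pencil_add (pencil_lmult (mat_adjoint C) (pencil_rmult L C))) Cs
      (const_pencil \<epsilon> \<epsilon> P0)) X *\<^sub>v v) \<bullet>c v =
    (kron P0 (1\<^sub>m n) *\<^sub>v v) \<bullet>c v +
    (\<Sum>C\<leftarrow>Cs. (pencil_eval n L X *\<^sub>v (kron C (1\<^sub>m n) *\<^sub>v v)) \<bullet>c (kron C (1\<^sub>m n) *\<^sub>v v))"
  using assms(3)
proof (induction Cs)
  case Nil
  then show ?case by (simp add: pencil_eval_const[OF P0 X])
next
  case (Cons C Cs)
  define q where "q = foldr (\<lambda>C. pencil_add (pencil_lmult (mat_adjoint C) (pencil_rmult L C))) Cs (const_pencil \<epsilon> \<epsilon> P0)"
  define K where "K = kron C (1\<^sub>m n)"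
  have C: "C \<in> carrier_mat d \<epsilon>" using Cons.prems by simp
  have q: "q \<in> carrier_pencil \<epsilon> \<epsilon>" unfolding q_def using Cons.prems by (intro certificate_sum_carrier[OF L P0]) auto
  have K: "K \<in> carrier_mat (d * n) (\<epsilon> * n)" using C by (simp add: K_def)
  note LC = pencil_carrier_intros(3)[OF L C]
  note CLC = pencil_carrier_intros(2)[OF mat_adjoint_carrier[OF C] LC]
  have Lc: "pencil_eval n L X \<in> carrier_mat (d * n) (d * n)" by (rule pencil_eval_carrier[OF L])
  have eq: "pencil_eval n (pencil_add (pencil_lmult (mat_adjoint C) (pencil_rmult L C)) q) X =
    mat_adjoint K * (pencil_eval n L X * K) + pencil_eval n q X"
    unfolding pencil_eval_add[OF CLC q X] pencil_eval_lmult[OF mat_adjoint_carrier[OF C] LC X]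
      pencil_eval_rmult[OF C L X] K_def
    using kron_adjoint[OF C one_carrier_mat[of n]] by simp
  have 1: "(mat_adjoint K * (pencil_eval n L X * K)) *\<^sub>v v = mat_adjoint K *\<^sub>v (pencil_eval n L X *\<^sub>v (K *\<^sub>v v))"
    using K Lc v by (simp add: assoc_mult_mat_vec[of _ "\<epsilon> * n" "d * n" _ "\<epsilon> * n"] mult_carrier_mat[of _ "d * n" "d * n"]
        assoc_mult_mat_vec[of _ "d * n" "d * n" _ "\<epsilon> * n"])
  have "(mat_adjoint K *\<^sub>v (pencil_eval n L X *\<^sub>v (K *\<^sub>v v))) \<bullet>c v = (pencil_eval n L X *\<^sub>v (K *\<^sub>v v)) \<bullet>c (K *\<^sub>v v)"
    using mult_vec_cscalar_prod[OF mat_adjoint_carrier[OF K], of "pencil_eval n L X *\<^sub>v (K *\<^sub>v v)" v] K Lc v by simp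
  moreover have "mat_adjoint K *\<^sub>v (pencil_eval n L X *\<^sub>v (K *\<^sub>v v)) \<in> carrier_vec (\<epsilon> * n)"
    using mat_adjoint_carrier[OF K] Lc K v by (auto intro!: mult_mat_vec_carrier)
  moreover have "mat_adjoint K * (pencil_eval n L X * K) \<in> carrier_mat (\<epsilon> * n) (\<epsilon> * n)"
    using mat_adjoint_carrier[OF K] Lc K by (auto intro!: mult_carrier_mat)
  ultimately have "((mat_adjoint K * (pencil_eval n L X * K) + pencil_eval n q X) *\<^sub>v v) \<bullet>c v =
     (pencil_eval n L X *\<^sub>v (K *\<^sub>v v)) \<bullet>c (K *\<^sub>v v) + (pencil_eval n q X *\<^sub>v v) \<bullet>c v"
    using v pencil_eval_carrier[OF q, of n X] 1
    by (simp add: add_mult_distrib_mat_vec[of _ "\<epsilon> * n" "\<epsilon> * n"] add_scalar_prod_distrib[of _ "\<epsilon> * n"]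
        mult_mat_vec_carrier[of _ "\<epsilon> * n" "\<epsilon> * n"])
  moreover have "(pencil_eval n q X *\<^sub>v v) \<bullet>c v = (kron P0 (1\<^sub>m n) *\<^sub>v v) \<bullet>c v +
    (\<Sum>C\<leftarrow>Cs. (pencil_eval n L X *\<^sub>v (kron C (1\<^sub>m n) *\<^sub>v v)) \<bullet>c (kron C (1\<^sub>m n) *\<^sub>v v))"
    unfolding q_def using Cons by simp
  ultimately show ?case
    by (simp add: q_def[symmetric] eq K_def[symmetric])
qed

text \<open>The left-hand side of the certificate has the value 0 at \<open>v\<close>: in one
  summand the value of \<open>Lt\<close> meets \<open>v\<close> directly, in the other after moving
  its adjoint across the inner product. On the right-hand side no term is negative.\<close>

lemma certificate_kernel:
  assumes A: "\<forall>j. A j \<in> carrier_mat d d" and Lt: "Lt \<in> carrier_pencil \<delta> \<epsilon>"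
    and cert: "is_certificate d \<delta> \<epsilon> (hermitian_monic_pencil d A) Lt D P0 Cs"
    and X: "X \<in> interior_spectrahedron (hermitian_monic_pencil d A) n"
    and v: "v \<in> carrier_vec (\<epsilon> * n)" "pencil_eval n Lt X *\<^sub>v v = 0\<^sub>v (\<delta> * n)"
    and i: "i < n"
  shows "slice \<epsilon> n v i \<in> common_kernel P0 Cs"
proof -
  let ?L = "hermitian_monic_pencil d A"
  note L = hermitian_monic_pencil_carrier[OF A]
  have XT: "X \<in> mat_tuples n" using X by (simp add: interior_spectrahedron_def)
  have D: "D \<in> carrier_mat \<epsilon> \<delta>" and psd: "psd \<epsilon> P0" and Cs: "set Cs \<subseteq> carrier_mat d \<epsilon>"
    and eq: "pencil_add (pencil_lmult D Lt) (pencil_rmult (pencil_adjoint Lt) (mat_adjoint D)) =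
     foldr (\<lambda>C. pencil_add (pencil_lmult (mat_adjoint C) (pencil_rmult ?L C))) Cs (const_pencil \<epsilon> \<epsilon> P0)"
    using cert by (auto simp: is_certificate_def)
  have P0: "P0 \<in> carrier_mat \<epsilon> \<epsilon>" using psd by (simp add: psd_def)
  define M K where "M = pencil_eval n Lt X" and "K = kron D (1\<^sub>m n)"
  have M: "M \<in> carrier_mat (\<delta> * n) (\<epsilon> * n)" unfolding M_def by (rule pencil_eval_carrier[OF Lt])
  have K: "K \<in> carrier_mat (\<epsilon> * n) (\<delta> * n)" unfolding K_def using D by simp
  have "pencil_eval n (pencil_add (pencil_lmult D Lt) (pencil_rmult (pencil_adjoint Lt) (mat_adjoint D))) X
    = K * M + mat_adjoint M * mat_adjoint K"
    unfolding pencil_eval_add[OF pencil_carrier_intros(2)[OF D Lt]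
        pencil_carrier_intros(3)[OF pencil_carrier_intros(4)[OF Lt] mat_adjoint_carrier[OF D]] XT]
      pencil_eval_lmult[OF D Lt XT] pencil_eval_adjoint[OF Lt XT]
      pencil_eval_rmult[OF mat_adjoint_carrier[OF D] pencil_carrier_intros(4)[OF Lt] XT] M_def K_def
    using kron_adjoint[OF D one_carrier_mat[of n]] by simp
  moreover have "((K * M + mat_adjoint M * mat_adjoint K) *\<^sub>v v) \<bullet>c v = 0"
  proof -
    have KM: "K * M \<in> carrier_mat (\<epsilon> * n) (\<epsilon> * n)" using K M by simp
    have MK: "mat_adjoint M * mat_adjoint K \<in> carrier_mat (\<epsilon> * n) (\<epsilon> * n)"
      by (rule mult_carrier_mat[OF mat_adjoint_carrier[OF M] mat_adjoint_carrier[OF K]])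
    have "(K * M) *\<^sub>v v = 0\<^sub>v (\<epsilon> * n)"
      using assoc_mult_mat_vec[OF K M v(1)] v(2) K by (auto simp: M_def)
    moreover have "((mat_adjoint M * mat_adjoint K) *\<^sub>v v) \<bullet>c v = 0"
    proof -
      have Kv: "mat_adjoint K *\<^sub>v v \<in> carrier_vec (\<delta> * n)" using K v by (simp add: mult_mat_vec_carrier[of _ _ "\<epsilon> * n"])
      have "((mat_adjoint M * mat_adjoint K) *\<^sub>v v) \<bullet>c v = (mat_adjoint M *\<^sub>v (mat_adjoint K *\<^sub>v v)) \<bullet>c v"
        using assoc_mult_mat_vec[OF mat_adjoint_carrier[OF M] mat_adjoint_carrier[OF K] v(1)] by simp
      also have "\<dots> = (mat_adjoint K *\<^sub>v v) \<bullet>c (M *\<^sub>v v)"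
        using mult_vec_cscalar_prod[OF mat_adjoint_carrier[OF M] Kv v(1)] by simp
      also have "\<dots> = 0" using v(2) Kv by (simp add: M_def)
      finally show ?thesis .
    qed
    ultimately show ?thesis
      using KM MK v by (simp add: add_mult_distrib_mat_vec[OF KM MK v(1)] add_scalar_prod_distrib[of _ "\<epsilon> * n"])
  qed
  ultimately have zero: "(kron P0 (1\<^sub>m n) *\<^sub>v v) \<bullet>c v +
    (\<Sum>C\<leftarrow>Cs. (pencil_eval n ?L X *\<^sub>v (kron C (1\<^sub>m n) *\<^sub>v v)) \<bullet>c (kron C (1\<^sub>m n) *\<^sub>v v)) = 0"
    using certificate_sum_form[OF L P0 Cs XT v(1)] unfolding eq by simp
  \<comment> \<open>The form of \<open>P0\<close> becomes the squared length of
    \<open>N *\<^sub>v v\<close>; so a vanishing value of the form yields a vanishing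
    vector.\<close>
  obtain G where G: "G \<in> carrier_mat \<epsilon> \<epsilon>" "P0 = G * mat_adjoint G" using psd_factorization[OF psd] .
  define N where "N = kron (mat_adjoint G) (1\<^sub>m n)"
  have N: "N \<in> carrier_mat (\<epsilon> * n) (\<epsilon> * n)" using G by (simp add: N_def)
  have "kron P0 (1\<^sub>m n) = mat_adjoint N * N"
    using kron_mult[OF G(1) mat_adjoint_carrier[OF G(1)] one_carrier_mat[of n] one_carrier_mat[of n]]
      kron_adjoint[OF mat_adjoint_carrier[OF G(1)] one_carrier_mat[of n]] G(2) by (simp add: N_def)
  then have PN: "kron P0 (1\<^sub>m n) *\<^sub>v v = mat_adjoint N *\<^sub>v (N *\<^sub>v v)"
    using assoc_mult_mat_vec[OF mat_adjoint_carrier[OF N] N v(1)] by simp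
  have Nv: "N *\<^sub>v v \<in> carrier_vec (\<epsilon> * n)" using N v by (simp add: mult_mat_vec_carrier[of _ _ "\<epsilon> * n"])
  have Pform: "(kron P0 (1\<^sub>m n) *\<^sub>v v) \<bullet>c v = (N *\<^sub>v v) \<bullet>c (N *\<^sub>v v)"
    unfolding PN using mult_vec_cscalar_prod[OF mat_adjoint_carrier[OF N] Nv v(1)] by simp
  then have P1: "0 \<le> Re ((kron P0 (1\<^sub>m n) *\<^sub>v v) \<bullet>c v)"
    using cscalar_prod_self[OF Nv] by (simp add: sum_nonneg)
  have Kc: "kron C (1\<^sub>m n) *\<^sub>v v \<in> carrier_vec (d * n)" if "C \<in> set Cs" for C
    using that Cs v by (intro mult_mat_vec_carrier[of _ _ "\<epsilon> * n"] kron_carrier) auto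
  have L1: "0 \<le> Re ((pencil_eval n ?L X *\<^sub>v (kron C (1\<^sub>m n) *\<^sub>v v)) \<bullet>c (kron C (1\<^sub>m n) *\<^sub>v v))"
    if "C \<in> set Cs" for C
  proof (cases "kron C (1\<^sub>m n) *\<^sub>v v = 0\<^sub>v (d * n)")
    case True
    show ?thesis unfolding True using pencil_eval_carrier[OF L, of n X] by simp
  qed (use interior_spectrahedron_posdef[OF A X Kc[OF that]] in auto)
  have Re_list: "Re (\<Sum>C\<leftarrow>xs. f C) = (\<Sum>C\<leftarrow>xs. Re (f C))" for f :: "complex mat \<Rightarrow> complex" and xs
    by (induction xs) auto
  have sum0: "Re ((kron P0 (1\<^sub>m n) *\<^sub>v v) \<bullet>c v) +
    (\<Sum>C\<leftarrow>Cs. Re ((pencil_eval n ?L X *\<^sub>v (kron C (1\<^sub>m n) *\<^sub>v v)) \<bullet>c (kron C (1\<^sub>m n) *\<^sub>v v))) = 0"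
    using arg_cong[OF zero, of Re] by (simp add: Re_list)
  have sumge: "0 \<le> (\<Sum>C\<leftarrow>Cs. Re ((pencil_eval n ?L X *\<^sub>v (kron C (1\<^sub>m n) *\<^sub>v v)) \<bullet>c (kron C (1\<^sub>m n) *\<^sub>v v)))"
    by (rule sum_list_nonneg) (use L1 in auto)
  have "kron P0 (1\<^sub>m n) *\<^sub>v v = 0\<^sub>v (\<epsilon> * n)"
  proof -
    have "Re ((kron P0 (1\<^sub>m n) *\<^sub>v v) \<bullet>c v) = 0" using sum0 sumge P1 by simp
    then have "(N *\<^sub>v v) \<bullet>c (N *\<^sub>v v) = 0" unfolding Pform cscalar_prod_self[OF Nv] by simp
    then have "N *\<^sub>v v = 0\<^sub>v (\<epsilon> * n)" using conjugate_square_eq_0_vec[OF Nv] by simp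
    then show ?thesis unfolding PN using mult_mat_zero_vec[OF mat_adjoint_carrier[OF N]] by simp
  qed
  from arg_cong[OF this, of "\<lambda>w. slice \<epsilon> n w i"] have "P0 *\<^sub>v slice \<epsilon> n v i = 0\<^sub>v \<epsilon>"
    using slice_kron_one[OF P0 v(1) i] slice_zero[OF i] by simp
  moreover have "C *\<^sub>v slice \<epsilon> n v i = 0\<^sub>v d" if C: "C \<in> set Cs" for C
  proof -
    have "(\<Sum>C\<leftarrow>Cs. Re ((pencil_eval n ?L X *\<^sub>v (kron C (1\<^sub>m n) *\<^sub>v v)) \<bullet>c (kron C (1\<^sub>m n) *\<^sub>v v))) = 0"
      using sum0 sumge P1 by simp
    then have "Re ((pencil_eval n ?L X *\<^sub>v (kron C (1\<^sub>m n) *\<^sub>v v)) \<bullet>c (kron C (1\<^sub>m n) *\<^sub>v v)) = 0"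
      by (subst (asm) sum_list_nonneg_eq_0_iff) (use L1 C in auto)
    \<comment> \<open>Interiority enters here: strict positivity excludes a nonzero vector, while at
      a boundary point the form may vanish on one.\<close>
    then have "kron C (1\<^sub>m n) *\<^sub>v v = 0\<^sub>v (d * n)"
      using interior_spectrahedron_posdef[OF A X Kc[OF C]] by fastforce
    from arg_cong[OF this, of "\<lambda>w. slice d n w i"] show ?thesis
      using slice_kron_one[of C d \<epsilon> v n i] slice_zero[OF i] C Cs v(1) i by auto
  qed
  ultimately show ?thesis
    unfolding common_kernel_def using P0 Cs by (auto simp: mat_kernel_def)
qed

lemma full_rank_on_interior_iff:
  assumes "p \<in> carrier_pencil \<delta> \<epsilon>"
  shows "full_rank_on_interior L p \<longleftrightarrow> (\<forall>n>0. \<forall>X\<in>interior_spectrahedron L n.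
    \<forall>v\<in>carrier_vec (\<epsilon> * n). pencil_eval n p X *\<^sub>v v = 0\<^sub>v (\<delta> * n) \<longrightarrow> v = 0\<^sub>v (\<epsilon> * n))"
  unfolding full_rank_on_interior_def using full_column_rank_iff[OF pencil_eval_carrier[OF assms]] by simp

lemma full_rank_of_trivial_common_kernel:
  assumes A: "\<forall>j. A j \<in> carrier_mat d d" and Lt: "Lt \<in> carrier_pencil \<delta> \<epsilon>"
    and cert: "is_certificate d \<delta> \<epsilon> (hermitian_monic_pencil d A) Lt D P0 Cs"
    and V: "common_kernel P0 Cs = {0\<^sub>v \<epsilon>}"
  shows "full_rank_on_interior (hermitian_monic_pencil d A) Lt"
  unfolding full_rank_on_interior_iff[OF Lt]
proof (intro allI impI ballI)
  fix n X v
  assume *: "X \<in> interior_spectrahedron (hermitian_monic_pencil d A) n" "v \<in> carrier_vec (\<epsilon> * n)"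
    "pencil_eval n Lt X *\<^sub>v v = 0\<^sub>v (\<delta> * n)"
  show "v = 0\<^sub>v (\<epsilon> * n)"
    using certificate_kernel[OF A Lt cert *] V by (intro eq_zero_vec_sliceI[OF *(2)]) simp
qed

text \<open>\<open>kron B (1\<^sub>m n)\<close> embeds the kernel of the restricted pencil
  injectively into that of \<open>Lt\<close>. It is onto, because by
  \<open>certificate_kernel\<close> all slices of a kernel vector of \<open>Lt\<close> lie in the
  span of the columns of \<open>B\<close>.\<close>

lemma full_rank_iff_restriction:
  assumes A: "\<forall>j. A j \<in> carrier_mat d d" and Lt: "Lt \<in> carrier_pencil \<delta> \<epsilon>"
    and cert: "is_certificate d \<delta> \<epsilon> (hermitian_monic_pencil d A) Lt D P0 Cs"
    and B: "vec_space.basis_mat \<epsilon> (common_kernel P0 Cs) B"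
  shows "full_rank_on_interior (hermitian_monic_pencil d A) Lt \<longleftrightarrow>
    full_rank_on_interior (hermitian_monic_pencil d A) (pencil_rmult Lt B)"
proof -
  let ?L = "hermitian_monic_pencil d A"
  define m where "m = dim_col B"
  note Bc = basis_matD(1)[OF B, folded m_def]
  note LB = pencil_carrier_intros(3)[OF Lt Bc]
  have KB: "kron B (1\<^sub>m n) \<in> carrier_mat (\<epsilon> * n) (m * n)" for n using Bc by simp
  have ev: "pencil_eval n (pencil_rmult Lt B) X *\<^sub>v w = pencil_eval n Lt X *\<^sub>v (kron B (1\<^sub>m n) *\<^sub>v w)"
    if "X \<in> interior_spectrahedron ?L n" "w \<in> carrier_vec (m * n)" for n X w
    using that pencil_eval_rmult[OF Bc Lt, of X n]
      assoc_mult_mat_vec[OF pencil_eval_carrier[OF Lt, of n X] KB that(2)]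
    by (simp add: interior_spectrahedron_def)
  show ?thesis
    unfolding full_rank_on_interior_iff[OF Lt] full_rank_on_interior_iff[OF LB]
  proof (intro iffI allI impI ballI)
    fix n X w
    assume full: "\<forall>n>0. \<forall>X\<in>interior_spectrahedron ?L n. \<forall>v\<in>carrier_vec (\<epsilon> * n).
        pencil_eval n Lt X *\<^sub>v v = 0\<^sub>v (\<delta> * n) \<longrightarrow> v = 0\<^sub>v (\<epsilon> * n)"
      and *: "0 < n" "X \<in> interior_spectrahedron ?L n" "w \<in> carrier_vec (m * n)"
        "pencil_eval n (pencil_rmult Lt B) X *\<^sub>v w = 0\<^sub>v (\<delta> * n)"
    have "kron B (1\<^sub>m n) *\<^sub>v w \<in> carrier_vec (\<epsilon> * n)" using KB *(3) by (rule mult_mat_vec_carrier)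
    with full * ev[OF *(2,3)] have z: "kron B (1\<^sub>m n) *\<^sub>v w = 0\<^sub>v (\<epsilon> * n)" by simp
    show "w = 0\<^sub>v (m * n)"
    proof (rule eq_zero_vec_sliceI[OF *(3)])
      fix i assume i: "i < n"
      show "slice m n w i = 0\<^sub>v m"
      using arg_cong[OF z, of "\<lambda>w. slice \<epsilon> n w i"] slice_kron_one[OF Bc *(3) i] slice_zero[OF i]
      by (intro basis_matD(2)[OF B, folded m_def]) simp_all
    qed
  next
    fix n X v
    assume full: "\<forall>n>0. \<forall>X\<in>interior_spectrahedron ?L n. \<forall>w\<in>carrier_vec (m * n).
        pencil_eval n (pencil_rmult Lt B) X *\<^sub>v w = 0\<^sub>v (\<delta> * n) \<longrightarrow> w = 0\<^sub>v (m * n)"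
      and *: "0 < n" "X \<in> interior_spectrahedron ?L n" "v \<in> carrier_vec (\<epsilon> * n)"
        "pencil_eval n Lt X *\<^sub>v v = 0\<^sub>v (\<delta> * n)"
    have "\<exists>u\<in>carrier_vec m. slice \<epsilon> n v i = B *\<^sub>v u" if "i < n" for i
      using basis_matD(3)[OF B certificate_kernel[OF A Lt cert *(2-4) that]] by (simp add: m_def)
    then obtain u where u: "\<And>i. i < n \<Longrightarrow> u i \<in> carrier_vec m" "\<And>i. i < n \<Longrightarrow> slice \<epsilon> n v i = B *\<^sub>v u i"
      by metis
    \<comment> \<open>Glues the coordinate vectors \<open>u i\<close> together: position
      \<open>s\<close> belongs to slice \<open>s mod n\<close> and coordinate
      \<open>s div n\<close>.\<close>
    define w where "w = vec (m * n) (\<lambda>s. u (s mod n) $ (s div n))"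
    have w: "w \<in> carrier_vec (m * n)" by (simp add: w_def)
    have sw: "slice m n w i = u i" if "i < n" for i
      using u(1)[OF that] that by (intro eq_vecI) (auto simp: slice_def w_def block_index_less)
    have vw: "v = kron B (1\<^sub>m n) *\<^sub>v w"
    proof (rule eq_vec_sliceI[OF *(3) mult_mat_vec_carrier[OF KB w]])
      show "slice \<epsilon> n v i = slice \<epsilon> n (kron B (1\<^sub>m n) *\<^sub>v w) i" if "i < n" for i
        using u(2)[OF that] sw[OF that] slice_kron_one[OF Bc w that] by simp
    qed
    then have "w = 0\<^sub>v (m * n)" using full * w ev[OF *(2) w] by simp
    then show "v = 0\<^sub>v (\<epsilon> * n)" unfolding vw using mult_mat_zero_vec[OF KB] by simp
  qed
qed

text \<open>Some matrix of the solution is nonzero, so its kernel, and with it the intersection, is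
  a proper subspace. The strict drop in size is what makes repeated restriction terminate.\<close>

lemma dim_common_kernel:
  assumes cert: "is_certificate d \<delta> \<epsilon> L Lt D P0 Cs" and nz: "\<not> is_zero_solution d \<epsilon> P0 Cs"
    and B: "vec_space.basis_mat \<epsilon> (common_kernel P0 Cs) B"
  shows "dim_col B < \<epsilon>"
proof (rule ccontr)
  assume "\<not> dim_col B < \<epsilon>"
  then have V: "common_kernel P0 Cs = carrier_vec \<epsilon>"
    using basis_matD(5,6)[OF B] by simp
  have zero: "M = 0\<^sub>m r \<epsilon>" if "M \<in> carrier_mat r \<epsilon>" "carrier_vec \<epsilon> \<subseteq> mat_kernel M" for M :: "complex mat" and r
  proof (rule eq_matI)
    fix i j assume ij: "i < dim_row (0\<^sub>m r \<epsilon> :: complex mat)" "j < dim_col (0\<^sub>m r \<epsilon> :: complex mat)"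
    have "unit_vec \<epsilon> j \<in> mat_kernel M" using that(2) by auto
    then have "M *\<^sub>v unit_vec \<epsilon> j = 0\<^sub>v r" using that(1) by (auto simp: mat_kernel_def)
    from arg_cong[OF this, of "\<lambda>v. v $ i"] show "M $$ (i, j) = 0\<^sub>m r \<epsilon> $$ (i, j)"
      using that ij by simp
  qed (use that in auto)
  have "P0 = 0\<^sub>m \<epsilon> \<epsilon>" using cert V by (intro zero) (auto simp: is_certificate_def psd_def common_kernel_def)
  moreover have "\<forall>C\<in>set Cs. C = 0\<^sub>m d \<epsilon>"
    using cert V by (intro ballI zero) (auto simp: is_certificate_def common_kernel_def)
  ultimately show False using nz by (simp add: is_zero_solution_def)
qed

subsection \<open>Positive definite points are interior\<close>

text \<open>Each product of moduli is at most half the sum of the squares. The resulting factor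
  \<open>card S\<close> is crude but harmless, since the level stays fixed where the bound is
  applied.\<close>

lemma qform_norm_bound:
  assumes "\<And>i j. i \<in> S \<Longrightarrow> j \<in> S \<Longrightarrow> cmod (E i j) \<le> e"
  shows "cmod (qform S E v) \<le> e * real (card S) * (\<Sum>i\<in>S. (cmod (v i))\<^sup>2)"
proof -
  have "cmod (qform S E v) \<le> (\<Sum>i\<in>S. \<Sum>j\<in>S. cmod (cnj (v i) * E i j * v j))"
    unfolding qform_def by (intro order.trans[OF norm_sum] sum_mono norm_sum)
  also have "\<dots> \<le> (\<Sum>i\<in>S. \<Sum>j\<in>S. e * (((cmod (v i))\<^sup>2 + (cmod (v j))\<^sup>2) / 2))"
  proof (intro sum_mono)
    fix i j assume ij: "i \<in> S" "j \<in> S"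
    have "cmod (v i) * cmod (v j) \<le> ((cmod (v i))\<^sup>2 + (cmod (v j))\<^sup>2) / 2"
      using zero_le_power2[of "cmod (v i) - cmod (v j)"] by (simp add: power2_diff)
    then have "cmod (E i j) * (cmod (v i) * cmod (v j)) \<le> e * (((cmod (v i))\<^sup>2 + (cmod (v j))\<^sup>2) / 2)"
      using assms[OF ij] order.trans[OF norm_ge_zero assms[OF ij]] by (intro mult_mono) auto
    then show "cmod (cnj (v i) * E i j * v j) \<le> e * (((cmod (v i))\<^sup>2 + (cmod (v j))\<^sup>2) / 2)"
      by (simp add: norm_mult mult_ac)
  qed
  also have "\<dots> = e * ((\<Sum>i\<in>S. \<Sum>j\<in>S. (cmod (v i))\<^sup>2) + (\<Sum>i\<in>S. \<Sum>j\<in>S. (cmod (v j))\<^sup>2)) / 2"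
    by (simp only: sum_distrib_left[symmetric] sum_divide_distrib[symmetric] sum.distrib times_divide_eq_right)
  also have "\<dots> = e * real (card S) * (\<Sum>i\<in>S. (cmod (v i))\<^sup>2)"
    by (simp add: sum_distrib_left[symmetric])
  finally show ?thesis .
qed

text \<open>Coercivity leaves a slack \<open>c\<close>. The pencil is affine, so moving the entries
  of \<open>X\<close> by less than \<open>r\<close> moves every entry of its value by at most
  \<open>2 * K * r\<close>, and the form by at most \<open>d * n\<close> times that, relative to the
  squared length of the vector; the slack absorbs it.\<close>

lemma posdef_interior_spectrahedron:
  assumes A: "\<forall>j. A j \<in> carrier_mat d d" and X: "X \<in> mat_tuples n"
    and pos: "\<And>v. v \<in> carrier_vec (d * n) \<Longrightarrow> v \<noteq> 0\<^sub>v (d * n) \<Longrightarrow>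
      0 < Re ((pencil_eval n (hermitian_monic_pencil d A) X *\<^sub>v v) \<bullet>c v)"
  shows "X \<in> interior_spectrahedron (hermitian_monic_pencil d A) n"
proof -
  let ?L = "hermitian_monic_pencil d A" and ?S = "{..<d * n}"
  note ec = pencil_eval_carrier[OF hermitian_monic_pencil_carrier[OF A], of n]
  let ?H = "\<lambda>Y i j. pencil_eval n ?L Y $$ (i, j)"
  have "\<exists>c>0. \<forall>v. c * (\<Sum>i\<in>?S. (cmod (v i))\<^sup>2) \<le> Re (qform ?S (?H X) v)"
  proof (rule posdef_function_coercive)
    fix v :: "nat \<Rightarrow> complex" assume "\<exists>i\<in>?S. v i \<noteq> 0"
    then obtain i where i: "i < d * n" "v i \<noteq> 0" by auto
    have "vec (d * n) v \<noteq> 0\<^sub>v (d * n)"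
    proof
      assume "vec (d * n) v = 0\<^sub>v (d * n)"
      from arg_cong[OF this, of "\<lambda>w. w $ i"] show False using i by simp
    qed
    with pos[of "vec (d * n) v"] have "0 < Re ((pencil_eval n ?L X *\<^sub>v vec (d * n) v) \<bullet>c vec (d * n) v)"
      by simp
    also have "(pencil_eval n ?L X *\<^sub>v vec (d * n) v) \<bullet>c vec (d * n) v = qform ?S (?H X) v"
      by (subst cscalar_prod_qform[OF ec]) (auto intro: qform_cong)
    finally show "0 < Re (qform ?S (?H X) v)" .
  qed simp
  then obtain c where c: "c > 0" "\<And>v. c * (\<Sum>i\<in>?S. (cmod (v i))\<^sup>2) \<le> Re (qform ?S (?H X) v)" by blast
  \<comment> \<open>One bound for the coefficient sums at all positions; the terms in
    \<open>X\<close> and in its adjoint each contribute it once, whence the factor 2 below.\<close>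
  define K where "K = (\<Sum>j\<in>UNIV. \<Sum>a<d. \<Sum>b<d. cmod (A j $$ (a, b)))"
  have K: "(\<Sum>j\<in>UNIV. cmod (A j $$ (a, b))) \<le> K" if "a < d" "b < d" for a b
  proof -
    have "cmod (A j $$ (a, b)) \<le> (\<Sum>a<d. \<Sum>b<d. cmod (A j $$ (a, b)))" for j
    proof -
      have "cmod (A j $$ (a, b)) \<le> (\<Sum>b<d. cmod (A j $$ (a, b)))"
        using that by (intro member_le_sum) auto
      also have "\<dots> \<le> (\<Sum>a<d. \<Sum>b<d. cmod (A j $$ (a, b)))"
        using that by (intro member_le_sum[of a _ "\<lambda>a. \<Sum>b<d. cmod (A j $$ (a, b))"]) (auto intro: sum_nonneg)
      finally show ?thesis .
    qed
    then show ?thesis unfolding K_def by (intro sum_mono)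
  qed
  have K0: "K \<ge> 0" unfolding K_def by (intro sum_nonneg) auto
  \<comment> \<open>Chosen so that \<open>2 * K * r * real (d * n) \<le> c\<close>; the
    \<open>+ 1\<close> keeps the denominator positive when \<open>K\<close> or \<open>d * n\<close>
    is 0.\<close>
  define r where "r = c / (2 * K * real (d * n) + 1)"
  have r: "r > 0" using c K0 by (simp add: r_def divide_pos_pos add_nonneg_pos)
  have rc: "2 * K * r * real (d * n) \<le> c"
  proof -
    have "2 * K * real (d * n) * c \<le> c * (2 * K * real (d * n) + 1)" using c by (simp add: algebra_simps)
    moreover have "0 < 2 * K * real (d * n) + 1" using K0 by (simp add: add_nonneg_pos)
    ultimately have "2 * K * real (d * n) * c / (2 * K * real (d * n) + 1) \<le> c" by (simp add: pos_divide_le_eq)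
    then show ?thesis by (simp add: r_def mult_ac)
  qed
  have "Y \<in> free_spectrahedron ?L n"
    if Y: "Y \<in> mat_tuples n" and near: "\<forall>j. \<forall>a<n. \<forall>b<n. cmod (Y j $$ (a, b) - X j $$ (a, b)) < r" for Y
  proof -
    have bound: "cmod (?H Y s t - ?H X s t) \<le> 2 * K * r" if "s \<in> ?S" "t \<in> ?S" for s t
    proof -
      from that have "s < d * n" "t < d * n" by auto
      then obtain a i b k where ab: "a < d" "b < d" "i < n" "k < n" and st: "s = a * n + i" "t = b * n + k"
        by (metis less_mult_cases)
      let ?E = "\<lambda>j i k. Y j $$ (i, k) - X j $$ (i, k)"
      have eq: "?H Y s t - ?H X s t = - (\<Sum>j\<in>UNIV. A j $$ (a, b) * ?E j i k)
          - (\<Sum>j\<in>UNIV. cnj (A j $$ (b, a)) * cnj (?E j k i))"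
        unfolding st hermitian_monic_pencil_eval_index[OF A X ab] hermitian_monic_pencil_eval_index[OF A Y ab]
        by (simp add: right_diff_distrib sum_subtractf)
      have "cmod (?H Y s t - ?H X s t) \<le>
          cmod (\<Sum>j\<in>UNIV. A j $$ (a, b) * ?E j i k) + cmod (\<Sum>j\<in>UNIV. cnj (A j $$ (b, a)) * cnj (?E j k i))"
        unfolding eq by (rule order.trans[OF norm_triangle_ineq4]) (simp only: norm_minus_cancel order.refl)
      also have "\<dots> \<le> (\<Sum>j\<in>UNIV. cmod (A j $$ (a, b)) * r) + (\<Sum>j\<in>UNIV. cmod (A j $$ (b, a)) * r)"
      proof (intro add_mono order.trans[OF norm_sum] sum_mono)
        show "cmod (A j $$ (a, b) * ?E j i k) \<le> cmod (A j $$ (a, b)) * r" for j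
          unfolding norm_mult using near ab by (intro mult_left_mono[OF less_imp_le]) auto
        show "cmod (cnj (A j $$ (b, a)) * cnj (?E j k i)) \<le> cmod (A j $$ (b, a)) * r" for j
          unfolding norm_mult complex_mod_cnj using near ab by (intro mult_left_mono[OF less_imp_le]) auto
      qed
      also have "\<dots> = ((\<Sum>j\<in>UNIV. cmod (A j $$ (a, b))) + (\<Sum>j\<in>UNIV. cmod (A j $$ (b, a)))) * r"
        by (simp only: sum_distrib_right distrib_right)
      also have "\<dots> \<le> (K + K) * r" using r K[OF ab(1,2)] K[OF ab(2,1)] by (intro mult_right_mono add_mono) auto
      finally show ?thesis by simp
    qed
    have "0 \<le> Re ((pencil_eval n ?L Y *\<^sub>v v) \<bullet>c v)" if v: "v \<in> carrier_vec (d * n)" for v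
    proof -
      define s where "s = (\<Sum>i\<in>?S. (cmod (v $ i))\<^sup>2)"
      have s: "s \<ge> 0" unfolding s_def by (intro sum_nonneg) auto
      have "cmod (qform ?S (\<lambda>i j. ?H Y i j - ?H X i j) (\<lambda>i. v $ i)) \<le> 2 * K * r * real (card ?S) * s"
        unfolding s_def using bound by (rule qform_norm_bound)
      also have "\<dots> \<le> c * s" using mult_right_mono[OF rc s] by simp
      finally have "cmod (qform ?S (?H Y) (\<lambda>i. v $ i) - qform ?S (?H X) (\<lambda>i. v $ i)) \<le> c * s"
        unfolding qform_diff .
      moreover have "c * s \<le> Re (qform ?S (?H X) (\<lambda>i. v $ i))" unfolding s_def by (rule c)
      moreover have "- cmod (qform ?S (?H Y) (\<lambda>i. v $ i) - qform ?S (?H X) (\<lambda>i. v $ i)) \<le>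
          Re (qform ?S (?H Y) (\<lambda>i. v $ i)) - Re (qform ?S (?H X) (\<lambda>i. v $ i))"
        using abs_Re_le_cmod[of "qform ?S (?H Y) (\<lambda>i. v $ i) - qform ?S (?H X) (\<lambda>i. v $ i)"]
        unfolding minus_complex.sel by linarith
      ultimately have "0 \<le> Re (qform ?S (?H Y) (\<lambda>i. v $ i))" by linarith
      then show ?thesis by (simp only: cscalar_prod_qform[OF ec v])
    qed
    then have "psd (d * n) (pencil_eval n ?L Y)"
      using ec hermitian_monic_pencil_eval_hermitian[OF A Y] by (simp add: psd_def)
    then show ?thesis using Y by (simp add: free_spectrahedron_def hermitian_monic_pencil_def)
  qed
  then show ?thesis using X r by (auto simp: interior_spectrahedron_def)
qed

subsection \<open>Real coordinates of the two sides of the certificate equation\<close>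

lemma pencil_coeff_simps:
  "const_coeff (pencil_add p q) = const_coeff p + const_coeff q"
  "x_coeff (pencil_add p q) j = x_coeff p j + x_coeff q j"
  "xstar_coeff (pencil_add p q) j = xstar_coeff p j + xstar_coeff q j"
  "const_coeff (pencil_lmult M p) = M * const_coeff p"
  "x_coeff (pencil_lmult M p) j = M * x_coeff p j"
  "xstar_coeff (pencil_lmult M p) j = M * xstar_coeff p j"
  "const_coeff (pencil_rmult p M) = const_coeff p * M"
  "x_coeff (pencil_rmult p M) j = x_coeff p j * M"
  "xstar_coeff (pencil_rmult p M) j = xstar_coeff p j * M"
  "const_coeff (pencil_adjoint p) = mat_adjoint (const_coeff p)"
  "x_coeff (pencil_adjoint p) j = mat_adjoint (xstar_coeff p j)"
  "xstar_coeff (pencil_adjoint p) j = mat_adjoint (x_coeff p j)"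
  by (simp_all add: pencil_add_def pencil_lmult_def pencil_rmult_def pencil_adjoint_def)

lemma certificate_sum_coeff:
  assumes L: "L \<in> carrier_pencil d d" and P0: "P0 \<in> carrier_mat \<epsilon> \<epsilon>" and Cs: "set Cs \<subseteq> carrier_mat d \<epsilon>"
    and ab: "a < \<epsilon>" "b < \<epsilon>"
  defines "q \<equiv> foldr (\<lambda>C. pencil_add (pencil_lmult (mat_adjoint C) (pencil_rmult L C))) Cs (const_pencil \<epsilon> \<epsilon> P0)"
  shows "const_coeff q $$ (a, b) = P0 $$ (a, b) + (\<Sum>C\<leftarrow>Cs. (mat_adjoint C * (const_coeff L * C)) $$ (a, b))"
    and "x_coeff q j $$ (a, b) = (\<Sum>C\<leftarrow>Cs. (mat_adjoint C * (x_coeff L j * C)) $$ (a, b))"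
  using Cs unfolding q_def
proof (induction Cs)
  case (Cons C Cs)
  let ?q = "foldr (\<lambda>C. pencil_add (pencil_lmult (mat_adjoint C) (pencil_rmult L C))) Cs (const_pencil \<epsilon> \<epsilon> P0)"
  have qc: "const_coeff ?q \<in> carrier_mat \<epsilon> \<epsilon>" "x_coeff ?q j \<in> carrier_mat \<epsilon> \<epsilon>"
    if "set (C # Cs) \<subseteq> carrier_mat d \<epsilon>"
    using that by (auto intro!: carrier_pencilD certificate_sum_carrier[OF L P0])
  { case 1
    then show ?case using Cons.IH(1) qc(1)[OF 1] ab by (simp add: pencil_coeff_simps)
  next
    case 2
    then show ?case using Cons.IH(2) qc(2)[OF 2] ab by (simp add: pencil_coeff_simps) }
qed (use ab in \<open>simp_all add: const_pencil_def\<close>)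

text \<open>Self-adjointness of the right-hand side, which lets the certificate equation be checked
  on the constant term and the coefficients at the \<open>x_j\<close> alone.\<close>

lemma certificate_sum_adjoint:
  assumes L: "L \<in> carrier_pencil d d" and "pencil_adjoint L = L"
    and P0: "P0 \<in> carrier_mat \<epsilon> \<epsilon>" "mat_adjoint P0 = P0" and Cs: "set Cs \<subseteq> carrier_mat d \<epsilon>"
  defines "q \<equiv> foldr (\<lambda>C. pencil_add (pencil_lmult (mat_adjoint C) (pencil_rmult L C))) Cs (const_pencil \<epsilon> \<epsilon> P0)"
  shows "xstar_coeff q j = mat_adjoint (x_coeff q j)"
  using Cs unfolding q_def
proof (induction Cs)
  case Nil
  then show ?case by (auto simp: const_pencil_def intro!: eq_matI)
next
  case (Cons C Cs)
  let ?q = "foldr (\<lambda>C. pencil_add (pencil_lmult (mat_adjoint C) (pencil_rmult L C))) Cs (const_pencil \<epsilon> \<epsilon> P0)"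
  have "?q \<in> carrier_pencil \<epsilon> \<epsilon>" using Cons.prems by (intro certificate_sum_carrier[OF L P0(1)]) auto
  note qc = carrier_pencilD[OF this]
  note Lc = carrier_pencilD[OF L]
  have C: "C \<in> carrier_mat d \<epsilon>" using Cons.prems by simp
  have "xstar_coeff L j = mat_adjoint (x_coeff L j)"
    using arg_cong[OF assms(2), of "\<lambda>p. xstar_coeff p j"] by (simp add: pencil_adjoint_def)
  then have "mat_adjoint C * (xstar_coeff L j * C) = mat_adjoint (mat_adjoint C * (x_coeff L j * C))"
    using C Lc by (simp add: mat_adjoint_mult[OF mat_adjoint_carrier[OF C] mult_carrier_mat[OF Lc(2) C]]
        mat_adjoint_mult[OF Lc(2) C] assoc_mult_mat[OF mat_adjoint_carrier[OF C] mat_adjoint_carrier[OF Lc(2)] C])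
  moreover have "mat_adjoint C * (x_coeff L j * C) \<in> carrier_mat \<epsilon> \<epsilon>"
    by (rule mult_carrier_mat[OF mat_adjoint_carrier[OF C] mult_carrier_mat[OF Lc(2) C]])
  ultimately show ?case
    using Cons qc by (simp add: pencil_coeff_simps mat_adjoint_add[of _ \<epsilon> \<epsilon>])
qed

definition left_coeff :: "'g pencil \<Rightarrow> 'g option \<Rightarrow> complex mat" where
  "left_coeff p w = (case w of None \<Rightarrow> const_coeff p | Some j \<Rightarrow> x_coeff p j)"

text \<open>Its adjoint is \<open>left_coeff (pencil_adjoint p) w\<close>, because taking adjoints
  exchanges each variable with its adjoint.\<close>

definition right_coeff :: "'g pencil \<Rightarrow> 'g option \<Rightarrow> complex mat" where
  "right_coeff p w = (case w of None \<Rightarrow> const_coeff p | Some j \<Rightarrow> xstar_coeff p j)"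

text \<open>The product of the factor \<open>G\<close> with its adjoint. \<open>G\<close> takes a
  pair of indices as one argument, so that all factors form a single function space with the product
  topology.\<close>

definition gram :: "'k set \<Rightarrow> ('k \<times> 'k \<Rightarrow> complex) \<Rightarrow> 'k \<Rightarrow> 'k \<Rightarrow> complex" where
  "gram S G p q = (\<Sum>k\<in>S. G (p, k) * cnj (G (q, k)))"

text \<open>Both sides of the certificate equation are self-adjoint, so the coefficients at the adjoint
  variables are redundant; in a coordinate \<open>(w, a, b)\<close>, \<open>w = None\<close> stands for the constant term. The
  right-hand side depends linearly on a Gram matrix \<open>Z\<close> of stacked matrices with rows \<open>0, \<dots>, d\<close>: the
  rows below \<open>d\<close> form the \<open>C\<^sub>k\<close>, and row \<open>d\<close> contributes \<open>P0\<close>, as if \<open>L\<close> were replaced by the direct sum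
  of \<open>L\<close> and \<open>1\<close>.\<close>

definition cert_coord ::
  "nat \<Rightarrow> ('g \<Rightarrow> complex mat) \<Rightarrow> (nat \<times> nat \<Rightarrow> nat \<times> nat \<Rightarrow> complex) \<Rightarrow> 'g option \<times> nat \<times> nat \<Rightarrow> complex"
  where "cert_coord d A Z = (\<lambda>(w, a, b). case w of
     None \<Rightarrow> (\<Sum>\<alpha>\<le>d. Z (\<alpha>, a) (\<alpha>, b))
   | Some j \<Rightarrow> - (\<Sum>\<alpha><d. \<Sum>\<beta><d. A j $$ (\<alpha>, \<beta>) * Z (\<alpha>, a) (\<beta>, b)))"

text \<open>The left-hand side for \<open>D = z E\<close> with the matrix unit \<open>E\<close> at position \<open>(a0, e0)\<close>. The values
  \<open>z = 1, \<i>\<close> span all \<open>D\<close> over the reals.\<close>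

definition mult_coord ::
  "'g pencil \<Rightarrow> nat \<times> nat \<times> complex \<Rightarrow> 'g option \<times> nat \<times> nat \<Rightarrow> complex"
  where "mult_coord Lt = (\<lambda>(a0, e0, z) (w, a, b).
     (if a = a0 then z * left_coeff Lt w $$ (e0, b) else 0)
   + (if b = a0 then cnj (z * right_coeff Lt w $$ (e0, a)) else 0))"

lemma left_coeff_carrier: "p \<in> carrier_pencil r c \<Longrightarrow> left_coeff p w \<in> carrier_mat r c"
  by (auto simp: left_coeff_def carrier_pencilD split: option.split)

lemma right_coeff_carrier: "p \<in> carrier_pencil r c \<Longrightarrow> right_coeff p w \<in> carrier_mat r c"
  by (auto simp: right_coeff_def carrier_pencilD split: option.split)

lemma pencil_eqI:
  assumes p: "p \<in> carrier_pencil r c" and q: "q \<in> carrier_pencil r c"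
    and left: "\<And>w a b. a < r \<Longrightarrow> b < c \<Longrightarrow> left_coeff p w $$ (a, b) = left_coeff q w $$ (a, b)"
    and star: "\<And>j. xstar_coeff p j = mat_adjoint (x_coeff p j)" "\<And>j. xstar_coeff q j = mat_adjoint (x_coeff q j)"
  shows "p = q"
proof (rule pencil.expand, intro conjI ext)
  have "left_coeff p w = left_coeff q w" for w
    using left left_coeff_carrier[OF p, of w] left_coeff_carrier[OF q, of w] by (intro eq_matI) auto
  from this[of None] this[of "Some _"]
  show "const_coeff p = const_coeff q" and x: "x_coeff p j = x_coeff q j" for j
    by (simp_all add: left_coeff_def)
  show "xstar_coeff p j = xstar_coeff q j" for j by (simp add: star x)
qed

lemma pencil_multiple_index:
  assumes D: "D \<in> carrier_mat \<epsilon> \<delta>" and Lt: "Lt \<in> carrier_pencil \<delta> \<epsilon>" and ab: "a < \<epsilon>" "b < \<epsilon>"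
  shows "left_coeff (pencil_add (pencil_lmult D Lt) (pencil_rmult (pencil_adjoint Lt) (mat_adjoint D))) w $$ (a, b) =
    (\<Sum>e<\<delta>. D $$ (a, e) * left_coeff Lt w $$ (e, b)) + (\<Sum>e<\<delta>. cnj (D $$ (b, e) * right_coeff Lt w $$ (e, a)))"
proof -
  note l = left_coeff_carrier[OF Lt, of w] and r = right_coeff_carrier[OF Lt, of w]
  have "left_coeff (pencil_add (pencil_lmult D Lt) (pencil_rmult (pencil_adjoint Lt) (mat_adjoint D))) w =
      D * left_coeff Lt w + mat_adjoint (right_coeff Lt w) * mat_adjoint D"
    by (simp add: left_coeff_def right_coeff_def pencil_coeff_simps split: option.split)
  also have "\<dots> $$ (a, b) = (D * left_coeff Lt w) $$ (a, b) + (mat_adjoint (right_coeff Lt w) * mat_adjoint D) $$ (a, b)"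
    using l r D ab by (intro index_add_mat) auto
  also have "(D * left_coeff Lt w) $$ (a, b) = (\<Sum>e<\<delta>. D $$ (a, e) * left_coeff Lt w $$ (e, b))"
    by (rule mult_mat_index_sum[OF D l ab])
  also have "(mat_adjoint (right_coeff Lt w) * mat_adjoint D) $$ (a, b) =
      (\<Sum>e<\<delta>. cnj (D $$ (b, e) * right_coeff Lt w $$ (e, a)))"
    unfolding mult_mat_index_sum[OF mat_adjoint_carrier[OF r] mat_adjoint_carrier[OF D] ab]
    using r D ab by (intro sum.cong) (auto simp: mult.commute)
  finally show ?thesis .
qed

text \<open>The inner sums over \<open>Z\<close> are the entries of the multiplier D that the real
  coefficients \<open>c\<close> encode.\<close>

lemma mult_coord_sum:
  assumes "a < \<epsilon>" "b < \<epsilon>"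
  shows "(\<Sum>j\<in>{..<\<epsilon>} \<times> {..<\<delta>} \<times> Z. c j *\<^sub>R mult_coord Lt j (w, a, b)) =
    (\<Sum>e<\<delta>. (\<Sum>z\<in>Z. c (a, e, z) *\<^sub>R z) * left_coeff Lt w $$ (e, b)) +
    (\<Sum>e<\<delta>. cnj ((\<Sum>z\<in>Z. c (b, e, z) *\<^sub>R z) * right_coeff Lt w $$ (e, a)))"
proof -
  have "(\<Sum>j\<in>{..<\<epsilon>} \<times> {..<\<delta>} \<times> Z. c j *\<^sub>R mult_coord Lt j (w, a, b)) =
    (\<Sum>a0<\<epsilon>. \<Sum>e<\<delta>. \<Sum>z\<in>Z. c (a0, e, z) *\<^sub>R mult_coord Lt (a0, e, z) (w, a, b))"
    by (simp only: sum.cartesian_product')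
  also have "\<dots> = (\<Sum>a0<\<epsilon>. (if a = a0 then \<Sum>e<\<delta>. \<Sum>z\<in>Z. c (a0, e, z) *\<^sub>R (z * left_coeff Lt w $$ (e, b)) else 0)
     + (if b = a0 then \<Sum>e<\<delta>. \<Sum>z\<in>Z. c (a0, e, z) *\<^sub>R cnj (z * right_coeff Lt w $$ (e, a)) else 0))"
    by (intro sum.cong refl) (simp add: mult_coord_def scaleR_add_right sum.distrib)
  also have "\<dots> = (\<Sum>e<\<delta>. \<Sum>z\<in>Z. c (a, e, z) *\<^sub>R (z * left_coeff Lt w $$ (e, b)))
     + (\<Sum>e<\<delta>. \<Sum>z\<in>Z. c (b, e, z) *\<^sub>R cnj (z * right_coeff Lt w $$ (e, a)))"
    using assms by (simp add: sum.distrib sum.delta)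
  also have "\<dots> = (\<Sum>e<\<delta>. (\<Sum>z\<in>Z. c (a, e, z) *\<^sub>R z) * left_coeff Lt w $$ (e, b)) +
    (\<Sum>e<\<delta>. cnj ((\<Sum>z\<in>Z. c (b, e, z) *\<^sub>R z) * right_coeff Lt w $$ (e, a)))"
    by (simp only: sum_distrib_right cnj_sum complex_cnj_mult complex_cnj_scaleR mult_scaleR_left)
  finally show ?thesis .
qed

text \<open>Turns a coincidence of coordinates into a certificate. Each column \<open>k\<close> of
  the factor yields one matrix \<open>C k\<close> from its rows below \<open>d\<close>, and the rows
  at \<open>d\<close> together yield \<open>P0\<close>. The second conclusion ensures that a nonzero
  factor gives a nonzero solution.\<close>

lemma gram_certificate:
  fixes A :: "'g \<Rightarrow> complex mat" and G :: "(nat \<times> nat) \<times> (nat \<times> nat) \<Rightarrow> complex"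
  assumes A: "\<forall>j. A j \<in> carrier_mat d d" and Lt: "Lt \<in> carrier_pencil \<delta> \<epsilon>"
  defines "S \<equiv> {..d} \<times> {..<\<epsilon>}"
  assumes coord: "\<And>w a b. a < \<epsilon> \<Longrightarrow> b < \<epsilon> \<Longrightarrow> cert_coord d A (gram S G) (w, a, b) =
      (\<Sum>j\<in>{..<\<epsilon>} \<times> {..<\<delta>} \<times> {1, \<i>}. c j *\<^sub>R mult_coord Lt j (w, a, b))"
  obtains D P0 Cs where "is_certificate d \<delta> \<epsilon> (hermitian_monic_pencil d A) Lt D P0 Cs"
    "is_zero_solution d \<epsilon> P0 Cs \<Longrightarrow> \<forall>p\<in>S. \<forall>k\<in>S. G (p, k) = 0"
proof -
  let ?L = "hermitian_monic_pencil d A"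
  note L = hermitian_monic_pencil_carrier[OF A]
  have "finite S" by (simp add: S_def)
  then obtain ks where ks: "set ks = S" "distinct ks" using finite_distinct_list by blast
  define D where "D = mat \<epsilon> \<delta> (\<lambda>(a, e). \<Sum>z\<in>{1, \<i>}. c (a, e, z) *\<^sub>R z)"
  define P0 where "P0 = mat \<epsilon> \<epsilon> (\<lambda>(a, b). \<Sum>k\<in>S. G ((d, a), k) * cnj (G ((d, b), k)))"
  \<comment> \<open>The conjugate is needed because \<open>gram\<close> conjugates its second
    factor, whereas the product of the adjoint of \<open>C k\<close> with \<open>C k\<close>
    conjugates the first.\<close>
  define C where "C k = mat d \<epsilon> (\<lambda>(\<alpha>, a). cnj (G ((\<alpha>, a), k)))" for k
  define Cs where "Cs = map C ks"
  define q where "q = foldr (\<lambda>C. pencil_add (pencil_lmult (mat_adjoint C) (pencil_rmult ?L C))) Cs (const_pencil \<epsilon> \<epsilon> P0)"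
  have D: "D \<in> carrier_mat \<epsilon> \<delta>" and P0: "P0 \<in> carrier_mat \<epsilon> \<epsilon>" and C: "C k \<in> carrier_mat d \<epsilon>" for k
    by (simp_all add: D_def P0_def C_def)
  have Cs: "set Cs \<subseteq> carrier_mat d \<epsilon>" using C by (auto simp: Cs_def)
  have Pherm: "mat_adjoint P0 = P0"
    by (rule eq_matI) (auto simp: P0_def mult.commute)
  have psd: "psd \<epsilon> P0"
    unfolding psd_def
  proof (intro conjI ballI P0 Pherm)
    fix v :: "complex vec" assume v: "v \<in> carrier_vec \<epsilon>"
    have "(P0 *\<^sub>v v) \<bullet>c v = qform {..<\<epsilon>} (\<lambda>a b. \<Sum>k\<in>S. G ((d, a), k) * cnj (G ((d, b), k))) (\<lambda>i. v $ i)"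
      unfolding cscalar_prod_qform[OF P0 v] by (rule qform_cong) (auto simp: P0_def)
    also have "\<dots> = (\<Sum>k\<in>S. qform {..<\<epsilon>} (\<lambda>a b. G ((d, a), k) * cnj (G ((d, b), k))) (\<lambda>i. v $ i))"
      unfolding qform_def sum_distrib_left sum_distrib_right
      by (simp only: sum.swap[of _ S])
    also have "Re \<dots> \<ge> 0" unfolding qform_rank_one by (auto intro!: sum_nonneg)
    finally show "0 \<le> Re ((P0 *\<^sub>v v) \<bullet>c v)" .
  qed
  have sum_Cs: "(\<Sum>C\<leftarrow>Cs. f C) = (\<Sum>k\<in>S. f (C k))" for f :: "complex mat \<Rightarrow> complex"
    unfolding Cs_def using ks by (simp add: sum_list_distinct_conv_sum_set o_def)
  have q_coord: "left_coeff q w $$ (a, b) = cert_coord d A (gram S G) (w, a, b)" if ab: "a < \<epsilon>" "b < \<epsilon>" for w a b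
  proof (cases w)
    case None
    have "(mat_adjoint (C k) * (1\<^sub>m d * C k)) $$ (a, b) = (\<Sum>\<alpha><d. G ((\<alpha>, a), k) * cnj (G ((\<alpha>, b), k)))" for k
    proof -
      have "(mat_adjoint (C k) * (1\<^sub>m d * C k)) $$ (a, b) = (mat_adjoint (C k) * C k) $$ (a, b)"
        using C[of k] by simp
      also have "\<dots> = (\<Sum>\<alpha><d. mat_adjoint (C k) $$ (a, \<alpha>) * C k $$ (\<alpha>, b))"
        by (rule mult_mat_index_sum[OF mat_adjoint_carrier[OF C] C ab])
      finally show ?thesis using ab by (simp add: C_def)
    qed
    then have "left_coeff q w $$ (a, b) = (\<Sum>k\<in>S. G ((d, a), k) * cnj (G ((d, b), k))) +
        (\<Sum>k\<in>S. \<Sum>\<alpha><d. G ((\<alpha>, a), k) * cnj (G ((\<alpha>, b), k)))"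
      using certificate_sum_coeff(1)[OF L P0 Cs ab] ab None
      by (simp add: left_coeff_def q_def sum_Cs hermitian_monic_pencil_def P0_def)
    also have "\<dots> = (\<Sum>\<alpha>\<le>d. gram S G (\<alpha>, a) (\<alpha>, b))"
      unfolding gram_def by (subst sum.swap) (simp add: lessThan_Suc_atMost[symmetric])
    finally show ?thesis using None by (simp add: cert_coord_def)
  next
    case (Some j)
    have Aj: "- A j \<in> carrier_mat d d" using A by simp
    have "(mat_adjoint (C k) * (- A j * C k)) $$ (a, b) =
      - (\<Sum>\<alpha><d. \<Sum>\<beta><d. A j $$ (\<alpha>, \<beta>) * (G ((\<alpha>, a), k) * cnj (G ((\<beta>, b), k))))" for k
    proof -
      have "(mat_adjoint (C k) * (- A j * C k)) $$ (a, b) = (\<Sum>\<alpha><d. mat_adjoint (C k) $$ (a, \<alpha>) * (- A j * C k) $$ (\<alpha>, b))"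
        by (rule mult_mat_index_sum[OF mat_adjoint_carrier[OF C] mult_carrier_mat[OF Aj C] ab])
      also have "\<dots> = (\<Sum>\<alpha><d. G ((\<alpha>, a), k) * (\<Sum>\<beta><d. - A j $$ (\<alpha>, \<beta>) * cnj (G ((\<beta>, b), k))))"
      proof (intro sum.cong refl)
        fix \<alpha> assume "\<alpha> \<in> {..<d}"
        then have \<alpha>: "\<alpha> < d" by simp
        have "dim_row (A j) = d" "dim_col (A j) = d" using A by auto
        with \<alpha> ab show "mat_adjoint (C k) $$ (a, \<alpha>) * (- A j * C k) $$ (\<alpha>, b) =
          G ((\<alpha>, a), k) * (\<Sum>\<beta><d. - A j $$ (\<alpha>, \<beta>) * cnj (G ((\<beta>, b), k)))"
          unfolding mult_mat_index_sum[OF Aj C \<alpha> ab(2)] by (simp add: C_def)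
      qed
      also have "\<dots> = - (\<Sum>\<alpha><d. \<Sum>\<beta><d. A j $$ (\<alpha>, \<beta>) * (G ((\<alpha>, a), k) * cnj (G ((\<beta>, b), k))))"
        by (simp add: sum_distrib_left sum_negf mult_ac)
      finally show ?thesis .
    qed
    then have "left_coeff q w $$ (a, b) =
        - (\<Sum>k\<in>S. \<Sum>\<alpha><d. \<Sum>\<beta><d. A j $$ (\<alpha>, \<beta>) * (G ((\<alpha>, a), k) * cnj (G ((\<beta>, b), k))))"
      using certificate_sum_coeff(2)[OF L P0 Cs ab] ab Some
      by (simp add: left_coeff_def q_def sum_Cs hermitian_monic_pencil_def sum_negf)
    also have "\<dots> = - (\<Sum>\<alpha><d. \<Sum>\<beta><d. A j $$ (\<alpha>, \<beta>) * gram S G (\<alpha>, a) (\<beta>, b))"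
      unfolding gram_def sum_distrib_left by (simp only: sum.swap[of _ _ S])
    finally show ?thesis using Some by (simp add: cert_coord_def)
  qed
  define p where "p = pencil_add (pencil_lmult D Lt) (pencil_rmult (pencil_adjoint Lt) (mat_adjoint D))"
  have "p = q"
  proof (rule pencil_eqI)
    show "p \<in> carrier_pencil \<epsilon> \<epsilon>" unfolding p_def using D Lt by (auto intro!: pencil_carrier_intros)
    show "q \<in> carrier_pencil \<epsilon> \<epsilon>" unfolding q_def by (rule certificate_sum_carrier[OF L P0 Cs])
    show "left_coeff p w $$ (a, b) = left_coeff q w $$ (a, b)" if ab: "a < \<epsilon>" "b < \<epsilon>" for w a b
      unfolding q_coord[OF ab] coord[OF ab] mult_coord_sum[OF ab] p_def pencil_multiple_index[OF D Lt ab]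
      using ab by (simp add: D_def)
    show "xstar_coeff q j = mat_adjoint (x_coeff q j)" for j
      unfolding q_def by (rule certificate_sum_adjoint[OF L hermitian_monic_pencil_adjoint P0 Pherm Cs])
    show "xstar_coeff p j = mat_adjoint (x_coeff p j)" for j
    proof -
      note cs = carrier_pencilD(1)[OF Lt] carrier_pencilD(2,3)[OF Lt, of j]
      have 1: "D * x_coeff Lt j \<in> carrier_mat \<epsilon> \<epsilon>" "mat_adjoint (xstar_coeff Lt j) * mat_adjoint D \<in> carrier_mat \<epsilon> \<epsilon>"
        "D * xstar_coeff Lt j \<in> carrier_mat \<epsilon> \<epsilon>" "mat_adjoint (x_coeff Lt j) * mat_adjoint D \<in> carrier_mat \<epsilon> \<epsilon>"
        using cs D by (auto intro!: mult_carrier_mat[of _ _ \<delta>])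
      show ?thesis
        unfolding p_def pencil_coeff_simps mat_adjoint_add[OF 1(1,2)] mat_adjoint_mult[OF D cs(2)]
          mat_adjoint_mult[OF mat_adjoint_carrier[OF cs(3)] mat_adjoint_carrier[OF D]] mat_adjoint_adjoint
        by (rule comm_add_mat[OF 1(3,4)])
    qed
  qed
  then have "is_certificate d \<delta> \<epsilon> ?L Lt D P0 Cs"
    unfolding is_certificate_def p_def q_def using D psd Cs by simp
  moreover have "\<forall>p\<in>S. \<forall>k\<in>S. G (p, k) = 0" if zero: "is_zero_solution d \<epsilon> P0 Cs"
  proof (intro ballI)
    fix p k assume p: "p \<in> S" and k: "k \<in> S"
    obtain \<alpha> a where pa: "p = (\<alpha>, a)" "\<alpha> \<le> d" "a < \<epsilon>" using p by (auto simp: S_def)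
    show "G (p, k) = 0"
    proof (cases "\<alpha> = d")
      case True
      \<comment> \<open>Diagonal entries of \<open>P0\<close> are sums of squared moduli over the
        columns, so \<open>P0 = 0\<close> kills row \<open>d\<close> of the factor.\<close>
      have "0 = P0 $$ (a, a)" using zero pa by (simp add: is_zero_solution_def)
      also have "\<dots> = (\<Sum>k\<in>S. of_real ((cmod (G (p, k)))\<^sup>2))"
        unfolding complex_norm_square using pa True by (simp add: P0_def)
      finally have "(\<Sum>k\<in>S. of_real ((cmod (G (p, k)))\<^sup>2)) = (0 :: complex)" ..
      then have "(\<Sum>k\<in>S. (cmod (G (p, k)))\<^sup>2) = 0"
        by (simp only: of_real_sum[symmetric] of_real_eq_0_iff)
      then show ?thesis using \<open>finite S\<close> k by (simp add: sum_nonneg_eq_0_iff)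
    next
      case False
      then have "\<alpha> < d" using pa by simp
      moreover have "C k = 0\<^sub>m d \<epsilon>" using zero k ks by (auto simp: is_zero_solution_def Cs_def)
      then have "C k $$ (\<alpha>, a) = 0\<^sub>m d \<epsilon> $$ (\<alpha>, a)" by simp
      ultimately show ?thesis using pa by (simp add: C_def)
    qed
  qed
  ultimately show thesis using that by blast
qed

lemma qform_gram: "qform S (gram T G) v = of_real (\<Sum>k\<in>T. (cmod (\<Sum>i\<in>S. cnj (v i) * G (i, k)))\<^sup>2)"
proof -
  have "qform S (gram T G) v = (\<Sum>k\<in>T. qform S (\<lambda>p q. G (p, k) * cnj (G (q, k))) v)"
    unfolding qform_def gram_def sum_distrib_left sum_distrib_right
    by (simp only: sum.swap[of _ T])
  then show ?thesis by (simp only: qform_rank_one of_real_sum)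
qed

lemma cert_coord_combine:
  "cert_coord d A (\<lambda>p q. s *\<^sub>R Z p q + t *\<^sub>R Z' p q) i = s *\<^sub>R cert_coord d A Z i + t *\<^sub>R cert_coord d A Z' i"
  by (simp add: cert_coord_def sum.distrib scaleR_sum_right distrib_left split: prod.split option.split)

lemma continuous_on_cert_coord: "continuous_on K (\<lambda>G. cert_coord d A (gram S G))"
proof (rule continuous_on_coordinatewise_then_product)
  fix i :: "'a option \<times> nat \<times> nat"
  obtain w a b where i: "i = (w, a, b)" by (metis prod_cases3)
  have g: "continuous_on K (\<lambda>G. gram S G p q)" for p q
    unfolding gram_def
    by (intro continuous_on_sum continuous_on_mult continuous_on_cnj continuous_on_coordinate)
  show "continuous_on K (\<lambda>G. cert_coord d A (gram S G) i)"
  proof (cases w)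
    case None
    show ?thesis unfolding i cert_coord_def prod.case None option.case
      by (intro continuous_on_sum g)
  next
    case (Some j)
    show ?thesis unfolding i cert_coord_def prod.case Some option.case
      by (intro continuous_on_minus continuous_on_sum continuous_on_mult continuous_on_const g)
  qed
qed

subsection \<open>The separating functional\<close>

text \<open>The sphere of factors is not convex, but its Gram matrices are: a convex combination is
  positive semidefinite and hence has a factor again. The squared norm of a factor is the trace of
  its Gram matrix, and the trace is linear, so the normalisation survives.\<close>

lemma convex_gram:
  assumes S: "finite S" and t: "0 \<le> t" "t \<le> 1"
    and G: "\<And>i. i \<notin> S \<times> S \<Longrightarrow> G i = 0" "(\<Sum>i\<in>S \<times> S. (cmod (G i))\<^sup>2) = 1"
    and H: "\<And>i. i \<notin> S \<times> S \<Longrightarrow> H i = 0" "(\<Sum>i\<in>S \<times> S. (cmod (H i))\<^sup>2) = 1"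
  obtains F where "\<And>i. i \<notin> S \<times> S \<Longrightarrow> F i = 0" "(\<Sum>i\<in>S \<times> S. (cmod (F i))\<^sup>2) = 1"
    "gram S F = (\<lambda>p q. (1 - t) *\<^sub>R gram S G p q + t *\<^sub>R gram S H p q)"
proof -
  define Z where "Z p q = (1 - t) *\<^sub>R gram S G p q + t *\<^sub>R gram S H p q" for p q
  have trace: "(\<Sum>i\<in>S \<times> S. (cmod (F i))\<^sup>2) = Re (\<Sum>p\<in>S. gram S F p p)" for F
  proof -
    have "(\<Sum>p\<in>S. gram S F p p) = of_real (\<Sum>i\<in>S \<times> S. (cmod (F i))\<^sup>2)"
      unfolding gram_def of_real_sum complex_norm_square by (simp add: sum.cartesian_product')
    then show ?thesis by simp
  qed
  have "\<exists>E. \<forall>p\<in>S. \<forall>q\<in>S. Z p q = (\<Sum>k\<in>S. E p k * cnj (E q k))"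
  proof (rule psd_function_factorization[OF S])
    show "Z p q = cnj (Z q p)" for p q
      by (simp add: Z_def gram_def mult.commute)
    show "0 \<le> Re (qform S Z v)" for v
    proof -
      have "qform S Z v = (1 - t) *\<^sub>R qform S (gram S G) v + t *\<^sub>R qform S (gram S H) v"
        by (simp add: qform_def Z_def scaleR_sum_right sum.distrib[symmetric] algebra_simps)
      then show ?thesis using t unfolding qform_gram by (simp add: sum_nonneg)
    qed
  qed
  then obtain E where E: "\<And>p q. p \<in> S \<Longrightarrow> q \<in> S \<Longrightarrow> Z p q = (\<Sum>k\<in>S. E p k * cnj (E q k))" by blast
  \<comment> \<open>Zero outside \<open>S \<times> S\<close>, as the normalised set demands; this
    also makes the two Gram matrices agree at all indices.\<close>
  define F where "F = (\<lambda>(p, k). if p \<in> S \<and> k \<in> S then E p k else 0)"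
  have gF: "gram S F = Z"
  proof (intro ext)
    fix p q
    show "gram S F p q = Z p q"
    proof (cases "p \<in> S \<and> q \<in> S")
      case True
      then show ?thesis by (simp add: E gram_def F_def)
    next
      case False
      then have "gram S F p q = 0" "gram S G p q = 0" "gram S H p q = 0"
        using G(1) H(1) by (auto simp: gram_def F_def)
      then show ?thesis by (simp add: Z_def)
    qed
  qed
  have "(\<Sum>i\<in>S \<times> S. (cmod (F i))\<^sup>2) = Re (\<Sum>p\<in>S. Z p p)" unfolding trace gF ..
  also have "\<dots> = (1 - t) * Re (\<Sum>p\<in>S. gram S G p p) + t * Re (\<Sum>p\<in>S. gram S H p p)"
    by (simp add: Z_def sum.distrib scaleR_sum_right[symmetric] sum_distrib_left)
  also have "\<dots> = 1" unfolding trace[symmetric] G(2) H(2) by simp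
  finally show thesis using gF unfolding Z_def by (intro that[of F]) (auto simp: F_def split: if_splits)
qed

text \<open>The compact convex set is the image of the Gram matrices of trace 1 with columns indexed
  by \<open>S\<close> itself, enough since positive semidefinite matrices have square factors. The
  later arguments need positivity on rank-one Gram matrices only.\<close>

lemma exists_positive_functional:
  fixes A :: "'g::finite \<Rightarrow> complex mat"
  assumes A: "\<forall>j. A j \<in> carrier_mat d d" and Lt: "Lt \<in> carrier_pencil \<delta> \<epsilon>" and "0 < \<epsilon>"
    and only_zero: "\<And>D P0 Cs. is_certificate d \<delta> \<epsilon> (hermitian_monic_pencil d A) Lt D P0 Cs \<Longrightarrow> is_zero_solution d \<epsilon> P0 Cs"
  defines "S \<equiv> {..d} \<times> {..<\<epsilon>}" and "I \<equiv> (UNIV :: 'g option set) \<times> {..<\<epsilon>} \<times> {..<\<epsilon>}"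
  obtains l where
    "\<And>j. j \<in> {..<\<epsilon>} \<times> {..<\<delta>} \<times> {1, \<i>} \<Longrightarrow> (\<Sum>i\<in>I. inner (l i) (mult_coord Lt j i)) = 0"
    "\<And>g. \<exists>p\<in>S. g p \<noteq> 0 \<Longrightarrow> 0 < (\<Sum>i\<in>I. inner (l i) (cert_coord d A (\<lambda>p q. g p * cnj (g q)) i))"
proof -
  let ?J = "{..<\<epsilon>} \<times> {..<\<delta>} \<times> {1, \<i>}"
  have S: "finite S" and I: "finite I" by (simp_all add: S_def I_def)
  define B where "B = {G :: (nat \<times> nat) \<times> (nat \<times> nat) \<Rightarrow> complex.
    (\<forall>i. i \<notin> S \<times> S \<longrightarrow> G i = 0) \<and> (\<Sum>i\<in>S \<times> S. (cmod (G i))\<^sup>2) = 1}"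
  define K where "K = (\<lambda>G. cert_coord d A (gram S G)) ` B"
  have "\<exists>l. (\<forall>j\<in>?J. (\<Sum>i\<in>I. inner (l i) (mult_coord Lt j i)) = 0) \<and> (\<forall>k\<in>K. 0 < (\<Sum>i\<in>I. inner (l i) (k i)))"
  proof (rule compact_convex_separation)
    show "compact K" unfolding K_def B_def
      using S by (intro compact_continuous_image continuous_on_cert_coord compact_sphere_function) simp
    show "(\<lambda>i. (1 - t) *\<^sub>R x i + t *\<^sub>R y i) \<in> K" if xy: "x \<in> K" "y \<in> K" and t: "0 \<le> t" "t \<le> 1" for x y t
    proof -
      obtain G H where G: "G \<in> B" "x = cert_coord d A (gram S G)" and H: "H \<in> B" "y = cert_coord d A (gram S H)"
        using xy by (auto simp: K_def)
      obtain F where F: "\<And>i. i \<notin> S \<times> S \<Longrightarrow> F i = 0" "(\<Sum>i\<in>S \<times> S. (cmod (F i))\<^sup>2) = 1"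
        "gram S F = (\<lambda>p q. (1 - t) *\<^sub>R gram S G p q + t *\<^sub>R gram S H p q)"
        using convex_gram[OF S t, of G H] G(1) H(1) unfolding B_def by blast
      have "(\<lambda>i. (1 - t) *\<^sub>R x i + t *\<^sub>R y i) = cert_coord d A (gram S F)"
        unfolding F(3) G(2) H(2) cert_coord_combine ..
      then show ?thesis using F(1,2) unfolding K_def B_def by blast
    qed
    show "\<exists>i\<in>I. k i \<noteq> (\<Sum>j\<in>?J. c j *\<^sub>R mult_coord Lt j i)" if k: "k \<in> K" for k c
    proof (rule ccontr)
      assume "\<not> ?thesis"
      then have eq: "k (w, a, b) = (\<Sum>j\<in>?J. c j *\<^sub>R mult_coord Lt j (w, a, b))" if "a < \<epsilon>" "b < \<epsilon>" for w a b
        using that by (auto simp: I_def)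
      obtain G where G: "G \<in> B" "k = cert_coord d A (gram S G)" using k by (auto simp: K_def)
      \<comment> \<open>A point of \<open>K\<close> in the span of the \<open>mult_coord\<close>
        would be a certificate; the hypothesis makes it zero, against the normalisation of
        \<open>G\<close>.\<close>
      obtain D P0 Cs where "is_certificate d \<delta> \<epsilon> (hermitian_monic_pencil d A) Lt D P0 Cs"
        "is_zero_solution d \<epsilon> P0 Cs \<Longrightarrow> \<forall>p\<in>S. \<forall>k\<in>S. G (p, k) = 0"
        using gram_certificate[OF A Lt eq[unfolded G(2), unfolded S_def]] unfolding S_def by metis
      then have "\<forall>p\<in>S. \<forall>k\<in>S. G (p, k) = 0" using only_zero by blast
      then have "(\<Sum>i\<in>S \<times> S. (cmod (G i))\<^sup>2) = 0" by (intro sum.neutral) auto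
      with G(1) show False by (simp add: B_def)
    qed
  qed (use I in auto)
  then obtain l where l: "\<And>j. j \<in> ?J \<Longrightarrow> (\<Sum>i\<in>I. inner (l i) (mult_coord Lt j i)) = 0"
    "\<And>k. k \<in> K \<Longrightarrow> 0 < (\<Sum>i\<in>I. inner (l i) (k i))" by blast
  have "0 < (\<Sum>i\<in>I. inner (l i) (cert_coord d A (\<lambda>p q. g p * cnj (g q)) i))" if g: "\<exists>p\<in>S. g p \<noteq> 0" for g
  proof -
    define n where "n = (\<Sum>p\<in>S. (cmod (g p))\<^sup>2)"
    have n: "n > 0" using g S unfolding n_def by (auto intro: sum_pos2)
    have k0: "(0, 0) \<in> S" using \<open>0 < \<epsilon>\<close> by (simp add: S_def)
    \<comment> \<open>A factor with a single nonzero column, whose Gram matrix is the normalised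
      rank-one matrix of \<open>g\<close>; \<open>(0, 0)\<close> is an available column index
      because \<open>0 < \<epsilon>\<close>.\<close>
    define G :: "(nat \<times> nat) \<times> (nat \<times> nat) \<Rightarrow> complex"
      where "G = (\<lambda>(p, k). if p \<in> S \<and> k = (0, 0) then g p / of_real (sqrt n) else 0)"
    have "(\<Sum>i\<in>S \<times> S. (cmod (G i))\<^sup>2) = (\<Sum>p\<in>S. \<Sum>k\<in>S. if k = (0, 0) then (cmod (g p))\<^sup>2 / n else 0)"
      unfolding sum.cartesian_product' using n
      by (intro sum.cong refl) (simp add: G_def norm_divide power_divide)
    also have "\<dots> = 1" using S k0 n by (simp add: n_def flip: sum_divide_distrib)
    finally have GB: "G \<in> B" using k0 by (auto simp: B_def G_def)
    \<comment> \<open>The summand with coefficient 0 brings a mere scaling into the form required by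
      \<open>cert_coord_combine\<close>.\<close>
    have gr: "gram S G p q = (1 / n) *\<^sub>R (g p * cnj (g q)) + 0 *\<^sub>R (g p * cnj (g q))" if "p \<in> S" "q \<in> S" for p q
    proof -
      have "gram S G p q = (\<Sum>k\<in>S. if k = (0, 0) then g p / of_real (sqrt n) * cnj (g q / of_real (sqrt n)) else 0)"
        unfolding gram_def using that by (intro sum.cong) (auto simp: G_def)
      also have "\<dots> = g p / of_real (sqrt n) * cnj (g q / of_real (sqrt n))" using S k0 by simp
      also have "\<dots> = g p * cnj (g q) / of_real (sqrt n * sqrt n)"
        by (simp only: complex_cnj_divide complex_cnj_complex_of_real of_real_mult times_divide_times_eq)
      also have "sqrt n * sqrt n = n" using n by simp
      finally show ?thesis using n by (simp add: scaleR_conv_of_real divide_inverse mult.commute)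
    qed
    have "cert_coord d A (gram S G) i = (1 / n) *\<^sub>R cert_coord d A (\<lambda>p q. g p * cnj (g q)) i" if iI: "i \<in> I" for i
    proof -
      obtain w a b where i: "i = (w, a, b)" "a < \<epsilon>" "b < \<epsilon>" using iI by (auto simp: I_def)
      have inS: "(\<alpha>, a) \<in> S" "(\<alpha>, b) \<in> S" if "\<alpha> \<le> d" for \<alpha>
        using that i(2,3) by (simp_all add: S_def)
      have "cert_coord d A (gram S G) i =
          cert_coord d A (\<lambda>p q. (1 / n) *\<^sub>R (g p * cnj (g q)) + 0 *\<^sub>R (g p * cnj (g q))) i"
        unfolding i(1) cert_coord_def prod.case
        by (cases w) (auto simp only: option.case gr inS lessThan_iff atMost_iff less_imp_le
            intro!: sum.cong arg_cong[of _ _ uminus] arg_cong2[of _ _ _ _ "(*)"])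
      then show ?thesis unfolding cert_coord_combine by simp
    qed
    then have "0 < (\<Sum>i\<in>I. inner (l i) ((1 / n) *\<^sub>R cert_coord d A (\<lambda>p q. g p * cnj (g q)) i))"
      using l(2)[of "cert_coord d A (gram S G)"] GB by (simp add: K_def)
    also have "\<dots> = (1 / n) * (\<Sum>i\<in>I. inner (l i) (cert_coord d A (\<lambda>p q. g p * cnj (g q)) i))"
      by (simp only: inner_scaleR_right sum_distrib_left)
    finally show ?thesis using n by (simp add: zero_less_divide_iff)
  qed
  with l(1) show thesis by (rule that)
qed

section \<open>The separating functional in terms of matrices\<close>

lemma sum_rotate: "(\<Sum>a\<in>A. \<Sum>b\<in>B. \<Sum>c\<in>C. f a b c) = (\<Sum>b\<in>B. \<Sum>c\<in>C. \<Sum>a\<in>A. f a b c)"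
  by (rule trans[OF sum.swap]) (rule sum.cong[OF refl], rule sum.swap)

lemma sum_UNIV_option:
  fixes f :: "'a::finite option \<Rightarrow> 'b::comm_monoid_add"
  shows "(\<Sum>w\<in>UNIV. f w) = f None + (\<Sum>j\<in>UNIV. f (Some j))"
  unfolding UNIV_option_conv by (simp add: sum.reindex)

lemma inner_complex_Re: "inner x y = Re (cnj x * y)" "inner x (cnj y) = Re (x * y)"
  by (simp_all add: inner_complex_def)

lemma inner_if: "inner x (if P then y else 0) = (if P then inner x y else 0)"
  by simp

text \<open>The pairing is the real part of \<open>z\<close> times a complex number independent of
  \<open>z\<close>. If it vanishes for \<open>z = 1\<close> and \<open>z = \<i>\<close>, that number
  is 0, so the real orthogonality relations become complex ones.\<close>

lemma mult_coord_pairing: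
  fixes l :: "'g::finite option \<times> nat \<times> nat \<Rightarrow> complex"
  assumes "a0 < \<epsilon>"
  shows "(\<Sum>i\<in>UNIV \<times> {..<\<epsilon>} \<times> {..<\<epsilon>}. inner (l i) (mult_coord Lt (a0, e, z) i)) =
    Re (z * (\<Sum>w\<in>UNIV. \<Sum>b<\<epsilon>. left_coeff Lt w $$ (e, b) * cnj (l (w, a0, b)) + right_coeff Lt w $$ (e, b) * l (w, b, a0)))"
proof -
  have "(\<Sum>a<\<epsilon>. \<Sum>b<\<epsilon>. inner (l (w, a, b)) (mult_coord Lt (a0, e, z) (w, a, b))) =
    Re (z * (\<Sum>b<\<epsilon>. left_coeff Lt w $$ (e, b) * cnj (l (w, a0, b)) + right_coeff Lt w $$ (e, b) * l (w, b, a0)))" for w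
  proof -
    have "(\<Sum>a<\<epsilon>. \<Sum>b<\<epsilon>. inner (l (w, a, b)) (mult_coord Lt (a0, e, z) (w, a, b))) =
      (\<Sum>a<\<epsilon>. (if a = a0 then \<Sum>b<\<epsilon>. inner (l (w, a, b)) (z * left_coeff Lt w $$ (e, b)) else 0)
        + (\<Sum>b<\<epsilon>. if b = a0 then inner (l (w, a, b)) (cnj (z * right_coeff Lt w $$ (e, a))) else 0))"
      by (intro sum.cong refl) (simp only: mult_coord_def prod.case inner_add_right sum.distrib inner_if, simp)
    also have "\<dots> = (\<Sum>b<\<epsilon>. inner (l (w, a0, b)) (z * left_coeff Lt w $$ (e, b)))
        + (\<Sum>a<\<epsilon>. inner (l (w, a, a0)) (cnj (z * right_coeff Lt w $$ (e, a))))"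
      using assms by (simp add: sum.distrib)
    also have "\<dots> = (\<Sum>b<\<epsilon>. Re (z * (left_coeff Lt w $$ (e, b) * cnj (l (w, a0, b)) + right_coeff Lt w $$ (e, b) * l (w, b, a0))))"
      unfolding inner_complex_Re(2) unfolding inner_complex_Re(1) sum.distrib[symmetric] plus_complex.sel[symmetric]
      by (intro sum.cong refl arg_cong[of _ _ Re]) (simp only: distrib_left mult_ac)
    finally show ?thesis by (simp only: sum_distrib_left Re_sum)
  qed
  then show ?thesis by (simp only: sum.cartesian_product' sum_distrib_left Re_sum)
qed

text \<open>Rewrites the real functional as a trace pairing with matrices, hence the transposed
  index order \<open>(b, a)\<close>. The factor 2 in the positivity condition accounts for the
  coefficients at the adjoint variables, which the coordinates omit.\<close>

lemma separating_data:
  fixes A :: "'g::finite \<Rightarrow> complex mat"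
  assumes A: "\<forall>j. A j \<in> carrier_mat d d" and Lt: "Lt \<in> carrier_pencil \<delta> \<epsilon>" and "0 < \<epsilon>"
    and only_zero: "\<And>D P0 Cs. is_certificate d \<delta> \<epsilon> (hermitian_monic_pencil d A) Lt D P0 Cs \<Longrightarrow> is_zero_solution d \<epsilon> P0 Cs"
  obtains \<Gamma>0 \<Gamma> where "\<Gamma>0 \<in> carrier_mat \<epsilon> \<epsilon>" "mat_adjoint \<Gamma>0 = \<Gamma>0" "\<And>j. \<Gamma> j \<in> carrier_mat \<epsilon> \<epsilon>"
    "\<And>e a. e < \<delta> \<Longrightarrow> a < \<epsilon> \<Longrightarrow> (\<Sum>b<\<epsilon>. const_coeff Lt $$ (e, b) * \<Gamma>0 $$ (b, a)) +
      (\<Sum>j\<in>UNIV. \<Sum>b<\<epsilon>. x_coeff Lt j $$ (e, b) * \<Gamma> j $$ (b, a) + xstar_coeff Lt j $$ (e, b) * cnj (\<Gamma> j $$ (a, b))) = 0"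
    "\<And>g. \<exists>p\<in>{..d} \<times> {..<\<epsilon>}. g p \<noteq> 0 \<Longrightarrow>
      0 < Re (\<Sum>a<\<epsilon>. \<Sum>b<\<epsilon>. \<Gamma>0 $$ (b, a) * (\<Sum>\<alpha>\<le>d. g (\<alpha>, a) * cnj (g (\<alpha>, b))))
        - 2 * Re (\<Sum>j\<in>UNIV. \<Sum>a<\<epsilon>. \<Sum>b<\<epsilon>. \<Gamma> j $$ (b, a) *
            (\<Sum>\<alpha><d. \<Sum>\<beta><d. A j $$ (\<alpha>, \<beta>) * (g (\<alpha>, a) * cnj (g (\<beta>, b)))))"
proof -
  let ?I = "(UNIV :: 'g option set) \<times> {..<\<epsilon>} \<times> {..<\<epsilon>}"
  obtain l where l0: "\<And>j. j \<in> {..<\<epsilon>} \<times> {..<\<delta>} \<times> {1, \<i>} \<Longrightarrow> (\<Sum>i\<in>?I. inner (l i) (mult_coord Lt j i)) = 0"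
    and lpos: "\<And>g. \<exists>p\<in>{..d} \<times> {..<\<epsilon>}. g p \<noteq> 0 \<Longrightarrow>
      0 < (\<Sum>i\<in>?I. inner (l i) (cert_coord d A (\<lambda>p q. g p * cnj (g q)) i))"
    by (rule exists_positive_functional[OF A Lt \<open>0 < \<epsilon>\<close>]) (erule only_zero, blast)
  \<comment> \<open>Constant coefficients on the right-hand side are hermitian, so only the
    hermitian part of \<open>l\<close> at \<open>None\<close> counts. At \<open>Some j\<close> the
    half arises because the pairing is shared between \<open>x_j\<close> and its adjoint.\<close>
  define \<Gamma>0 where "\<Gamma>0 = mat \<epsilon> \<epsilon> (\<lambda>(b, a). (cnj (l (None, a, b)) + l (None, b, a)) / 2)"
  define \<Gamma> where "\<Gamma> j = mat \<epsilon> \<epsilon> (\<lambda>(b, a). cnj (l (Some j, a, b)) / 2)" for j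
  have "\<Gamma>0 \<in> carrier_mat \<epsilon> \<epsilon>" by (simp add: \<Gamma>0_def)
  moreover have "mat_adjoint \<Gamma>0 = \<Gamma>0" by (rule eq_matI) (auto simp: \<Gamma>0_def add.commute)
  moreover have "\<And>j. \<Gamma> j \<in> carrier_mat \<epsilon> \<epsilon>" by (simp add: \<Gamma>_def)
  moreover have "(\<Sum>b<\<epsilon>. const_coeff Lt $$ (e, b) * \<Gamma>0 $$ (b, a)) +
      (\<Sum>j\<in>UNIV. \<Sum>b<\<epsilon>. x_coeff Lt j $$ (e, b) * \<Gamma> j $$ (b, a) + xstar_coeff Lt j $$ (e, b) * cnj (\<Gamma> j $$ (a, b))) = 0"
    (is "?lhs = 0") if ea: "e < \<delta>" "a < \<epsilon>" for e a
  proof -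
    define T where "T = (\<Sum>w\<in>UNIV. \<Sum>b<\<epsilon>. left_coeff Lt w $$ (e, b) * cnj (l (w, a, b)) + right_coeff Lt w $$ (e, b) * l (w, b, a))"
    have "Re (z * T) = 0" if "z \<in> {1, \<i>}" for z
      using l0[of "(a, e, z)"] ea that unfolding T_def mult_coord_pairing[OF ea(2)] by blast
    from this[of 1] this[of \<i>] have T0: "T = 0" by (simp add: complex_eq_iff)
    have T2: "T = 2 * ?lhs"
    proof -
      have "(\<Sum>b<\<epsilon>. const_coeff Lt $$ (e, b) * cnj (l (None, a, b)) + const_coeff Lt $$ (e, b) * l (None, b, a)) =
          2 * (\<Sum>b<\<epsilon>. const_coeff Lt $$ (e, b) * \<Gamma>0 $$ (b, a))"
        unfolding sum_distrib_left using ea by (intro sum.cong refl) (simp add: \<Gamma>0_def distrib_left)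
      moreover have "(\<Sum>b<\<epsilon>. x_coeff Lt j $$ (e, b) * cnj (l (Some j, a, b)) + xstar_coeff Lt j $$ (e, b) * l (Some j, b, a)) =
          2 * (\<Sum>b<\<epsilon>. x_coeff Lt j $$ (e, b) * \<Gamma> j $$ (b, a) + xstar_coeff Lt j $$ (e, b) * cnj (\<Gamma> j $$ (a, b)))" for j
        unfolding sum_distrib_left using ea by (intro sum.cong refl) (simp add: \<Gamma>_def distrib_left)
      ultimately show ?thesis
        unfolding T_def sum_UNIV_option left_coeff_def right_coeff_def option.case
        by (simp only: distrib_left sum_distrib_left[symmetric])
    qed
    have "x = 0" if "2 * x = 0" for x :: complex using that by simp
    then show ?thesis using trans[OF T2[symmetric] T0] .
  qed
  moreover have "0 < Re (\<Sum>a<\<epsilon>. \<Sum>b<\<epsilon>. \<Gamma>0 $$ (b, a) * (\<Sum>\<alpha>\<le>d. g (\<alpha>, a) * cnj (g (\<alpha>, b))))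
        - 2 * Re (\<Sum>j\<in>UNIV. \<Sum>a<\<epsilon>. \<Sum>b<\<epsilon>. \<Gamma> j $$ (b, a) *
            (\<Sum>\<alpha><d. \<Sum>\<beta><d. A j $$ (\<alpha>, \<beta>) * (g (\<alpha>, a) * cnj (g (\<beta>, b)))))"
    if g: "\<exists>p\<in>{..d} \<times> {..<\<epsilon>}. g p \<noteq> 0" for g
  proof -
    define X where "X a b = (\<Sum>\<alpha>\<le>d. g (\<alpha>, a) * cnj (g (\<alpha>, b)))" for a b
    define Y where "Y j a b = (\<Sum>\<alpha><d. \<Sum>\<beta><d. A j $$ (\<alpha>, \<beta>) * (g (\<alpha>, a) * cnj (g (\<beta>, b))))" for j a b
    have e1: "(\<Sum>i\<in>?I. inner (l i) (cert_coord d A (\<lambda>p q. g p * cnj (g q)) i)) =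
      (\<Sum>a<\<epsilon>. \<Sum>b<\<epsilon>. Re (cnj (l (None, a, b)) * X a b)) - (\<Sum>j\<in>UNIV. \<Sum>a<\<epsilon>. \<Sum>b<\<epsilon>. Re (cnj (l (Some j, a, b)) * Y j a b))"
      unfolding sum.cartesian_product' sum_UNIV_option inner_complex_Re(1) cert_coord_def prod.case option.case
        X_def[symmetric] Y_def[symmetric]
      by (simp only: mult_minus_right uminus_complex.sel sum_negf add_uminus_conv_diff)
    have e2: "(\<Sum>j\<in>UNIV. \<Sum>a<\<epsilon>. \<Sum>b<\<epsilon>. Re (cnj (l (Some j, a, b)) * Y j a b)) =
        2 * Re (\<Sum>j\<in>UNIV. \<Sum>a<\<epsilon>. \<Sum>b<\<epsilon>. \<Gamma> j $$ (b, a) * Y j a b)"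
      unfolding Re_sum sum_distrib_left by (intro sum.cong refl) (simp add: \<Gamma>_def)
    have e3: "(\<Sum>a<\<epsilon>. \<Sum>b<\<epsilon>. Re (cnj (l (None, a, b)) * X a b)) = Re (\<Sum>a<\<epsilon>. \<Sum>b<\<epsilon>. \<Gamma>0 $$ (b, a) * X a b)"
    proof -
      \<comment> \<open>Since \<open>X\<close> is hermitian, averaging \<open>l\<close> with its
        adjoint leaves the real pairing unchanged.\<close>
      have Xh: "X b a = cnj (X a b)" for a b by (simp add: X_def mult.commute)
      have "Re (l (None, b, a) * X a b) = Re (cnj (l (None, b, a)) * X b a)" for a b
        unfolding Xh[of b a] by simp
      then have "(\<Sum>a<\<epsilon>. \<Sum>b<\<epsilon>. Re (l (None, b, a) * X a b)) = (\<Sum>a<\<epsilon>. \<Sum>b<\<epsilon>. Re (cnj (l (None, a, b)) * X a b))"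
        by (subst sum.swap) (simp only:)
      moreover have "Re (\<Sum>a<\<epsilon>. \<Sum>b<\<epsilon>. \<Gamma>0 $$ (b, a) * X a b) =
          (\<Sum>a<\<epsilon>. \<Sum>b<\<epsilon>. (Re (cnj (l (None, a, b)) * X a b) + Re (l (None, b, a) * X a b)) / 2)"
        unfolding Re_sum by (intro sum.cong refl) (simp add: \<Gamma>0_def distrib_right field_simps)
      ultimately show ?thesis by (simp add: sum.distrib flip: sum_divide_distrib)
    qed
    show ?thesis using lpos[OF g] unfolding e1 e2 e3 unfolding X_def Y_def .
  qed
  ultimately show thesis by (rule that)
qed

lemma qform_adjoint: "qform S (\<lambda>p q. cnj (M q p)) v = cnj (qform S M v)"
  unfolding qform_def cnj_sum by (subst sum.swap) (simp add: mult_ac)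

lemma qform_identity: "finite S \<Longrightarrow> qform S (\<lambda>p q. if p = q then 1 else 0) v = of_real (\<Sum>p\<in>S. (cmod (v p))\<^sup>2)"
  unfolding qform_def of_real_sum complex_norm_square by (intro sum.cong refl) (simp add: if_distrib if_distribR cong: if_cong)

text \<open>The terms in \<open>x_j\<close> and in its adjoint are conjugate to each other, so the
  value is the squared length minus twice a real part, the shape of the positivity condition in
  \<open>separating_data\<close>.\<close>

lemma hermitian_monic_pencil_form:
  fixes A :: "'g::finite \<Rightarrow> complex mat"
  assumes A: "\<forall>j. A j \<in> carrier_mat d d" and X: "X \<in> mat_tuples n" and v: "v \<in> carrier_vec (d * n)"
  defines "V \<equiv> \<lambda>\<alpha> i. v $ (\<alpha> * n + i)"
  shows "Re ((pencil_eval n (hermitian_monic_pencil d A) X *\<^sub>v v) \<bullet>c v) =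
    (\<Sum>\<alpha><d. \<Sum>i<n. (cmod (V \<alpha> i))\<^sup>2) -
    2 * Re (\<Sum>j\<in>UNIV. \<Sum>\<alpha><d. \<Sum>\<beta><d. A j $$ (\<alpha>, \<beta>) * (\<Sum>k<n. \<Sum>i<n. V \<beta> k * X j $$ (i, k) * cnj (V \<alpha> i)))"
proof -
  let ?L = "hermitian_monic_pencil d A" and ?P = "{..<d} \<times> {..<n}"
  define M where "M = (\<lambda>(\<alpha>, i) (\<beta>, k). \<Sum>j\<in>UNIV. A j $$ (\<alpha>, \<beta>) * X j $$ (i, k))"
  have "(pencil_eval n ?L X *\<^sub>v v) \<bullet>c v = (\<Sum>\<alpha><d. \<Sum>i<n. \<Sum>\<beta><d. \<Sum>k<n.
      cnj (V \<alpha> i) * pencil_eval n ?L X $$ (\<alpha> * n + i, \<beta> * n + k) * V \<beta> k)"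
    unfolding cscalar_prod_qform[OF pencil_eval_carrier[OF hermitian_monic_pencil_carrier[OF A]] v]
      qform_def sum_lessThan_mult V_def ..
  also have "\<dots> = (\<Sum>\<alpha><d. \<Sum>i<n. \<Sum>\<beta><d. \<Sum>k<n.
      cnj (V \<alpha> i) * ((if (\<alpha>, i) = (\<beta>, k) then 1 else 0) - M (\<alpha>, i) (\<beta>, k) - cnj (M (\<beta>, k) (\<alpha>, i))) * V \<beta> k)"
    by (intro sum.cong refl)
      (simp only: lessThan_iff hermitian_monic_pencil_eval_index[OF A X] M_def prod.case prod.inject cnj_sum complex_cnj_mult)
  also have "\<dots> = qform ?P (\<lambda>p q. (if p = q then 1 else 0) - M p q - cnj (M q p)) (\<lambda>(\<alpha>, i). V \<alpha> i)"
    unfolding qform_def by (simp only: sum.cartesian_product' prod.case)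
  also have "\<dots> = of_real (\<Sum>p\<in>?P. (cmod (case p of (\<alpha>, i) \<Rightarrow> V \<alpha> i))\<^sup>2) -
      qform ?P M (\<lambda>(\<alpha>, i). V \<alpha> i) - cnj (qform ?P M (\<lambda>(\<alpha>, i). V \<alpha> i))"
    by (simp only: qform_diff qform_adjoint qform_identity finite_cartesian_product finite_lessThan)
  also have "Re \<dots> = (\<Sum>\<alpha><d. \<Sum>i<n. (cmod (V \<alpha> i))\<^sup>2) - 2 * Re (qform ?P M (\<lambda>(\<alpha>, i). V \<alpha> i))"
    by (simp add: sum.cartesian_product')
  also have "qform ?P M (\<lambda>(\<alpha>, i). V \<alpha> i) =
      (\<Sum>\<alpha><d. \<Sum>i<n. \<Sum>\<beta><d. \<Sum>k<n. \<Sum>j\<in>UNIV. A j $$ (\<alpha>, \<beta>) * (V \<beta> k * X j $$ (i, k) * cnj (V \<alpha> i)))"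
    unfolding qform_def sum.cartesian_product' M_def prod.case sum_distrib_left sum_distrib_right
    by (simp only: mult_ac)
  also have "\<dots> = (\<Sum>j\<in>UNIV. \<Sum>\<alpha><d. \<Sum>i<n. \<Sum>\<beta><d. \<Sum>k<n. A j $$ (\<alpha>, \<beta>) * (V \<beta> k * X j $$ (i, k) * cnj (V \<alpha> i)))"
    by (simp only: sum.swap[of _ UNIV])
  also have "\<dots> = (\<Sum>j\<in>UNIV. \<Sum>\<alpha><d. \<Sum>\<beta><d. A j $$ (\<alpha>, \<beta>) * (\<Sum>k<n. \<Sum>i<n. V \<beta> k * X j $$ (i, k) * cnj (V \<alpha> i)))"
    unfolding sum_distrib_left
  proof (rule sum.cong[OF refl], rule sum.cong[OF refl])
    fix j \<alpha>
    show "(\<Sum>i<n. \<Sum>\<beta><d. \<Sum>k<n. A j $$ (\<alpha>, \<beta>) * (V \<beta> k * X j $$ (i, k) * cnj (V \<alpha> i))) =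
      (\<Sum>\<beta><d. \<Sum>k<n. \<Sum>i<n. A j $$ (\<alpha>, \<beta>) * (V \<beta> k * X j $$ (i, k) * cnj (V \<alpha> i)))"
      by (rule sum_rotate)
  qed
  finally show ?thesis .
qed

subsection \<open>The rank deficient point\<close>

lemma sandwich_index:
  fixes M N :: "complex mat"
  assumes M: "M \<in> carrier_mat r c" and N: "N \<in> carrier_mat c c" and "i < r" "j < r"
  shows "(M * N * mat_adjoint M) $$ (i, j) = (\<Sum>a<c. \<Sum>b<c. M $$ (i, b) * N $$ (b, a) * cnj (M $$ (j, a)))"
proof -
  have "(M * N * mat_adjoint M) $$ (i, j) = (\<Sum>a<c. (M * N) $$ (i, a) * mat_adjoint M $$ (a, j))"
    using assms by (intro mult_mat_index_sum[OF mult_carrier_mat[OF M N] mat_adjoint_carrier[OF M]])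
  also have "\<dots> = (\<Sum>a<c. (\<Sum>b<c. M $$ (i, b) * N $$ (b, a)) * cnj (M $$ (j, a)))"
  proof (intro sum.cong refl)
    fix a assume "a \<in> {..<c}"
    then show "(M * N) $$ (i, a) * mat_adjoint M $$ (a, j) = (\<Sum>b<c. M $$ (i, b) * N $$ (b, a)) * cnj (M $$ (j, a))"
      using assms mult_mat_index_sum[OF M N \<open>i < r\<close>, of a] by simp
  qed
  finally show ?thesis by (simp only: sum_distrib_right)
qed

text \<open>Strict positivity makes the factor invertible, since a nonzero kernel vector of
  \<open>mat_adjoint G\<close> would give the form the value 0.\<close>

lemma posdef_factorization:
  fixes \<Gamma> :: "complex mat"
  assumes \<Gamma>: "\<Gamma> \<in> carrier_mat n n" "mat_adjoint \<Gamma> = \<Gamma>"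
    and pos: "\<And>v. v \<in> carrier_vec n \<Longrightarrow> v \<noteq> 0\<^sub>v n \<Longrightarrow> 0 < Re ((\<Gamma> *\<^sub>v v) \<bullet>c v)"
  obtains G W where "G \<in> carrier_mat n n" "W \<in> carrier_mat n n" "\<Gamma> = G * mat_adjoint G"
    "W * mat_adjoint G = 1\<^sub>m n" "mat_adjoint G * W = 1\<^sub>m n"
proof -
  have "0 \<le> Re ((\<Gamma> *\<^sub>v v) \<bullet>c v)" if "v \<in> carrier_vec n" for v
  proof (cases "v = 0\<^sub>v n")
    case True
    then show ?thesis using \<Gamma> by (simp add: mult_mat_zero_vec[OF \<Gamma>(1)])
  qed (use pos[OF that] in simp)
  then have "psd n \<Gamma>" using \<Gamma> by (simp add: psd_def)
  then obtain G where G: "G \<in> carrier_mat n n" "\<Gamma> = G * mat_adjoint G" by (rule psd_factorization)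
  note H = mat_adjoint_carrier[OF G(1)]
  have "det (mat_adjoint G) \<noteq> 0"
  proof
    assume "det (mat_adjoint G) = 0"
    then obtain v where v: "v \<in> carrier_vec n" "v \<noteq> 0\<^sub>v n" "mat_adjoint G *\<^sub>v v = 0\<^sub>v n"
      using det_0_iff_vec_prod_zero_field[OF H] by blast
    have "\<Gamma> *\<^sub>v v = 0\<^sub>v n"
      unfolding G(2) assoc_mult_mat_vec[OF G(1) H v(1)] v(3) by (rule mult_mat_zero_vec[OF G(1)])
    then show False using pos[OF v(1,2)] v(1) by simp
  qed
  then have "mat_adjoint G \<in> Units (ring_mat TYPE(complex) n ())"
    by (rule det_non_zero_imp_unit[OF H])
  then obtain W where "W \<in> carrier_mat n n" "W * mat_adjoint G = 1\<^sub>m n" "mat_adjoint G * W = 1\<^sub>m n"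
    unfolding Units_def ring_mat_def by auto
  with G show thesis using that by blast
qed

text \<open>Read \<open>v\<close> as a matrix V with row index \<open>b\<close> and column index
  \<open>k\<close>. The coefficients at \<open>x_j\<close> then act by left multiplication combined
  with the transpose of \<open>X j\<close> on the right, those at the adjoint variables with the
  entrywise conjugate of \<open>X j\<close> on the right.\<close>

lemma pencil_eval_mult_vec_index:
  assumes p: "p \<in> carrier_pencil r c" and X: "X \<in> mat_tuples n" and v: "v \<in> carrier_vec (c * n)"
    and "e < r" "i < n"
  shows "(pencil_eval n p X *\<^sub>v v) $ (e * n + i) = (\<Sum>b<c. const_coeff p $$ (e, b) * v $ (b * n + i)) +
    (\<Sum>j\<in>UNIV. \<Sum>b<c. x_coeff p j $$ (e, b) * (\<Sum>k<n. X j $$ (i, k) * v $ (b * n + k)) +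
      xstar_coeff p j $$ (e, b) * (\<Sum>k<n. cnj (X j $$ (k, i)) * v $ (b * n + k)))"
proof -
  have "(pencil_eval n p X *\<^sub>v v) $ (e * n + i) =
    (\<Sum>b<c. \<Sum>k<n. pencil_eval n p X $$ (e * n + i, b * n + k) * v $ (b * n + k))"
    using mult_vec_index_sum[OF pencil_eval_carrier[OF p] v block_index_less[OF assms(4,5)]]
    by (simp only: sum_lessThan_mult)
  also have "\<dots> = (\<Sum>b<c. \<Sum>k<n. (if k = i then const_coeff p $$ (e, b) * v $ (b * n + k) else 0)
      + (\<Sum>j\<in>UNIV. x_coeff p j $$ (e, b) * (X j $$ (i, k) * v $ (b * n + k))
        + xstar_coeff p j $$ (e, b) * (cnj (X j $$ (k, i)) * v $ (b * n + k))))"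
  proof (intro sum.cong refl)
    fix b k assume "b \<in> {..<c}" "k \<in> {..<n}"
    then have "b < c" "k < n" by auto
    then show "pencil_eval n p X $$ (e * n + i, b * n + k) * v $ (b * n + k) =
      (if k = i then const_coeff p $$ (e, b) * v $ (b * n + k) else 0)
      + (\<Sum>j\<in>UNIV. x_coeff p j $$ (e, b) * (X j $$ (i, k) * v $ (b * n + k))
        + xstar_coeff p j $$ (e, b) * (cnj (X j $$ (k, i)) * v $ (b * n + k)))"
      using pencil_eval_index[OF p X assms(4) _ assms(5), of b k]
      by (auto simp: sum.distrib sum_distrib_right distrib_right mult.assoc)
  qed
  also have "\<dots> = (\<Sum>b<c. const_coeff p $$ (e, b) * v $ (b * n + i)) +
    (\<Sum>b<c. \<Sum>k<n. \<Sum>j\<in>UNIV. x_coeff p j $$ (e, b) * (X j $$ (i, k) * v $ (b * n + k))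
        + xstar_coeff p j $$ (e, b) * (cnj (X j $$ (k, i)) * v $ (b * n + k)))"
    using assms(5) by (simp add: sum.distrib)
  also have "(\<Sum>b<c. \<Sum>k<n. \<Sum>j\<in>UNIV. x_coeff p j $$ (e, b) * (X j $$ (i, k) * v $ (b * n + k))
        + xstar_coeff p j $$ (e, b) * (cnj (X j $$ (k, i)) * v $ (b * n + k))) =
    (\<Sum>j\<in>UNIV. \<Sum>b<c. \<Sum>k<n. x_coeff p j $$ (e, b) * (X j $$ (i, k) * v $ (b * n + k))
        + xstar_coeff p j $$ (e, b) * (cnj (X j $$ (k, i)) * v $ (b * n + k)))"
    by (simp only: sum.swap[of _ UNIV])
  finally show ?thesis by (simp only: sum.distrib sum_distrib_left)
qed

text \<open>A monic pencil has constant term 1, so the functional must be normalised: congruence by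
  the inverse of \<open>G\<close> carries \<open>\<Gamma>0\<close> to the identity and each
  \<open>\<Gamma> j\<close> to the transpose of \<open>X j\<close>, and respects both positivity and
  the orthogonality relations.\<close>

lemma rank_deficient_of_only_zero:
  fixes A :: "'g::finite \<Rightarrow> complex mat"
  assumes A: "\<forall>j. A j \<in> carrier_mat d d" and Lt: "Lt \<in> carrier_pencil \<delta> \<epsilon>" and e0: "0 < \<epsilon>"
    and only_zero: "\<And>D P0 Cs. is_certificate d \<delta> \<epsilon> (hermitian_monic_pencil d A) Lt D P0 Cs \<Longrightarrow> is_zero_solution d \<epsilon> P0 Cs"
  shows "\<exists>X\<in>interior_spectrahedron (hermitian_monic_pencil d A) \<epsilon>. \<not> full_column_rank (pencil_eval \<epsilon> Lt X)"
proof -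
  obtain \<Gamma>0 \<Gamma> where \<Gamma>0: "\<Gamma>0 \<in> carrier_mat \<epsilon> \<epsilon>" "mat_adjoint \<Gamma>0 = \<Gamma>0" and \<Gamma>: "\<And>j. \<Gamma> j \<in> carrier_mat \<epsilon> \<epsilon>"
    and ortho: "\<And>e a. e < \<delta> \<Longrightarrow> a < \<epsilon> \<Longrightarrow> (\<Sum>b<\<epsilon>. const_coeff Lt $$ (e, b) * \<Gamma>0 $$ (b, a)) +
      (\<Sum>j\<in>UNIV. \<Sum>b<\<epsilon>. x_coeff Lt j $$ (e, b) * \<Gamma> j $$ (b, a) + xstar_coeff Lt j $$ (e, b) * cnj (\<Gamma> j $$ (a, b))) = 0"
    and pos: "\<And>g. \<exists>p\<in>{..d} \<times> {..<\<epsilon>}. g p \<noteq> 0 \<Longrightarrow>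
      0 < Re (\<Sum>a<\<epsilon>. \<Sum>b<\<epsilon>. \<Gamma>0 $$ (b, a) * (\<Sum>\<alpha>\<le>d. g (\<alpha>, a) * cnj (g (\<alpha>, b))))
        - 2 * Re (\<Sum>j\<in>UNIV. \<Sum>a<\<epsilon>. \<Sum>b<\<epsilon>. \<Gamma> j $$ (b, a) *
            (\<Sum>\<alpha><d. \<Sum>\<beta><d. A j $$ (\<alpha>, \<beta>) * (g (\<alpha>, a) * cnj (g (\<beta>, b)))))"
    by (rule separating_data[OF A Lt e0]) (erule only_zero, blast)
  have "0 < Re ((\<Gamma>0 *\<^sub>v v) \<bullet>c v)" if v: "v \<in> carrier_vec \<epsilon>" "v \<noteq> 0\<^sub>v \<epsilon>" for v
  proof -
    obtain a where a: "a < \<epsilon>" "v $ a \<noteq> 0" using v by (metis eq_vecI carrier_vecD index_zero_vec)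
    \<comment> \<open>Supported on the extra row \<open>d\<close>, where \<open>L\<close> is
      replaced by 1, this tests the functional on a pure \<open>P0\<close> term.\<close>
    define g where "g = (\<lambda>(\<alpha>, a). if \<alpha> = d then v $ a else 0)"
    have "g (d, a) \<noteq> 0" using a by (simp add: g_def)
    then have "\<exists>p\<in>{..d} \<times> {..<\<epsilon>}. g p \<noteq> 0" using a by blast
    note positive = pos[OF this]
    have "(\<Sum>\<alpha>\<le>d. g (\<alpha>, a) * cnj (g (\<alpha>, b))) = v $ a * cnj (v $ b)" for a b
      unfolding lessThan_Suc_atMost[symmetric] by (simp add: g_def)
    moreover have "(\<Sum>\<alpha><d. \<Sum>\<beta><d. A j $$ (\<alpha>, \<beta>) * (g (\<alpha>, a) * cnj (g (\<beta>, b)))) = 0" for j a b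
      by (simp add: g_def)
    ultimately have "0 < Re (\<Sum>a<\<epsilon>. \<Sum>b<\<epsilon>. \<Gamma>0 $$ (b, a) * (v $ a * cnj (v $ b)))"
      using positive by simp
    also have "(\<Sum>a<\<epsilon>. \<Sum>b<\<epsilon>. \<Gamma>0 $$ (b, a) * (v $ a * cnj (v $ b))) = qform {..<\<epsilon>} (\<lambda>i j. \<Gamma>0 $$ (i, j)) (\<lambda>i. v $ i)"
      unfolding qform_def by (subst sum.swap) (simp only: mult_ac)
    finally show ?thesis by (simp only: cscalar_prod_qform[OF \<Gamma>0(1) v(1)])
  qed
  then obtain G W where G: "G \<in> carrier_mat \<epsilon> \<epsilon>" and W: "W \<in> carrier_mat \<epsilon> \<epsilon>" and \<Gamma>G: "\<Gamma>0 = G * mat_adjoint G"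
    and WH: "W * mat_adjoint G = 1\<^sub>m \<epsilon>" and HW: "mat_adjoint G * W = 1\<^sub>m \<epsilon>"
    by (rule posdef_factorization[OF \<Gamma>0]) blast
  \<comment> \<open>\<open>W\<close> inverts the adjoint of \<open>G\<close>, so \<open>F\<close>
    inverts \<open>G\<close>.\<close>
  define F where "F = mat_adjoint W"
  have F: "F \<in> carrier_mat \<epsilon> \<epsilon>" using W by (simp add: F_def)
  note H = mat_adjoint_carrier[OF G]
  have GF: "G * F = 1\<^sub>m \<epsilon>" and FG: "F * G = 1\<^sub>m \<epsilon>"
    using arg_cong[OF WH, of mat_adjoint] arg_cong[OF HW, of mat_adjoint] mat_adjoint_mult[OF W H] mat_adjoint_mult[OF H W]
    by (simp_all add: F_def)
  have cancel: "G * (F * M) = M" "F * (G * M) = M" if "M \<in> carrier_mat \<epsilon> m" for M m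
    using assoc_mult_mat[OF G F that] assoc_mult_mat[OF F G that] GF FG that by simp_all
  define Y where "Y j = F * (\<Gamma> j * W)" for j
  have Y: "Y j \<in> carrier_mat \<epsilon> \<epsilon>" for j unfolding Y_def using F \<Gamma> W by (auto intro!: mult_carrier_mat)
  have GW: "G = \<Gamma>0 * W" unfolding \<Gamma>G using assoc_mult_mat[OF G H W] HW G by simp
  have GY: "G * Y j = \<Gamma> j * W" for j
    unfolding Y_def using \<Gamma> W by (intro cancel(1)[of _ \<epsilon>] mult_carrier_mat)
  have GY': "G * mat_adjoint (Y j) = mat_adjoint (\<Gamma> j) * W" for j
  proof -
    have "mat_adjoint (Y j) = (F * mat_adjoint (\<Gamma> j)) * W"
      unfolding Y_def mat_adjoint_mult[OF F mult_carrier_mat[OF \<Gamma> W]] mat_adjoint_mult[OF \<Gamma> W]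
      by (simp add: F_def)
    also have "\<dots> = F * (mat_adjoint (\<Gamma> j) * W)" by (rule assoc_mult_mat[OF F mat_adjoint_carrier[OF \<Gamma>] W])
    finally show ?thesis using cancel(1)[OF mult_carrier_mat[OF mat_adjoint_carrier[OF \<Gamma>] W]] by simp
  qed
  \<comment> \<open>the transpose is forced by \<open>kron A X\<close> acting on the vectorised \<open>V\<close> as \<open>A V X\<^sup>T\<close>\<close>
  define X where "X j = transpose_mat (Y j)" for j
  have X: "X \<in> mat_tuples \<epsilon>" unfolding mat_tuples_def X_def using Y by simp
  have XY: "X j $$ (i, k) = Y j $$ (k, i)" if "i < \<epsilon>" "k < \<epsilon>" for i j k
    using that Y[of j] by (simp add: X_def)
  have "X \<in> interior_spectrahedron (hermitian_monic_pencil d A) \<epsilon>"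
  proof (rule posdef_interior_spectrahedron[OF A X])
    fix v :: "complex vec" assume v: "v \<in> carrier_vec (d * \<epsilon>)" "v \<noteq> 0\<^sub>v (d * \<epsilon>)"
    define V where "V = mat d \<epsilon> (\<lambda>(\<alpha>, i). v $ (\<alpha> * \<epsilon> + i))"
    \<comment> \<open>The substitution \<open>V = C * G\<close> undoes the normalisation: the value
      of the form of \<open>L(X)\<close> at \<open>v\<close> is the value of the functional at the
      single matrix \<open>C\<close>.\<close>
    define C where "C = V * F"
    have V: "V \<in> carrier_mat d \<epsilon>" by (simp add: V_def)
    have C: "C \<in> carrier_mat d \<epsilon>" unfolding C_def using V F by simp
    have VCG: "V = C * G" unfolding C_def using assoc_mult_mat[OF V F G] FG V by simp
    \<comment> \<open>Row \<open>d\<close> is zero, since only the part belonging to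
      \<open>L\<close> is tested; the conjugate is the one in the definition of \<open>C\<close> in
      \<open>gram_certificate\<close>.\<close>
    define g where "g = (\<lambda>(\<alpha>, a). if \<alpha> < d then cnj (C $$ (\<alpha>, a)) else 0)"
    have "\<exists>p\<in>{..d} \<times> {..<\<epsilon>}. g p \<noteq> 0"
    proof (rule ccontr)
      assume no: "\<not> ?thesis"
      have "C = 0\<^sub>m d \<epsilon>"
      proof (rule eq_matI)
        fix \<alpha> a assume "\<alpha> < dim_row (0\<^sub>m d \<epsilon> :: complex mat)" "a < dim_col (0\<^sub>m d \<epsilon> :: complex mat)"
        then have "\<alpha> < d" "a < \<epsilon>" by auto
        moreover from this no have "g (\<alpha>, a) = 0" by auto
        ultimately show "C $$ (\<alpha>, a) = 0\<^sub>m d \<epsilon> $$ (\<alpha>, a)" by (simp add: g_def)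
      qed (use C in auto)
      then have V0: "V = 0\<^sub>m d \<epsilon>" unfolding VCG using G by simp
      have "v = 0\<^sub>v (d * \<epsilon>)"
      proof (rule eq_vec_blockI[OF v(1)])
        fix \<alpha> i assume "\<alpha> < d" "i < \<epsilon>"
        then show "v $ (\<alpha> * \<epsilon> + i) = 0\<^sub>v (d * \<epsilon>) $ (\<alpha> * \<epsilon> + i)"
          using arg_cong[OF V0, of "\<lambda>M. M $$ (\<alpha>, i)"] by (simp add: V_def block_index_less)
      qed simp
      then show False using v by simp
    qed
    note positive = pos[OF this]
    \<comment> \<open>Congruence: the inner matrix \<open>F * (M * W)\<close> is the identity for
      \<open>M = \<Gamma>0\<close> and \<open>Y j\<close> for \<open>M = \<Gamma> j\<close>.\<close>
    have CV: "C * M * mat_adjoint C = V * (F * (M * W)) * mat_adjoint V" if M: "M \<in> carrier_mat \<epsilon> \<epsilon>" for M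
    proof -
      have MW: "M * W \<in> carrier_mat \<epsilon> \<epsilon>" using M W by simp
      have "V * (F * (M * W)) = C * (M * W)" unfolding C_def using assoc_mult_mat[OF V F MW] by simp
      also have "\<dots> * mat_adjoint V = C * (M * W * mat_adjoint V)"
        by (rule assoc_mult_mat[OF C MW mat_adjoint_carrier[OF V]])
      also have "M * W * mat_adjoint V = M * (W * mat_adjoint V)"
        by (rule assoc_mult_mat[OF M W mat_adjoint_carrier[OF V]])
      also have "W * mat_adjoint V = mat_adjoint C"
        unfolding C_def mat_adjoint_mult[OF V F] by (simp add: F_def)
      also have "C * (M * mat_adjoint C) = C * M * mat_adjoint C"
        using assoc_mult_mat[OF C M mat_adjoint_carrier[OF C]] by simp
      finally show ?thesis ..
    qed
    have first: "(\<Sum>a<\<epsilon>. \<Sum>b<\<epsilon>. \<Gamma>0 $$ (b, a) * (\<Sum>\<alpha>\<le>d. g (\<alpha>, a) * cnj (g (\<alpha>, b)))) =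
        of_real (\<Sum>\<alpha><d. \<Sum>i<\<epsilon>. (cmod (v $ (\<alpha> * \<epsilon> + i)))\<^sup>2)"
    proof -
      have "(\<Sum>\<alpha>\<le>d. g (\<alpha>, a) * cnj (g (\<alpha>, b))) = (\<Sum>\<alpha><d. cnj (C $$ (\<alpha>, a)) * C $$ (\<alpha>, b))" for a b
        unfolding lessThan_Suc_atMost[symmetric] by (simp add: g_def)
      then have "(\<Sum>a<\<epsilon>. \<Sum>b<\<epsilon>. \<Gamma>0 $$ (b, a) * (\<Sum>\<alpha>\<le>d. g (\<alpha>, a) * cnj (g (\<alpha>, b)))) =
          (\<Sum>a<\<epsilon>. \<Sum>b<\<epsilon>. \<Sum>\<alpha><d. C $$ (\<alpha>, b) * \<Gamma>0 $$ (b, a) * cnj (C $$ (\<alpha>, a)))"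
        by (simp only: sum_distrib_left mult_ac)
      also have "\<dots> = (\<Sum>\<alpha><d. \<Sum>a<\<epsilon>. \<Sum>b<\<epsilon>. C $$ (\<alpha>, b) * \<Gamma>0 $$ (b, a) * cnj (C $$ (\<alpha>, a)))"
        by (rule trans[OF sum.cong[OF refl sum.swap] sum.swap])
      also have "\<dots> = (\<Sum>\<alpha><d. (C * \<Gamma>0 * mat_adjoint C) $$ (\<alpha>, \<alpha>))"
        by (intro sum.cong refl) (simp only: lessThan_iff sandwich_index[OF C \<Gamma>0(1)])
      also have "C * \<Gamma>0 * mat_adjoint C = V * 1\<^sub>m \<epsilon> * mat_adjoint V"
        unfolding CV[OF \<Gamma>0(1)] GW[symmetric] FG ..
      also have "(\<Sum>\<alpha><d. (V * 1\<^sub>m \<epsilon> * mat_adjoint V) $$ (\<alpha>, \<alpha>)) = (\<Sum>\<alpha><d. \<Sum>i<\<epsilon>. V $$ (\<alpha>, i) * cnj (V $$ (\<alpha>, i)))"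
      proof (intro sum.cong refl)
        fix \<alpha> assume "\<alpha> \<in> {..<d}"
        then have \<alpha>: "\<alpha> < d" by simp
        have "(V * 1\<^sub>m \<epsilon> * mat_adjoint V) $$ (\<alpha>, \<alpha>) = (V * mat_adjoint V) $$ (\<alpha>, \<alpha>)" using V by simp
        also have "\<dots> = (\<Sum>i<\<epsilon>. V $$ (\<alpha>, i) * mat_adjoint V $$ (i, \<alpha>))"
          by (rule mult_mat_index_sum[OF V mat_adjoint_carrier[OF V] \<alpha> \<alpha>])
        finally show "(V * 1\<^sub>m \<epsilon> * mat_adjoint V) $$ (\<alpha>, \<alpha>) = (\<Sum>i<\<epsilon>. V $$ (\<alpha>, i) * cnj (V $$ (\<alpha>, i)))"
          using V \<alpha> by simp
      qed
      also have "\<dots> = of_real (\<Sum>\<alpha><d. \<Sum>i<\<epsilon>. (cmod (v $ (\<alpha> * \<epsilon> + i)))\<^sup>2)"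
        unfolding of_real_sum complex_norm_square by (simp add: V_def)
      finally show ?thesis .
    qed
    have second: "(\<Sum>a<\<epsilon>. \<Sum>b<\<epsilon>. \<Gamma> j $$ (b, a) * (\<Sum>\<alpha><d. \<Sum>\<beta><d. A j $$ (\<alpha>, \<beta>) * (g (\<alpha>, a) * cnj (g (\<beta>, b))))) =
        (\<Sum>\<alpha><d. \<Sum>\<beta><d. A j $$ (\<alpha>, \<beta>) *
          (\<Sum>k<\<epsilon>. \<Sum>i<\<epsilon>. v $ (\<beta> * \<epsilon> + k) * X j $$ (i, k) * cnj (v $ (\<alpha> * \<epsilon> + i))))" for j
    proof -
      have "(\<Sum>a<\<epsilon>. \<Sum>b<\<epsilon>. \<Gamma> j $$ (b, a) * (\<Sum>\<alpha><d. \<Sum>\<beta><d. A j $$ (\<alpha>, \<beta>) * (g (\<alpha>, a) * cnj (g (\<beta>, b))))) =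
        (\<Sum>a<\<epsilon>. \<Sum>b<\<epsilon>. \<Gamma> j $$ (b, a) * (\<Sum>\<alpha><d. \<Sum>\<beta><d. A j $$ (\<alpha>, \<beta>) * (cnj (C $$ (\<alpha>, a)) * C $$ (\<beta>, b))))"
        by (simp add: g_def)
      also have "\<dots> = (\<Sum>a<\<epsilon>. \<Sum>b<\<epsilon>. \<Sum>\<alpha><d. \<Sum>\<beta><d. A j $$ (\<alpha>, \<beta>) * (C $$ (\<beta>, b) * \<Gamma> j $$ (b, a) * cnj (C $$ (\<alpha>, a))))"
        by (simp only: sum_distrib_left mult_ac)
      also have "\<dots> = (\<Sum>\<alpha><d. \<Sum>\<beta><d. \<Sum>a<\<epsilon>. \<Sum>b<\<epsilon>. A j $$ (\<alpha>, \<beta>) * (C $$ (\<beta>, b) * \<Gamma> j $$ (b, a) * cnj (C $$ (\<alpha>, a))))"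
        by (rule trans[OF sum.cong[OF refl sum_rotate] sum_rotate])
      also have "\<dots> = (\<Sum>\<alpha><d. \<Sum>\<beta><d. A j $$ (\<alpha>, \<beta>) * (C * \<Gamma> j * mat_adjoint C) $$ (\<beta>, \<alpha>))"
        by (intro sum.cong refl) (simp only: lessThan_iff sandwich_index[OF C \<Gamma>] sum_distrib_left)
      also have "C * \<Gamma> j * mat_adjoint C = V * Y j * mat_adjoint V"
        unfolding CV[OF \<Gamma>] Y_def ..
      also have "(\<Sum>\<alpha><d. \<Sum>\<beta><d. A j $$ (\<alpha>, \<beta>) * (V * Y j * mat_adjoint V) $$ (\<beta>, \<alpha>)) =
        (\<Sum>\<alpha><d. \<Sum>\<beta><d. A j $$ (\<alpha>, \<beta>) *
          (\<Sum>k<\<epsilon>. \<Sum>i<\<epsilon>. v $ (\<beta> * \<epsilon> + k) * X j $$ (i, k) * cnj (v $ (\<alpha> * \<epsilon> + i))))"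
      proof (intro sum.cong refl arg_cong2[of _ _ _ _ "(*)"])
        fix \<alpha> \<beta> assume "\<alpha> \<in> {..<d}" "\<beta> \<in> {..<d}"
        then have \<alpha>\<beta>: "\<alpha> < d" "\<beta> < d" by auto
        have "(V * Y j * mat_adjoint V) $$ (\<beta>, \<alpha>) = (\<Sum>i<\<epsilon>. \<Sum>k<\<epsilon>. V $$ (\<beta>, k) * Y j $$ (k, i) * cnj (V $$ (\<alpha>, i)))"
          by (rule sandwich_index[OF V Y \<alpha>\<beta>(2,1)])
        also have "\<dots> = (\<Sum>k<\<epsilon>. \<Sum>i<\<epsilon>. V $$ (\<beta>, k) * Y j $$ (k, i) * cnj (V $$ (\<alpha>, i)))" by (rule sum.swap)
        also have "\<dots> = (\<Sum>k<\<epsilon>. \<Sum>i<\<epsilon>. v $ (\<beta> * \<epsilon> + k) * X j $$ (i, k) * cnj (v $ (\<alpha> * \<epsilon> + i)))"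
          using \<alpha>\<beta> by (intro sum.cong refl) (simp add: V_def XY)
        finally show "(V * Y j * mat_adjoint V) $$ (\<beta>, \<alpha>) = \<dots>" .
      qed
      finally show ?thesis .
    qed
    show "0 < Re ((pencil_eval \<epsilon> (hermitian_monic_pencil d A) X *\<^sub>v v) \<bullet>c v)"
      using positive unfolding first second Re_complex_of_real hermitian_monic_pencil_form[OF A X v(1)] .
  qed
  moreover have "\<not> full_column_rank (pencil_eval \<epsilon> Lt X)"
  proof -
    \<comment> \<open>Row-by-row vectorisation of \<open>G\<close>, matching the block indexing of
      \<open>kron\<close>; it is nonzero because \<open>G\<close> is invertible and
      \<open>0 < \<epsilon>\<close>.\<close>
    define v where "v = vec (\<epsilon> * \<epsilon>) (\<lambda>s. G $$ (s div \<epsilon>, s mod \<epsilon>))"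
    have v: "v \<in> carrier_vec (\<epsilon> * \<epsilon>)" by (simp add: v_def)
    have vG: "v $ (b * \<epsilon> + k) = G $$ (b, k)" if "b < \<epsilon>" "k < \<epsilon>" for b k
      using that by (simp add: v_def block_index_less)
    have "v \<noteq> 0\<^sub>v (\<epsilon> * \<epsilon>)"
    proof
      assume v0: "v = 0\<^sub>v (\<epsilon> * \<epsilon>)"
      have "G = 0\<^sub>m \<epsilon> \<epsilon>"
      proof (rule eq_matI)
        fix b k assume "b < dim_row (0\<^sub>m \<epsilon> \<epsilon> :: complex mat)" "k < dim_col (0\<^sub>m \<epsilon> \<epsilon> :: complex mat)"
        then have "b < \<epsilon>" "k < \<epsilon>" by auto
        then show "G $$ (b, k) = 0\<^sub>m \<epsilon> \<epsilon> $$ (b, k)" using vG[of b k] v0 by (simp add: block_index_less)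
      qed (use G in auto)
      then have "1\<^sub>m \<epsilon> = (0\<^sub>m \<epsilon> \<epsilon> :: complex mat)" using GF F by simp
      from arg_cong[OF this, of "\<lambda>M. M $$ (0, 0)"] show False using e0 by simp
    qed
    \<comment> \<open>Transposing and conjugating \<open>X j\<close> give \<open>Y j\<close> and
      \<open>mat_adjoint (Y j)\<close>. By \<open>GW\<close>, \<open>GY\<close> and
      \<open>GY'\<close> the value is therefore the left-hand side of \<open>ortho\<close>, as a
      matrix, multiplied by \<open>W\<close> from the right.\<close>
    moreover have "pencil_eval \<epsilon> Lt X *\<^sub>v v = 0\<^sub>v (\<delta> * \<epsilon>)"
    proof (rule eq_vec_blockI[OF mult_mat_vec_carrier[OF pencil_eval_carrier[OF Lt] v]])
      fix e i assume e: "e < \<delta>" and i: "i < \<epsilon>"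
      have Xs: "(\<Sum>k<\<epsilon>. X j $$ (i, k) * v $ (b * \<epsilon> + k)) = (\<Sum>m<\<epsilon>. \<Gamma> j $$ (b, m) * W $$ (m, i))"
        "(\<Sum>k<\<epsilon>. cnj (X j $$ (k, i)) * v $ (b * \<epsilon> + k)) = (\<Sum>m<\<epsilon>. cnj (\<Gamma> j $$ (m, b)) * W $$ (m, i))"
        if b: "b < \<epsilon>" for b j
      proof -
        have "(\<Sum>k<\<epsilon>. X j $$ (i, k) * v $ (b * \<epsilon> + k)) = (\<Sum>k<\<epsilon>. G $$ (b, k) * Y j $$ (k, i))"
          using b i by (intro sum.cong refl) (simp add: XY vG)
        also have "\<dots> = (G * Y j) $$ (b, i)" by (rule mult_mat_index_sum[OF G Y b i, symmetric])
        also have "\<dots> = (\<Sum>m<\<epsilon>. \<Gamma> j $$ (b, m) * W $$ (m, i))"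
          unfolding GY by (rule mult_mat_index_sum[OF \<Gamma> W b i])
        finally show "(\<Sum>k<\<epsilon>. X j $$ (i, k) * v $ (b * \<epsilon> + k)) = (\<Sum>m<\<epsilon>. \<Gamma> j $$ (b, m) * W $$ (m, i))" .
        have dims: "dim_row (Y j) = \<epsilon>" "dim_col (Y j) = \<epsilon>" "dim_row (\<Gamma> j) = \<epsilon>" "dim_col (\<Gamma> j) = \<epsilon>"
          using Y[of j] \<Gamma>[of j] by auto
        have "(\<Sum>k<\<epsilon>. cnj (X j $$ (k, i)) * v $ (b * \<epsilon> + k)) = (\<Sum>k<\<epsilon>. G $$ (b, k) * mat_adjoint (Y j) $$ (k, i))"
          using b i dims by (intro sum.cong refl) (simp add: XY vG)
        also have "\<dots> = (G * mat_adjoint (Y j)) $$ (b, i)"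
          by (rule mult_mat_index_sum[OF G mat_adjoint_carrier[OF Y] b i, symmetric])
        also have "\<dots> = (\<Sum>m<\<epsilon>. mat_adjoint (\<Gamma> j) $$ (b, m) * W $$ (m, i))"
          unfolding GY' by (rule mult_mat_index_sum[OF mat_adjoint_carrier[OF \<Gamma>] W b i])
        also have "\<dots> = (\<Sum>m<\<epsilon>. cnj (\<Gamma> j $$ (m, b)) * W $$ (m, i))"
          using b dims by (intro sum.cong refl) simp
        finally show "(\<Sum>k<\<epsilon>. cnj (X j $$ (k, i)) * v $ (b * \<epsilon> + k)) = (\<Sum>m<\<epsilon>. cnj (\<Gamma> j $$ (m, b)) * W $$ (m, i))" .
      qed
      have vs: "v $ (b * \<epsilon> + i) = (\<Sum>m<\<epsilon>. \<Gamma>0 $$ (b, m) * W $$ (m, i))" if b: "b < \<epsilon>" for b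
        using vG[OF b i] mult_mat_index_sum[OF \<Gamma>0(1) W b i] GW by simp
      have "(pencil_eval \<epsilon> Lt X *\<^sub>v v) $ (e * \<epsilon> + i) =
        (\<Sum>b<\<epsilon>. const_coeff Lt $$ (e, b) * (\<Sum>m<\<epsilon>. \<Gamma>0 $$ (b, m) * W $$ (m, i))) +
        (\<Sum>j\<in>UNIV. \<Sum>b<\<epsilon>. x_coeff Lt j $$ (e, b) * (\<Sum>m<\<epsilon>. \<Gamma> j $$ (b, m) * W $$ (m, i)) +
          xstar_coeff Lt j $$ (e, b) * (\<Sum>m<\<epsilon>. cnj (\<Gamma> j $$ (m, b)) * W $$ (m, i)))"
        unfolding pencil_eval_mult_vec_index[OF Lt X v e i]
        by (intro arg_cong2[of _ _ _ _ "(+)"] sum.cong refl) (simp_all only: lessThan_iff vs Xs)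
      also have "\<dots> = (\<Sum>b<\<epsilon>. \<Sum>m<\<epsilon>. const_coeff Lt $$ (e, b) * \<Gamma>0 $$ (b, m) * W $$ (m, i)) +
        (\<Sum>j\<in>UNIV. \<Sum>b<\<epsilon>. \<Sum>m<\<epsilon>. (x_coeff Lt j $$ (e, b) * \<Gamma> j $$ (b, m) + xstar_coeff Lt j $$ (e, b) * cnj (\<Gamma> j $$ (m, b))) * W $$ (m, i))"
        by (simp only: sum_distrib_left sum.distrib[symmetric] distrib_right mult.assoc)
      also have "\<dots> = (\<Sum>m<\<epsilon>. ((\<Sum>b<\<epsilon>. const_coeff Lt $$ (e, b) * \<Gamma>0 $$ (b, m)) +
        (\<Sum>j\<in>UNIV. \<Sum>b<\<epsilon>. x_coeff Lt j $$ (e, b) * \<Gamma> j $$ (b, m) + xstar_coeff Lt j $$ (e, b) * cnj (\<Gamma> j $$ (m, b)))) * W $$ (m, i))"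
      proof -
        have "(\<Sum>b<\<epsilon>. \<Sum>m<\<epsilon>. const_coeff Lt $$ (e, b) * \<Gamma>0 $$ (b, m) * W $$ (m, i)) =
            (\<Sum>m<\<epsilon>. \<Sum>b<\<epsilon>. const_coeff Lt $$ (e, b) * \<Gamma>0 $$ (b, m) * W $$ (m, i))" by (rule sum.swap)
        moreover have "(\<Sum>j\<in>UNIV. \<Sum>b<\<epsilon>. \<Sum>m<\<epsilon>. f j b m) = (\<Sum>m<\<epsilon>. \<Sum>j\<in>UNIV. \<Sum>b<\<epsilon>. f j b m)"
          for f :: "'g \<Rightarrow> nat \<Rightarrow> nat \<Rightarrow> complex"
          by (rule trans[OF sum.cong[OF refl sum.swap] sum.swap])
        ultimately show ?thesis by (simp only: distrib_right sum_distrib_right sum.distrib add.assoc)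
      qed
      also have "\<dots> = 0" using ortho[OF e] by (intro sum.neutral ballI) simp
      finally show "(pencil_eval \<epsilon> Lt X *\<^sub>v v) $ (e * \<epsilon> + i) = 0\<^sub>v (\<delta> * \<epsilon>) $ (e * \<epsilon> + i)"
        using e i by (simp add: block_index_less)
    qed simp
    ultimately show ?thesis using full_column_rank_iff[OF pencil_eval_carrier[OF Lt]] v by blast
  qed
  ultimately show ?thesis by blast
qed

theorem theorem1p4:
  fixes d \<delta> \<epsilon> :: nat
    and A :: "'g::finite \<Rightarrow> complex mat"
    and L Lt :: "'g pencil"
  assumes "0 < d" and "0 < \<epsilon>" and "\<epsilon> \<le> \<delta>"
    and "\<forall>j. A j \<in> carrier_mat d d"
    and "L = hermitian_monic_pencil d A"
    and "Lt \<in> carrier_pencil \<delta> \<epsilon>"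
  shows
    "((\<forall>D P0 Cs. is_certificate d \<delta> \<epsilon> L Lt D P0 Cs \<longrightarrow> is_zero_solution d \<epsilon> P0 Cs) \<longrightarrow>
       (\<exists>n>0. \<exists>X\<in>interior_spectrahedron L n. \<not> full_column_rank (pencil_eval n Lt X)))
     \<and>
     (\<forall>D P0 Cs. is_certificate d \<delta> \<epsilon> L Lt D P0 Cs \<and> \<not> is_zero_solution d \<epsilon> P0 Cs \<longrightarrow>
       (let V = common_kernel P0 Cs in
         (V = {0\<^sub>v \<epsilon>} \<longrightarrow> full_rank_on_interior L Lt)
         \<and>
         (V \<noteq> {0\<^sub>v \<epsilon>} \<longrightarrow>
           (\<forall>B. vec_space.basis_mat \<epsilon> V B \<longrightarrow>
             (full_rank_on_interior L Lt \<longleftrightarrow> full_rank_on_interior L (pencil_rmult Lt B))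
             \<and> pencil_rmult Lt B \<in> carrier_pencil \<delta> (dim_col B)
             \<and> 0 < dim_col B \<and> dim_col B < \<epsilon> \<and> dim_col B \<le> \<delta>))))"
proof -
  have A: "\<forall>j. A j \<in> carrier_mat d d" and L: "L = hermitian_monic_pencil d A"
    and Lt: "Lt \<in> carrier_pencil \<delta> \<epsilon>" using assms by auto
  show ?thesis
    unfolding L Let_def
  proof (intro conjI impI allI)
    assume "\<forall>D P0 Cs. is_certificate d \<delta> \<epsilon> (hermitian_monic_pencil d A) Lt D P0 Cs \<longrightarrow> is_zero_solution d \<epsilon> P0 Cs"
    then show "\<exists>n>0. \<exists>X\<in>interior_spectrahedron (hermitian_monic_pencil d A) n. \<not> full_column_rank (pencil_eval n Lt X)"
      using rank_deficient_of_only_zero[OF A Lt \<open>0 < \<epsilon>\<close>] \<open>0 < \<epsilon>\<close> by blast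
  next
    fix D P0 Cs
    assume "is_certificate d \<delta> \<epsilon> (hermitian_monic_pencil d A) Lt D P0 Cs \<and> \<not> is_zero_solution d \<epsilon> P0 Cs"
    then have cert: "is_certificate d \<delta> \<epsilon> (hermitian_monic_pencil d A) Lt D P0 Cs"
      and nz: "\<not> is_zero_solution d \<epsilon> P0 Cs" by auto
    show "full_rank_on_interior (hermitian_monic_pencil d A) Lt" if "common_kernel P0 Cs = {0\<^sub>v \<epsilon>}"
      by (rule full_rank_of_trivial_common_kernel[OF A Lt cert that])
    fix B assume V: "common_kernel P0 Cs \<noteq> {0\<^sub>v \<epsilon>}"
      and B: "vec_space.basis_mat \<epsilon> (common_kernel P0 Cs) B"
    show "full_rank_on_interior (hermitian_monic_pencil d A) Lt \<longleftrightarrow>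
        full_rank_on_interior (hermitian_monic_pencil d A) (pencil_rmult Lt B)"
      by (rule full_rank_iff_restriction[OF A Lt cert B])
    show "pencil_rmult Lt B \<in> carrier_pencil \<delta> (dim_col B)"
      by (rule pencil_carrier_intros(3)[OF Lt basis_matD(1)[OF B]])
    show "0 < dim_col B" using basis_matD(4)[OF B] V by auto
    show "dim_col B < \<epsilon>" by (rule dim_common_kernel[OF cert nz B])
    then show "dim_col B \<le> \<delta>" using \<open>\<epsilon> \<le> \<delta>\<close> by simp
  qed
qed

end
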